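(* Assume A1–A5 (stated in the context), put $s=\frac{r}{2-4r}$ and, for $\gamma>0$, $$\bar{\mathbb{B}}^s_{2\infty}(\gamma)=\Bigl\{f=\sum_{j=1}^\infty\theta_j\phi_j:\ \theta_j\in\mathbb{R},\ \sup_{\lambda>0}\lambda^{2s}\sum_{j>\lambda}\theta_j^2\le\gamma\Bigr\}.$$ Let $f_n$ be a sequence of alternatives with $cn^{-r}\le\|f_n\|\le Cn^{-r}$, $0<c<C<\infty$. Then $f_n$ is purely $n^{-r}$-consistent if and only if for any $\varepsilon>0$ there are $\gamma_\varepsilon>0$ and a sequence of functions $f_{1n}\in\bar{\mathbb{B}}^s_{2\infty}(\gamma_\varepsilon)$ such that $$\|f_n-f_{1n}\|\le\varepsilon n^{-r}\qquad\text{and}\qquad \|f_n\|^2=\|f_{1n}\|^2+\|f_n-f_{1n}\|^2 .$$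
   Context: Setting. Fix $0<r<1/2$ and $\sigma>0$. One observes $dY_n(t)=f(t)\,dt+\frac{\sigma}{\sqrt n}\,dw(t)$, $t\in[0,1]$, with unknown signal $f\in L_2(0,1)$ and Gaussian white noise $dw$. Let $(\phi_j)_{j\ge1}$ be an orthonormal basis of $L_2(0,1)$; then $y_j=\int_0^1\phi_j\,dY_n=\theta_j+\frac{\sigma}{\sqrt n}\xi_j$ with $\theta_j=\int_0^1f\phi_j\,dt$ and $\xi_j$ i.i.d. standard Gaussian. The hypothesis is $f=0$; alternatives are $f=f_n$. The test statistics are $$T_n=\sum_{j=1}^\infty\kappa_{nj}^2y_j^2-\sigma^2n^{-1}\rho_n,\qquad \rho_n=\sum_{j=1}^\infty\kappa_{nj}^2 .$$ Assumptions on the coefficients. $[\cdot]$ is the integer part; $a_n\asymp b_n$ means that $a_n/b_n$ is bounded between two positive constants. A1: for each $n$ the sequence $\kappa_{nj}^2$, $j\ge1$, is decreasing. A2: there are positive constants $C_1,C_2$ such that $C_1<A_n=\sigma^{-4}n^2\sum_{j=1}^\infty\kappa_{nj}^4<C_2$ for each $n$. A3: there are positive constants $c_1,c_2$ such that $c_1n^{-2r}\le\rho_n\le c_2n^{-2r}$. Put $k_n=\sup\{k:\sum_{j<k}\kappa_{nj}^2\le\frac12\rho_n\}$ and $\kappa_n^2=\kappa_{nk_n}^2$. A4: there are $C_1$ and $\lambda>1$ such that $\kappa^2_{n,[(1+\delta)k_n]}<C_1(1+\delta)^{-\lambda}\kappa_n^2$ for any $\delta>0$ and each $n$. A5: $\kappa_{n1}^2\asymp\kappa_n^2$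 as $n\to\infty$, and for any $c>1$ there is $C>0$ such that $\kappa_{n,[ck_n]}^2\ge C\kappa_n^2$ for all $n$. Tests. A test $K_n$ generated by $T_n$ rejects the hypothesis when $T_n$ exceeds a threshold; $\alpha(K_n)$ and $\beta(K_n,f)$ are its type I error probability and its type II error probability at $f$. A sequence $f_n$ is consistent if for any $\alpha\in(0,1)$, for tests $K_n$ generated by $T_n$ with $\alpha(K_n)=\alpha(1+o(1))$, one has $\limsup_{n}\beta(K_n,f_n)<1-\alpha$; it is $n^{-r}$-consistent if additionally $\|f_n\|\asymp n^{-r}$. It is inconsistent if for each sequence of tests $K_n$ generated by $T_n$ one has $\liminf_{n}(\alpha(K_n)+\beta(K_n,f_n))\ge1$. For alternatives given only along a subsequence $n_i\to\infty$ the limits are taken along $n_i$. An $n^{-r}$-consistent sequence $f_n$ is purely $n^{-r}$-consistent if there does not exist a subsequence $f_{n_i}$ such that $f_{n_i}=f_{1n_i}+f_{2n_i}$, where $f_{2n_i}$ is orthogonal to $f_{1n_i}$, $\|f_{2n_i}\|>c_1n_i^{-r}$ for some $c_1>0$, and the sequence $f_{2n_i}$ is inconsistent. *)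

theory Defs
  imports "HOL-Probability.Probability" "HOL-Library.Landau_Symbols"
begin

text \<open>Elements of \<open>L\<^sub>2(0,1)\<close> are represented by functions; two representatives are identified when they agree
  almost everywhere. All sequences below are indexed by \<open>j \<ge> 1\<close> and \<open>n \<ge> 1\<close>; values at index 0
  are irrelevant.\<close>

abbreviation leb01 :: "real measure" where
  "leb01 \<equiv> lebesgue_on {0<..<1}"

definition L2 :: "(real \<Rightarrow> real) set" where
  "L2 = {f. f \<in> borel_measurable leb01 \<and> integrable leb01 (\<lambda>t. (f t)\<^sup>2)}"

definition inner_L2 :: "(real \<Rightarrow> real) \<Rightarrow> (real \<Rightarrow> real) \<Rightarrow> real" where
  "inner_L2 f g = (LINT t|leb01. f t * g t)"

definition norm_L2 :: "(real \<Rightarrow> real) \<Rightarrow> real" where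
  "norm_L2 f = sqrt (inner_L2 f f)"

definition orthonormal_basis_L2 :: "(nat \<Rightarrow> real \<Rightarrow> real) \<Rightarrow> bool" where
  "orthonormal_basis_L2 \<phi> \<longleftrightarrow>
     (\<forall>j\<ge>1. \<phi> j \<in> L2) \<and>
     (\<forall>i\<ge>1. \<forall>j\<ge>1. inner_L2 (\<phi> i) (\<phi> j) = (if i = j then 1 else 0)) \<and>
     (\<forall>f\<in>L2. (\<lambda>N. norm_L2 (\<lambda>t. f t - (\<Sum>j=1..N. inner_L2 f (\<phi> j) * \<phi> j t))) \<longlonglongrightarrow> 0)"

text \<open>As \<open>u > 0\<close>, the index set \<open>{j. u < real j}\<close> only contains indices \<open>j \<ge> 1\<close>.\<close>

definition Besov_body :: "(nat \<Rightarrow> real \<Rightarrow> real) \<Rightarrow> real \<Rightarrow> real \<Rightarrow> (real \<Rightarrow> real) set" where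
  "Besov_body \<phi> s \<gamma> = {f \<in> L2.
     (SUP u\<in>{0<..}. ereal (u powr (2 * s) * (\<Sum>\<^sub>\<infinity>j\<in>{j. u < real j}. (inner_L2 f (\<phi> j))\<^sup>2)))
       \<le> ereal \<gamma>}"

definition rho :: "(nat \<Rightarrow> nat \<Rightarrow> real) \<Rightarrow> nat \<Rightarrow> real" where
  "rho \<kappa> n = (\<Sum>j. (\<kappa> n (Suc j))\<^sup>2)"

definition k_index :: "(nat \<Rightarrow> nat \<Rightarrow> real) \<Rightarrow> nat \<Rightarrow> nat" where
  "k_index \<kappa> n = Sup {k. 1 \<le> k \<and> (\<Sum>j=1..<k. (\<kappa> n j)\<^sup>2) \<le> rho \<kappa> n / 2}"

definition kappa_sq :: "(nat \<Rightarrow> nat \<Rightarrow> real) \<Rightarrow> nat \<Rightarrow> real" where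
  "kappa_sq \<kappa> n = (\<kappa> n (k_index \<kappa> n))\<^sup>2"

definition same_order :: "(nat \<Rightarrow> real) \<Rightarrow> (nat \<Rightarrow> real) \<Rightarrow> bool" where
  "same_order a b \<longleftrightarrow> (\<exists>c1>0. \<exists>c2>0. \<forall>n\<ge>1. c1 \<le> a n / b n \<and> a n / b n \<le> c2)"

definition A1 :: "(nat \<Rightarrow> nat \<Rightarrow> real) \<Rightarrow> bool" where
  "A1 \<kappa> \<longleftrightarrow> (\<forall>n\<ge>1. antimono_on {1..} (\<lambda>j. (\<kappa> n j)\<^sup>2))"

definition A2 :: "real \<Rightarrow> (nat \<Rightarrow> nat \<Rightarrow> real) \<Rightarrow> bool" where
  "A2 \<sigma> \<kappa> \<longleftrightarrow> (\<exists>C1>0. \<exists>C2>0. \<forall>n\<ge>1.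
     C1 < (real n)\<^sup>2 / \<sigma> ^ 4 * (\<Sum>j. (\<kappa> n (Suc j)) ^ 4) \<and>
     (real n)\<^sup>2 / \<sigma> ^ 4 * (\<Sum>j. (\<kappa> n (Suc j)) ^ 4) < C2)"

text \<open>Finiteness of \<open>\<rho>\<^sub>n\<close>, implicit in the bounds, is stated explicitly because \<open>suminf\<close> is total;
  it also gives convergence of the series in \<open>A2\<close>.\<close>

definition A3 :: "real \<Rightarrow> (nat \<Rightarrow> nat \<Rightarrow> real) \<Rightarrow> bool" where
  "A3 r \<kappa> \<longleftrightarrow>
     (\<forall>n\<ge>1. summable (\<lambda>j. (\<kappa> n (Suc j))\<^sup>2)) \<and>
     (\<exists>c1>0. \<exists>c2>0. \<forall>n\<ge>1.
        c1 * real n powr (- 2 * r) \<le> rho \<kappa> n \<and> rho \<kappa> n \<le> c2 * real n powr (- 2 * r))"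

definition A4 :: "(nat \<Rightarrow> nat \<Rightarrow> real) \<Rightarrow> bool" where
  "A4 \<kappa> \<longleftrightarrow> (\<exists>C1 l. l > 1 \<and> (\<forall>\<delta>>0. \<forall>n\<ge>1.
     (\<kappa> n (nat \<lfloor>(1 + \<delta>) * real (k_index \<kappa> n)\<rfloor>))\<^sup>2
       < C1 * (1 + \<delta>) powr (- l) * kappa_sq \<kappa> n))"

definition A5 :: "(nat \<Rightarrow> nat \<Rightarrow> real) \<Rightarrow> bool" where
  "A5 \<kappa> \<longleftrightarrow> same_order (\<lambda>n. (\<kappa> n 1)\<^sup>2) (kappa_sq \<kappa>) \<and>
     (\<forall>c>1. \<exists>C>0. \<forall>n\<ge>1.
        (\<kappa> n (nat \<lfloor>c * real (k_index \<kappa> n)\<rfloor>))\<^sup>2 \<ge> C * kappa_sq \<kappa> n)"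

text \<open>\<open>iid_std_normal M \<xi>\<close>: the noise coordinates \<open>\<xi>\<^sub>j = \<integral>\<phi>\<^sub>j dw\<close>, \<open>j \<ge> 1\<close>, live on the
  probability space \<open>M\<close>. The law of the data for each signal \<open>f\<close> and each \<open>n\<close> is that of
  \<open>(y\<^sub>j)\<close> below.\<close>

definition iid_std_normal :: "'w measure \<Rightarrow> (nat \<Rightarrow> 'w \<Rightarrow> real) \<Rightarrow> bool" where
  "iid_std_normal M \<xi> \<longleftrightarrow> prob_space M \<and>
     prob_space.indep_vars M (\<lambda>_. borel) \<xi> {1..} \<and>
     (\<forall>j\<ge>1. distributed M lborel (\<xi> j) std_normal_density)"

definition obs ::
  "(nat \<Rightarrow> 'w \<Rightarrow> real) \<Rightarrow> real \<Rightarrow> (nat \<Rightarrow> real \<Rightarrow> real) \<Rightarrow> nat \<Rightarrow> (real \<Rightarrow> real) \<Rightarrow> nat \<Rightarrow> 'w \<Rightarrow> real" where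
  "obs \<xi> \<sigma> \<phi> n f j \<omega> = inner_L2 f (\<phi> j) + \<sigma> / sqrt (real n) * \<xi> j \<omega>"

definition test_stat ::
  "(nat \<Rightarrow> 'w \<Rightarrow> real) \<Rightarrow> real \<Rightarrow> (nat \<Rightarrow> real \<Rightarrow> real) \<Rightarrow> (nat \<Rightarrow> nat \<Rightarrow> real) \<Rightarrow>
    nat \<Rightarrow> (real \<Rightarrow> real) \<Rightarrow> 'w \<Rightarrow> real" where
  "test_stat \<xi> \<sigma> \<phi> \<kappa> n f \<omega> =
     (\<Sum>j. (\<kappa> n (Suc j))\<^sup>2 * (obs \<xi> \<sigma> \<phi> n f (Suc j) \<omega>)\<^sup>2) - \<sigma>\<^sup>2 / real n * rho \<kappa> n"

text \<open>A test generated by \<open>T\<^sub>n\<close> is given by its threshold \<open>x\<close>: it rejects iff \<open>T\<^sub>n > x\<close>.\<close>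

definition type_I_error ::
  "'w measure \<Rightarrow> (nat \<Rightarrow> 'w \<Rightarrow> real) \<Rightarrow> real \<Rightarrow> (nat \<Rightarrow> real \<Rightarrow> real) \<Rightarrow> (nat \<Rightarrow> nat \<Rightarrow> real) \<Rightarrow>
    nat \<Rightarrow> real \<Rightarrow> real" where
  "type_I_error M \<xi> \<sigma> \<phi> \<kappa> n x =
     measure M {\<omega> \<in> space M. test_stat \<xi> \<sigma> \<phi> \<kappa> n (\<lambda>_. 0) \<omega> > x}"

definition type_II_error ::
  "'w measure \<Rightarrow> (nat \<Rightarrow> 'w \<Rightarrow> real) \<Rightarrow> real \<Rightarrow> (nat \<Rightarrow> real \<Rightarrow> real) \<Rightarrow> (nat \<Rightarrow> nat \<Rightarrow> real) \<Rightarrow>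
    nat \<Rightarrow> real \<Rightarrow> (real \<Rightarrow> real) \<Rightarrow> real" where
  "type_II_error M \<xi> \<sigma> \<phi> \<kappa> n x f =
     measure M {\<omega> \<in> space M. test_stat \<xi> \<sigma> \<phi> \<kappa> n f \<omega> \<le> x}"

definition consistent ::
  "'w measure \<Rightarrow> (nat \<Rightarrow> 'w \<Rightarrow> real) \<Rightarrow> real \<Rightarrow> (nat \<Rightarrow> real \<Rightarrow> real) \<Rightarrow> (nat \<Rightarrow> nat \<Rightarrow> real) \<Rightarrow>
    (nat \<Rightarrow> real \<Rightarrow> real) \<Rightarrow> bool" where
  "consistent M \<xi> \<sigma> \<phi> \<kappa> f \<longleftrightarrow>
     (\<forall>\<alpha>\<in>{0<..<1}. \<forall>x :: nat \<Rightarrow> real.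
        (\<lambda>n. type_I_error M \<xi> \<sigma> \<phi> \<kappa> n (x n)) \<sim>[sequentially] (\<lambda>_. \<alpha>) \<longrightarrow>
        limsup (\<lambda>n. ereal (type_II_error M \<xi> \<sigma> \<phi> \<kappa> n (x n) (f n))) < ereal (1 - \<alpha>))"

definition rate_consistent ::
  "'w measure \<Rightarrow> (nat \<Rightarrow> 'w \<Rightarrow> real) \<Rightarrow> real \<Rightarrow> (nat \<Rightarrow> real \<Rightarrow> real) \<Rightarrow> (nat \<Rightarrow> nat \<Rightarrow> real) \<Rightarrow>
    real \<Rightarrow> (nat \<Rightarrow> real \<Rightarrow> real) \<Rightarrow> bool" where
  "rate_consistent M \<xi> \<sigma> \<phi> \<kappa> r f \<longleftrightarrow>
     consistent M \<xi> \<sigma> \<phi> \<kappa> f \<and> same_order (\<lambda>n. norm_L2 (f n)) (\<lambda>n. real n powr (- r))"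

text \<open>Inconsistency of alternatives \<open>g i\<close> given along a subsequence, \<open>g i\<close> being the alternative
  at sample size \<open>m i\<close>.\<close>

definition inconsistent_along ::
  "'w measure \<Rightarrow> (nat \<Rightarrow> 'w \<Rightarrow> real) \<Rightarrow> real \<Rightarrow> (nat \<Rightarrow> real \<Rightarrow> real) \<Rightarrow> (nat \<Rightarrow> nat \<Rightarrow> real) \<Rightarrow>
    (nat \<Rightarrow> nat) \<Rightarrow> (nat \<Rightarrow> real \<Rightarrow> real) \<Rightarrow> bool" where
  "inconsistent_along M \<xi> \<sigma> \<phi> \<kappa> m g \<longleftrightarrow>
     (\<forall>x :: nat \<Rightarrow> real.
        liminf (\<lambda>i. ereal (type_I_error M \<xi> \<sigma> \<phi> \<kappa> (m i) (x i) +
                           type_II_error M \<xi> \<sigma> \<phi> \<kappa> (m i) (x i) (g i))) \<ge> 1)"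

definition purely_consistent ::
  "'w measure \<Rightarrow> (nat \<Rightarrow> 'w \<Rightarrow> real) \<Rightarrow> real \<Rightarrow> (nat \<Rightarrow> real \<Rightarrow> real) \<Rightarrow> (nat \<Rightarrow> nat \<Rightarrow> real) \<Rightarrow>
    real \<Rightarrow> (nat \<Rightarrow> real \<Rightarrow> real) \<Rightarrow> bool" where
  "purely_consistent M \<xi> \<sigma> \<phi> \<kappa> r f \<longleftrightarrow>
     rate_consistent M \<xi> \<sigma> \<phi> \<kappa> r f \<and>
     \<not> (\<exists>(m :: nat \<Rightarrow> nat) f1 f2.
          strict_mono m \<and> (\<forall>i. m i \<ge> 1) \<and>
          (\<forall>i. f1 i \<in> L2 \<and> f2 i \<in> L2 \<and>
               (AE t in leb01. f (m i) t = f1 i t + f2 i t) \<and>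
               inner_L2 (f1 i) (f2 i) = 0) \<and>
          (\<exists>c1>0. \<forall>i. norm_L2 (f2 i) > c1 * real (m i) powr (- r)) \<and>
          inconsistent_along M \<xi> \<sigma> \<phi> \<kappa> m f2)"

end

theory Submission
  imports Defs
begin

text \<open>
  The test only sees the frequencies \<open>j\<close> of order at most \<open>k\<^sub>n\<close>, and the exponent
  \<open>s = r / (2 - 4r)\<close> is the one for which the Besov condition at a large multiple of \<open>k\<^sub>n\<close> leaves only a
  part of norm small compared with \<open>n\<^sup>-\<^sup>r\<close> above it.

  Divided by its standard deviation under the hypothesis, \<open>T\<^sub>n\<close> becomes
  \<open>\<Sum>\<^sub>j q\<^sub>j ((\<zeta>\<^sub>j + b\<^sub>j)\<^sup>2 - 1)\<close> with Gaussian \<open>\<zeta>\<^sub>j\<close>, \<open>\<Sum>\<^sub>j q\<^sub>j\<^sup>2 = 1/2\<close> and \<open>b\<^sub>j = \<theta>\<^sub>j \<surd>n / \<sigma>\<close>.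
  This is the null statistic plus the deterministic shift \<open>d = \<Sum>\<^sub>j q\<^sub>j b\<^sub>j\<^sup>2\<close> plus a linear term whose
  second moment is at most \<open>4 d max\<^sub>j q\<^sub>j\<close>. As \<open>max\<^sub>j q\<^sub>j\<close> is of order \<open>n\<^bsup>2r-1\<^esup>\<close>, it tends to \<open>0\<close>; hence
  the null statistic is asymptotically standard normal, uniformly in the threshold (\<open>uniform_clt\<close>), and
  the linear term is negligible. The shift \<open>d\<close> is of the order of \<open>n\<^sup>2 E\<^sub>n\<close>, where
  \<open>E\<^sub>n(f) = \<Sum>\<^sub>j \<kappa>\<^sub>n\<^sub>j\<^sup>2 \<theta>\<^sub>j\<^sup>2\<close>. So alternatives are inconsistent iff \<open>n\<^sup>2 E\<^sub>n\<close> tends to \<open>0\<close>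
  (\<open>inconsistent_if_energy_vanishes\<close>, \<open>energy_vanishes_if_inconsistent\<close>), and consistent as soon as it stays
  away from \<open>0\<close> (\<open>consistent_if_energy_bounded_below\<close>).

  The assumptions give \<open>k\<^sub>n\<close> of order \<open>n\<^bsup>2-4r\<^esup>\<close> and \<open>\<kappa>\<^sub>n\<^sup>2\<close> of order \<open>n\<^bsup>2r-2\<^esup>\<close>
  (\<open>orders\<close>). On \<open>j \<le> a k\<^sub>n\<close> the weights are comparable to \<open>\<kappa>\<^sub>n\<^sup>2\<close>, with constants depending on \<open>a\<close>, and beyond \<open>a k\<^sub>n\<close> they are at
  most of order \<open>\<kappa>\<^sub>n\<^sup>2 / a\<close>. For signals of norm of order \<open>n\<^sup>-\<^sup>r\<close> this makes both sides of the theorem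
  equivalent to the property \<open>low_frequency\<close>: for every \<open>\<epsilon>\<close> some \<open>a\<close> bounds the energy of
  \<open>f\<^sub>n\<close> above \<open>a k\<^sub>n\<close> by \<open>\<epsilon> n\<^bsup>-2r\<^esup>\<close>, for all \<open>n\<close>. If it fails, the parts of \<open>f\<^sub>n\<close> above growing multiples
  of \<open>k\<^sub>n\<close>, along suitable \<open>n = m\<^sub>i\<close>, form an inconsistent orthogonal component of norm of order \<open>n\<^sup>-\<^sup>r\<close>. If it holds, an
  inconsistent orthogonal component \<open>h\<close> has almost no low frequencies, so that
  \<open>\<parallel>h\<parallel>\<^sup>2 = \<langle>f\<^sub>n, h\<rangle>\<close> is \<open>o(n\<^bsup>-2r\<^esup>)\<close>. For the Besov side, truncation at \<open>a k\<^sub>n\<close> supplies \<open>f\<^sub>1\<^sub>n\<close>;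
  conversely the Besov condition at \<open>\<lambda> = a k\<^sub>n\<close>
  bounds the tail by a multiple of \<open>a\<^bsup>-2s\<^esup> n\<^bsup>-2r\<^esup>\<close>, because \<open>2s (2 - 4r) = 2r\<close>.
\<close>

section \<open>The standard normal distribution function\<close>

abbreviation Phi :: "real \<Rightarrow> real" where
  "Phi \<equiv> cdf std_normal_distribution"

text \<open>Strict positivity yields power: moving a threshold by a fixed amount changes the error by a fixed
  amount. The Lipschitz bound, whose constant \<open>1\<close> bounds the density, yields the absence of power
  against vanishing shifts.\<close>

lemma Phi_diff:
  assumes "a < b"
  shows "0 < Phi b - Phi a" "Phi b - Phi a \<le> b - a"
proof -
  interpret real_distribution std_normal_distribution by (rule real_dist_normal_dist)
  have eq: "Phi b - Phi a = measure std_normal_distribution {a<..b}"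
    using cdf_diff_eq[OF assms] .
  have em: "emeasure std_normal_distribution {a<..b} = (\<integral>\<^sup>+x. ennreal (std_normal_density x) * indicator {a<..b} x \<partial>lborel)"
    by (subst emeasure_density) auto
  have "emeasure std_normal_distribution {a<..b} \<noteq> 0"
  proof
    assume "emeasure std_normal_distribution {a<..b} = 0"
    then have "AE x in lborel. ennreal (std_normal_density x) * indicator {a<..b} x = 0"
      unfolding em by (subst (asm) nn_integral_0_iff_AE) auto
    then have "AE x in lborel. x \<notin> {a<..b}"
      by eventually_elim (use normal_density_pos[of 1 0] in
          \<open>auto simp: indicator_def ennreal_eq_0_iff not_le[symmetric] split: if_splits\<close>)
    then have "emeasure lborel {a<..b} = 0"
      by (subst (asm) AE_iff_null) (auto simp: null_sets_def greaterThanAtMost_def greaterThan_def atMost_def Int_def)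
    then show False using assms by simp
  qed
  then show "0 < Phi b - Phi a"
    unfolding eq by (simp add: emeasure_eq_measure zero_less_measure_iff)
  have le1: "std_normal_density x \<le> 1" for x
  proof -
    have "sqrt (2 * pi) \<ge> 1" using pi_gt3 by simp
    then have "1 / sqrt (2*pi) \<le> 1" by simp
    moreover have "exp (- x\<^sup>2 / 2) \<le> 1" by simp
    ultimately show ?thesis unfolding std_normal_density_def
      by (intro mult_le_one) auto
  qed
  have "emeasure std_normal_distribution {a<..b} \<le> (\<integral>\<^sup>+x. indicator {a<..b} x \<partial>lborel)"
    unfolding em using le1 by (intro nn_integral_mono) (auto simp: indicator_def)
  also have "\<dots> = ennreal (b - a)" using assms by simp
  finally show "Phi b - Phi a \<le> b - a"
    unfolding eq using assms by (simp add: emeasure_eq_measure)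
qed

lemma Phi_less_iff: "Phi a < Phi b \<longleftrightarrow> a < b"
  using Phi_diff(1)[of a b] Phi_diff(1)[of b a] by (cases a b rule: linorder_cases) auto

lemma isCont_Phi: "isCont Phi x"
proof -
  have "\<bar>Phi y - Phi x\<bar> \<le> \<bar>y - x\<bar>" for y
    using Phi_diff[of x y] Phi_diff[of y x] by (cases x y rule: linorder_cases) auto
  then have "(Phi \<longlongrightarrow> Phi x) (at x)"
    by (intro metric_tendsto_imp_tendsto[OF tendsto_ident_at]) (auto simp: dist_real_def)
  then show ?thesis by (simp add: isCont_def)
qed

lemma Phi_surj:
  assumes "0 < p" "p < 1"
  obtains z where "Phi z = p"
proof -
  interpret real_distribution std_normal_distribution by (rule real_dist_normal_dist)
  have "eventually (\<lambda>x. Phi x < p) at_bot" "eventually (\<lambda>x. Phi x > p) at_top"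
    using order_tendstoD[OF cdf_lim_at_bot] order_tendstoD[OF cdf_lim_at_top_prob] assms by auto
  then obtain a b where a: "\<And>x. x \<le> a \<Longrightarrow> Phi x < p" and b: "\<And>x. b \<le> x \<Longrightarrow> Phi x > p"
    unfolding eventually_at_bot_linorder eventually_at_top_linorder by blast
  have "Phi a < p" "Phi b > p" using a b by auto
  then have "a \<le> b" using Phi_less_iff[of a b] by linarith
  then have "\<exists>z\<ge>a. z \<le> b \<and> Phi z = p"
    using IVT[of Phi a p b] \<open>Phi a < p\<close> \<open>Phi b > p\<close> isCont_Phi by auto
  then show thesis using that by auto
qed

text \<open>Polya's theorem: both functions are monotone, so control at the \<open>i/m\<close>-quantiles of the continuous limit
  controls all points between two neighbouring quantiles. Uniformity matters because inconsistency
  quantifies over arbitrary sequences of thresholds.\<close>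

lemma cdf_convergence_uniform:
  assumes rd: "\<And>n. real_distribution (\<mu> n)"
    and conv: "weak_conv_m \<mu> std_normal_distribution" and "0 < \<epsilon>"
  shows "eventually (\<lambda>n. \<forall>x. \<bar>cdf (\<mu> n) x - Phi x\<bar> \<le> \<epsilon>) sequentially"
proof -
  obtain m :: nat where m: "2 / \<epsilon> < real m" using reals_Archimedean2 by blast
  have "0 < 2 / \<epsilon>" using \<open>0 < \<epsilon>\<close> by simp
  then have m0: "real m > 0" using m by linarith
  have m\<epsilon>: "2 / real m \<le> \<epsilon>" using m \<open>0 < \<epsilon>\<close> m0 by (simp add: field_simps)
  have "\<exists>z. Phi z = real i / real m" if "i \<in> {1..<m}" for i
    using Phi_surj[of "real i / real m"] that by (auto simp: field_simps)
  then obtain z where z: "\<And>i. i \<in> {1..<m} \<Longrightarrow> Phi (z i) = real i / real m" by metis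
  have "eventually (\<lambda>n. \<bar>cdf (\<mu> n) (z i) - Phi (z i)\<bar> < 1 / real m) sequentially" for i
  proof -
    have "(\<lambda>n. cdf (\<mu> n) (z i)) \<longlonglongrightarrow> Phi (z i)"
      using conv isCont_Phi unfolding weak_conv_m_def weak_conv_def by auto
    then have "eventually (\<lambda>n. dist (cdf (\<mu> n) (z i)) (Phi (z i)) < 1 / real m) sequentially"
      using m0 by (intro tendstoD) auto
    then show ?thesis by (simp add: dist_real_def)
  qed
  then have "eventually (\<lambda>n. \<forall>i\<in>{1..<m}. \<bar>cdf (\<mu> n) (z i) - Phi (z i)\<bar> < 1 / real m) sequentially"
    by (intro eventually_ball_finite) auto
  then show ?thesis
  proof eventually_elim
    case (elim n)
    interpret N: real_distribution std_normal_distribution by (rule real_dist_normal_dist)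
    interpret mu: real_distribution "\<mu> n" by (rule rd)
    show ?case
    proof
      fix x
      define i where "i = nat \<lfloor>real m * Phi x\<rfloor>"
      have "0 \<le> real m * Phi x" using N.cdf_nonneg by simp
      then have i: "real i \<le> real m * Phi x" "real m * Phi x < real i + 1"
        unfolding i_def by linarith+
      have "cdf (\<mu> n) x \<ge> Phi x - 2 / real m"
      proof (cases "i = 0")
        case True
        then have "Phi x < 1 / real m" using i m0 by (simp add: field_simps)
        moreover have "1 / real m \<le> 2 / real m" using m0 by (simp add: field_simps)
        ultimately show ?thesis using mu.cdf_nonneg[of x] by linarith
      next
        case False
        show ?thesis
        proof (cases "i < m")
          case True
          with False have im: "i \<in> {1..<m}" by auto
          have "real i / real m \<le> Phi x" using i m0 by (simp add: field_simps)
          then have "z i \<le> x" using Phi_less_iff[of x "z i"] z[OF im] by linarith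
          then have "cdf (\<mu> n) (z i) \<le> cdf (\<mu> n) x" by (rule mu.cdf_nondecreasing)
          moreover have "Phi x \<le> real i / real m + 1 / real m" using i m0 by (simp add: field_simps)
          moreover have "2 / real m = 1 / real m + 1 / real m" by simp
          ultimately show ?thesis using elim im z[OF im] by fastforce
        next
          case False
          then have "real m \<le> real i" by simp
          then have "1 \<le> Phi x" using i(1) m0
            by (metis less_eq_real_def mult.right_neutral mult_le_cancel_left_pos order_trans)
          have "Phi (x+1) > Phi x" using Phi_less_iff by simp
          then show ?thesis using \<open>1 \<le> Phi x\<close> N.cdf_bounded_prob[of "x+1"] by linarith
        qed
      qed
      moreover have "cdf (\<mu> n) x \<le> Phi x + 2 / real m"
      proof (cases "i + 1 < m")
        case True
        then have im: "i + 1 \<in> {1..<m}" by auto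
        have "Phi x < real (i+1) / real m" using i m0 by (simp add: field_simps)
        then have "x < z (i+1)" using Phi_less_iff[of x "z (i+1)"] z[OF im] by linarith
        then have "cdf (\<mu> n) x \<le> cdf (\<mu> n) (z (i+1))" by (intro mu.cdf_nondecreasing) auto
        moreover have "real (i + 1) / real m \<le> Phi x + 1 / real m" using i m0 by (simp add: field_simps)
        moreover have "2 / real m = 1 / real m + 1 / real m" by simp
        ultimately show ?thesis using elim im z[OF im] by fastforce
      next
        case False
        then have "real m \<le> real i + 1" by linarith
        then have "real m * 1 \<le> real m * (Phi x + 1 / real m)"
          using i(1) m0 by (simp add: distrib_left)
        then have "1 \<le> Phi x + 1 / real m" using m0 by simp
        moreover have "1 / real m \<le> 2 / real m" using m0 by (simp add: field_simps)
        ultimately show ?thesis using mu.cdf_bounded_prob[of x] by linarith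
      qed
      ultimately show "\<bar>cdf (\<mu> n) x - Phi x\<bar> \<le> \<epsilon>" using m\<epsilon> by linarith
    qed
  qed
qed

section \<open>Weighted sums of squares of shifted Gaussians\<close>

locale gaussian_sequence = prob_space M
  for M :: "'w measure" +
  fixes \<zeta> :: "nat \<Rightarrow> 'w \<Rightarrow> real"
  assumes indep: "indep_vars (\<lambda>_. borel) \<zeta> UNIV"
    and std_normal: "\<And>j. distributed M lborel (\<zeta> j) std_normal_density"
begin

lemma measurable_noise [measurable]: "\<zeta> j \<in> borel_measurable M"
  using indep by (auto simp: indep_vars_def2)

lemma distr_noise: "distr M borel (\<zeta> j) = std_normal_distribution"
proof -
  have "distr M borel (\<zeta> j) = distr M lborel (\<zeta> j)" by (rule distr_cong) auto
  then show ?thesis using std_normal[of j] by (simp add: distributed_def)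
qed

lemma integrable_noise_iff:
  fixes g :: "real \<Rightarrow> real"
  assumes [measurable]: "g \<in> borel_measurable borel"
  shows "integrable M (\<lambda>\<omega>. g (\<zeta> j \<omega>)) \<longleftrightarrow> integrable std_normal_distribution g"
  by (subst distr_noise[symmetric, of j], subst integrable_distr_eq) auto

lemma integral_noise:
  fixes g :: "real \<Rightarrow> real"
  assumes [measurable]: "g \<in> borel_measurable borel"
  shows "expectation (\<lambda>\<omega>. g (\<zeta> j \<omega>)) = (LINT x|std_normal_distribution. g x)"
  by (subst distr_noise[symmetric, of j], subst integral_distr) auto

lemma integrable_noise_power [simp]: "integrable M (\<lambda>\<omega>. \<zeta> j \<omega> ^ k)"
  by (subst integrable_noise_iff[of "\<lambda>x. x ^ k"]) (auto intro: integrable_std_normal_distribution_moment)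

lemma noise_moments:
  "expectation (\<lambda>\<omega>. \<zeta> j \<omega>) = 0" "expectation (\<lambda>\<omega>. (\<zeta> j \<omega>)\<^sup>2) = 1" "expectation (\<lambda>\<omega>. \<zeta> j \<omega> ^ 4) = 3"
proof -
  show "expectation (\<lambda>\<omega>. \<zeta> j \<omega>) = 0"
    using integral_noise[of "\<lambda>x. x"] integral_std_normal_distribution_moment_odd[of 1] by simp
  show "expectation (\<lambda>\<omega>. (\<zeta> j \<omega>)\<^sup>2) = 1"
    using integral_noise[of "\<lambda>x. x ^ 2"] std_normal_distribution_even_moments[of 1] by (simp add: fact_numeral)
  show "expectation (\<lambda>\<omega>. \<zeta> j \<omega> ^ 4) = 3"
    using integral_noise[of "\<lambda>x. x ^ 4"] std_normal_distribution_even_moments[of 2] by (simp add: fact_numeral)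
qed

lemma noise_uncorrelated:
  "integrable M (\<lambda>\<omega>. \<zeta> i \<omega> * \<zeta> j \<omega>)"
  "expectation (\<lambda>\<omega>. \<zeta> i \<omega> * \<zeta> j \<omega>) = (if i = j then 1 else 0)"
proof -
  have one: "integrable M (\<zeta> k)" for k using integrable_noise_power[of k 1] by simp
  have "integrable M (\<lambda>\<omega>. \<zeta> i \<omega> * \<zeta> j \<omega>) \<and> expectation (\<lambda>\<omega>. \<zeta> i \<omega> * \<zeta> j \<omega>) = (if i = j then 1 else 0)"
  proof (cases "i = j")
    case True
    then show ?thesis using noise_moments(2)[of j] integrable_noise_power[of j 2]
      by (simp add: power2_eq_square)
  next
    case False
    have iv: "indep_vars (\<lambda>_. borel) \<zeta> {i, j}"
      using indep by (rule indep_vars_subset) auto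
    have "integrable M (\<lambda>\<omega>. \<Prod>k\<in>{i, j}. \<zeta> k \<omega>)"
      "expectation (\<lambda>\<omega>. \<Prod>k\<in>{i, j}. \<zeta> k \<omega>) = (\<Prod>k\<in>{i, j}. expectation (\<zeta> k))"
      by (intro indep_vars_integrable indep_vars_lebesgue_integral iv one finite.intros)+
    then show ?thesis using False noise_moments(1) by simp
  qed
  then show "integrable M (\<lambda>\<omega>. \<zeta> i \<omega> * \<zeta> j \<omega>)"
    "expectation (\<lambda>\<omega>. \<zeta> i \<omega> * \<zeta> j \<omega>) = (if i = j then 1 else 0)" by auto
qed

lemma expectation_linear_form_sq:
  "expectation (\<lambda>\<omega>. (\<Sum>j<N. a j * \<zeta> j \<omega>)\<^sup>2) = (\<Sum>j<N. (a j)\<^sup>2)"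
  "integrable M (\<lambda>\<omega>. (\<Sum>j<N. a j * \<zeta> j \<omega>)\<^sup>2)"
proof -
  have eq: "(\<lambda>\<omega>. (\<Sum>j<N. a j * \<zeta> j \<omega>)\<^sup>2) = (\<lambda>\<omega>. \<Sum>i<N. \<Sum>j<N. (a i * a j) * (\<zeta> i \<omega> * \<zeta> j \<omega>))"
    by (simp add: power2_eq_square sum_product algebra_simps)
  show "integrable M (\<lambda>\<omega>. (\<Sum>j<N. a j * \<zeta> j \<omega>)\<^sup>2)"
    unfolding eq by (intro Bochner_Integration.integrable_sum integrable_mult_right noise_uncorrelated)
  have "expectation (\<lambda>\<omega>. (\<Sum>j<N. a j * \<zeta> j \<omega>)\<^sup>2) = (\<Sum>i<N. \<Sum>j<N. (a i * a j) * (if i = j then 1 else 0))"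
    unfolding eq
    by (subst Bochner_Integration.integral_sum, (intro Bochner_Integration.integrable_sum integrable_mult_right noise_uncorrelated)[1],
        intro sum.cong refl, subst Bochner_Integration.integral_sum,
        (intro integrable_mult_right noise_uncorrelated)[1], intro sum.cong refl)
      (subst integral_mult_right_zero, subst noise_uncorrelated, rule refl)
  also have "\<dots> = (\<Sum>j<N. (a j)\<^sup>2)"
    by (simp add: if_distrib sum.delta power2_eq_square cong: if_cong)
  finally show "expectation (\<lambda>\<omega>. (\<Sum>j<N. a j * \<zeta> j \<omega>)\<^sup>2) = (\<Sum>j<N. (a j)\<^sup>2)" .
qed

text \<open>The target \<open>exp (- t\<^sup>2)\<close> is the characteristic function of a Gaussian of variance \<open>2\<close>, the variance of
  \<open>\<zeta>\<^sup>2 - 1\<close>; both functions agree with \<open>1 - t\<^sup>2\<close> up to an error of third order.\<close>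

lemma char_centred_square:
  obtains B where "0 \<le> B"
    "\<And>j t. cmod (char (distr M borel (\<lambda>\<omega>. (\<zeta> j \<omega>)\<^sup>2 - 1)) t - of_real (exp (- t\<^sup>2))) \<le> B * \<bar>t\<bar> ^ 3 + t ^ 4 / 2"
proof -
  define D where "D = (LINT x|std_normal_distribution. \<bar>x\<^sup>2 - 1\<bar> ^ 3)"
  have intD: "integrable std_normal_distribution (\<lambda>x. \<bar>x\<^sup>2 - 1\<bar> ^ 3)"
  proof (rule Bochner_Integration.integrable_bound)
    have "(x\<^sup>2 + 1)^3 = x^6 + 3 * x^4 + 3 * x^2 + 1" for x :: real
      by algebra
    moreover have "integrable std_normal_distribution (\<lambda>x. x^6 + 3 * x^4 + 3 * x^2 + 1)"
      using integrable_std_normal_distribution_moment[of 0]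
      by (intro Bochner_Integration.integrable_add integrable_mult_right integrable_std_normal_distribution_moment) auto
    ultimately show "integrable std_normal_distribution (\<lambda>x. (x\<^sup>2 + 1)^3)" by simp
    show "AE x in std_normal_distribution. norm (\<bar>x\<^sup>2 - 1\<bar> ^ 3) \<le> norm ((x\<^sup>2 + 1) ^ 3)"
    proof (intro AE_I2)
      fix x :: real
      have "\<bar>x\<^sup>2 - 1\<bar> \<le> x\<^sup>2 + 1" by (intro abs_leI) auto
      then have "\<bar>x\<^sup>2 - 1\<bar> ^ 3 \<le> (x\<^sup>2 + 1) ^ 3" by (intro power_mono) auto
      then show "norm (\<bar>x\<^sup>2 - 1\<bar> ^ 3) \<le> norm ((x\<^sup>2 + 1) ^ 3)" by simp
    qed
  qed auto
  have "0 \<le> D" unfolding D_def by simp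
  have main: "cmod (char (distr M borel (\<lambda>\<omega>. (\<zeta> j \<omega>)\<^sup>2 - 1)) t - of_real (exp (- t\<^sup>2))) \<le> D / 6 * \<bar>t\<bar> ^ 3 + t ^ 4 / 2" for j t
  proof -
    let ?X = "\<lambda>\<omega>. (\<zeta> j \<omega>)\<^sup>2 - 1"
    have ex: "(\<lambda>\<omega>. (?X \<omega>)\<^sup>2) = (\<lambda>\<omega>. \<zeta> j \<omega> ^ 4 - 2 * (\<zeta> j \<omega>)\<^sup>2 + 1)"
      by (intro ext) algebra
    have E1: "expectation ?X = 0" by (simp add: noise_moments prob_space)
    have I2: "integrable M (\<lambda>\<omega>. (?X \<omega>)\<^sup>2)" unfolding ex by simp
    have E2: "expectation (\<lambda>\<omega>. (?X \<omega>)\<^sup>2) = 2" unfolding ex by (simp add: noise_moments prob_space)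
    have "variance ?X = 2" using E1 E2 by simp
    then have "cmod (char (distr M borel ?X) t - (1 - t^2 * 2 / 2)) \<le>
        (t^2 / 6) * expectation (\<lambda>x. min (6 * (?X x)^2) (\<bar>t\<bar> * \<bar>?X x\<bar>^3))"
      using char_approx3'[of ?X 2 "distr M borel ?X" t] E1 I2 by simp
    also have "\<dots> \<le> (t^2 / 6) * (\<bar>t\<bar> * D)"
    proof (rule mult_left_mono)
      have i3: "integrable M (\<lambda>\<omega>. \<bar>?X \<omega>\<bar>^3)"
        using integrable_noise_iff[of "\<lambda>x. \<bar>x\<^sup>2 - 1\<bar> ^ 3"] intD by simp
      have "expectation (\<lambda>x. min (6 * (?X x)^2) (\<bar>t\<bar> * \<bar>?X x\<bar>^3)) \<le> expectation (\<lambda>x. \<bar>t\<bar> * \<bar>?X x\<bar>^3)"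
        using i3 I2 by (intro integral_mono Bochner_Integration.integrable_min integrable_mult_right) auto
      also have "\<dots> = \<bar>t\<bar> * D"
        using integral_noise[of "\<lambda>x. \<bar>x\<^sup>2 - 1\<bar> ^ 3"] by (simp add: D_def)
      finally show "expectation (\<lambda>x. min (6 * (?X x)^2) (\<bar>t\<bar> * \<bar>?X x\<bar>^3)) \<le> \<bar>t\<bar> * D" .
    qed simp
    also have "\<dots> = D / 6 * \<bar>t\<bar>^3" by (simp add: power3_eq_cube power2_eq_square abs_mult_self_eq)
    finally have 1: "cmod (char (distr M borel ?X) t - of_real (1 - t\<^sup>2)) \<le> D / 6 * \<bar>t\<bar>^3" by simp
    have 2: "\<bar>(1 - t\<^sup>2) - exp (- t\<^sup>2)\<bar> \<le> t ^ 4 / 2"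
    proof -
      have a: "1 - t\<^sup>2 \<le> exp (- t\<^sup>2)" using exp_ge_add_one_self[of "- t\<^sup>2"] by simp
      have "1 + t\<^sup>2 + (t\<^sup>2)\<^sup>2 / 2 \<le> exp (t\<^sup>2)" by (rule exp_lower_Taylor_quadratic) simp
      then have "exp (- t\<^sup>2) \<le> 1 / (1 + t\<^sup>2 + (t\<^sup>2)\<^sup>2 / 2)"
        unfolding exp_minus by (simp add: inverse_eq_divide frac_le add_pos_nonneg)
      also have "\<dots> \<le> 1 - t\<^sup>2 + (t\<^sup>2)\<^sup>2 / 2"
      proof -
        have p: "0 < 1 + t\<^sup>2 + (t\<^sup>2)\<^sup>2 / 2" by (simp add: add_pos_nonneg)
        have "(1 - u + u\<^sup>2 / 2) * (1 + u + u\<^sup>2 / 2) = 1 + (u\<^sup>2)\<^sup>2 / 4" for u :: real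
          by (simp add: field_simps power2_eq_square)
        note this[of "t\<^sup>2"]
        then show ?thesis using p by (simp add: divide_le_eq)
      qed
      \<comment> \<open>Reciprocal of the quadratic Taylor bound for \<open>exp\<close>.\<close>
      finally have "exp (- t\<^sup>2) \<le> 1 - t\<^sup>2 + t ^ 4 / 2" by (simp add: power_mult[symmetric])
      with a show ?thesis by linarith
    qed
    have "cmod (char (distr M borel ?X) t - of_real (exp (- t\<^sup>2))) \<le>
      cmod (char (distr M borel ?X) t - of_real (1 - t\<^sup>2)) + cmod (of_real (1 - t\<^sup>2) - of_real (exp (- t\<^sup>2)))"
      using norm_triangle_ineq[of "char (distr M borel ?X) t - of_real (1 - t\<^sup>2)" "of_real (1 - t\<^sup>2) - of_real (exp (- t\<^sup>2))"]
      by (simp add: algebra_simps)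
    also have "cmod (of_real (1 - t\<^sup>2) - of_real (exp (- t\<^sup>2))) = \<bar>(1 - t\<^sup>2) - exp (- t\<^sup>2)\<bar>"
      by (metis norm_of_real of_real_diff)
    finally show ?thesis using 1 2 by linarith
  qed
  show thesis using that[of "D / 6"] \<open>0 \<le> D\<close> main by auto
qed

text \<open>The normalisation \<open>1/2\<close> gives \<open>quad_form q (\<lambda>_. 0)\<close> unit variance, as \<open>\<zeta>\<^sup>2 - 1\<close> has variance \<open>2\<close>. A small
  \<open>\<delta>\<close> is the Lindeberg-type condition that no single coordinate dominates.\<close>

definition unit_weights :: "(nat \<Rightarrow> real) \<Rightarrow> real \<Rightarrow> bool" where
  "unit_weights q \<delta> \<longleftrightarrow> (\<forall>j. 0 \<le> q j \<and> q j \<le> \<delta>) \<and> summable q \<and> (\<lambda>j. (q j)\<^sup>2) sums (1/2)"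

definition quad_form :: "(nat \<Rightarrow> real) \<Rightarrow> (nat \<Rightarrow> real) \<Rightarrow> 'w \<Rightarrow> real" where
  "quad_form q b \<omega> = (\<Sum>j. q j * ((\<zeta> j \<omega> + b j)\<^sup>2 - 1))"

lemma measurable_quad_form [measurable]: "quad_form q b \<in> borel_measurable M"
  unfolding quad_form_def[abs_def] by measurable

lemma AE_summable_weighted_squares:
  assumes "\<And>j. 0 \<le> q j" "summable q"
  shows "AE \<omega> in M. summable (\<lambda>j. q j * (\<zeta> j \<omega>)\<^sup>2)"
proof -
  have E: "(\<integral>\<^sup>+\<omega>. ennreal (q j * (\<zeta> j \<omega>)\<^sup>2) \<partial>M) = ennreal (q j)" for j
    by (subst nn_integral_eq_integral) (auto simp: assms noise_moments)
  have "(\<integral>\<^sup>+\<omega>. (\<Sum>j. ennreal (q j * (\<zeta> j \<omega>)\<^sup>2)) \<partial>M) = (\<Sum>j. ennreal (q j))"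
    by (subst nn_integral_suminf) (auto simp: E)
  also have "\<dots> = ennreal (suminf q)" by (rule suminf_ennreal2) (use assms in auto)
  finally have "(\<integral>\<^sup>+\<omega>. (\<Sum>j. ennreal (q j * (\<zeta> j \<omega>)\<^sup>2)) \<partial>M) \<noteq> \<infinity>" by simp
  then have "AE \<omega> in M. (\<Sum>j. ennreal (q j * (\<zeta> j \<omega>)\<^sup>2)) \<noteq> \<infinity>"
    by (intro nn_integral_PInf_AE) auto
  then show ?thesis
    by eventually_elim (intro summable_suminf_not_top, use assms in auto)
qed

text \<open>The characteristic function of a partial sum is a product, compared factor by factor with the Gaussian
  one. Each factor contributes at most \<open>q\<^sub>j\<^sup>2\<close> times a constant that vanishes with \<open>\<delta>\<close>, and \<open>\<Sum> q\<^sub>j\<^sup>2 = 1/2\<close>, so the error is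
  uniform in the number of summands and passes to the infinite sum.\<close>

lemma quad_form_char_bound:
  obtains B where "0 \<le> B"
    "\<And>q \<delta> t. unit_weights q \<delta> \<Longrightarrow>
      cmod (char (distr M borel (quad_form q (\<lambda>_. 0))) t - of_real (exp (- t\<^sup>2 / 2)))
        \<le> (B * \<bar>t\<bar> ^ 3 * \<delta> + t ^ 4 * \<delta>\<^sup>2 / 2) / 2"
proof -
  obtain B where B: "0 \<le> B"
    "\<And>j t. cmod (char (distr M borel (\<lambda>\<omega>. (\<zeta> j \<omega>)\<^sup>2 - 1)) t - of_real (exp (- t\<^sup>2))) \<le> B * \<bar>t\<bar> ^ 3 + t ^ 4 / 2"
    using char_centred_square by blast
  have main: "cmod (char (distr M borel (quad_form q (\<lambda>_. 0))) t - of_real (exp (- t\<^sup>2 / 2)))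
        \<le> (B * \<bar>t\<bar> ^ 3 * \<delta> + t ^ 4 * \<delta>\<^sup>2 / 2) / 2" if uw: "unit_weights q \<delta>" for q \<delta> t
  proof -
    let ?S = "\<lambda>N \<omega>. \<Sum>j<N. q j * ((\<zeta> j \<omega>)\<^sup>2 - 1)"
    let ?c = "B * \<bar>t\<bar> ^ 3 * \<delta> + t ^ 4 * \<delta>\<^sup>2 / 2"
    have q: "\<And>j. 0 \<le> q j" "\<And>j. q j \<le> \<delta>" "summable q" "(\<lambda>j. (q j)\<^sup>2) sums (1/2)"
      using uw by (auto simp: unit_weights_def)
    have \<delta>: "0 \<le> \<delta>" using q(1)[of 0] q(2)[of 0] by linarith
    have partial: "cmod (char (distr M borel (?S N)) t - of_real (exp (- t\<^sup>2 * (\<Sum>j<N. (q j)\<^sup>2)))) \<le> ?c / 2" for N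
    proof -
      let ?\<psi> = "\<lambda>j. char (distr M borel (\<lambda>\<omega>. q j * ((\<zeta> j \<omega>)\<^sup>2 - 1))) t"
      have iv: "indep_vars (\<lambda>_. borel) (\<lambda>j \<omega>. q j * ((\<zeta> j \<omega>)\<^sup>2 - 1)) {..<N}"
        by (rule indep_vars_compose2[OF indep_vars_subset[OF indep]]) auto
      have \<psi>: "?\<psi> j = char (distr M borel (\<lambda>\<omega>. (\<zeta> j \<omega>)\<^sup>2 - 1)) (t * q j)" for j
        by (simp add: char_def integral_distr mult.assoc)
      have "exp (- t\<^sup>2 * (\<Sum>j<N. (q j)\<^sup>2)) = (\<Prod>j<N. exp (- (t * q j)\<^sup>2))"
        by (simp add: exp_sum[symmetric] sum_distrib_left power_mult_distrib sum_negf)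
      then have "cmod (char (distr M borel (?S N)) t - of_real (exp (- t\<^sup>2 * (\<Sum>j<N. (q j)\<^sup>2)))) =
        cmod ((\<Prod>j<N. ?\<psi> j) - (\<Prod>j<N. of_real (exp (- (t * q j)\<^sup>2))))"
        by (simp add: char_distr_sum[OF iv])
      also have "\<dots> \<le> (\<Sum>j<N. cmod (?\<psi> j - of_real (exp (- (t * q j)\<^sup>2))))"
      proof (rule norm_prod_diff)
        show "cmod (?\<psi> j) \<le> 1" for j
        proof -
          interpret D: real_distribution "distr M borel (\<lambda>\<omega>. q j * ((\<zeta> j \<omega>)\<^sup>2 - 1))"
            by (rule real_distribution_distr) auto
          show ?thesis by (rule D.cmod_char_le_1)
        qed
      qed auto
      also have "\<dots> \<le> (\<Sum>j<N. ?c * (q j)\<^sup>2)"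
      proof (rule sum_mono)
        fix j
        have "cmod (?\<psi> j - of_real (exp (- (t * q j)\<^sup>2))) \<le> B * \<bar>t * q j\<bar> ^ 3 + (t * q j) ^ 4 / 2"
          unfolding \<psi> by (rule B)
        also have "\<dots> = (B * \<bar>t\<bar> ^ 3 * q j + t ^ 4 * (q j)\<^sup>2 / 2) * (q j)\<^sup>2"
          using q(1)[of j]
          by (simp add: abs_mult power_mult_distrib algebra_simps power2_eq_square power3_eq_cube power4_eq_xxxx)
        also have "\<dots> \<le> ?c * (q j)\<^sup>2"
          using q(1)[of j] q(2)[of j] B(1)
          by (intro mult_right_mono add_mono mult_left_mono divide_right_mono power_mono) auto
        finally show "cmod (?\<psi> j - of_real (exp (- (t * q j)\<^sup>2))) \<le> ?c * (q j)\<^sup>2" .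
      qed
      also have "\<dots> = ?c * (\<Sum>j<N. (q j)\<^sup>2)" by (simp add: sum_distrib_left)
      also have "\<dots> \<le> ?c * (1/2)"
      proof (rule mult_left_mono)
        have "(\<Sum>j<N. (q j)\<^sup>2) \<le> suminf (\<lambda>j. (q j)\<^sup>2)"
          using q(4) by (intro sum_le_suminf) (auto simp: sums_iff)
        then show "(\<Sum>j<N. (q j)\<^sup>2) \<le> 1/2" using q(4) by (simp add: sums_iff)
        show "0 \<le> ?c" using B(1) \<delta> by simp
      qed
      finally show ?thesis by simp
    qed
    have ae: "AE \<omega> in M. (\<lambda>N. ?S N \<omega>) \<longlonglongrightarrow> quad_form q (\<lambda>_. 0) \<omega>"
      using AE_summable_weighted_squares[of q, OF q(1) q(3)]
    proof eventually_elim
      case (elim \<omega>)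
      have "summable (\<lambda>j. q j * (\<zeta> j \<omega>)\<^sup>2 - q j)" by (intro summable_diff elim q)
      then have "summable (\<lambda>j. q j * ((\<zeta> j \<omega>)\<^sup>2 - 1))" by (simp add: algebra_simps)
      then show ?case unfolding quad_form_def by (simp add: summable_LIMSEQ)
    qed
    have "(\<lambda>N. char (distr M borel (?S N)) t) \<longlonglongrightarrow> char (distr M borel (quad_form q (\<lambda>_. 0))) t"
    proof -
      have "(\<lambda>N. CLINT \<omega>|M. iexp (t * ?S N \<omega>)) \<longlonglongrightarrow> (CLINT \<omega>|M. iexp (t * quad_form q (\<lambda>_. 0) \<omega>))"
      proof (rule integral_dominated_convergence[where w = "\<lambda>_. 1"])
        show "AE \<omega> in M. (\<lambda>N. iexp (t * ?S N \<omega>)) \<longlonglongrightarrow> iexp (t * quad_form q (\<lambda>_. 0) \<omega>)"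
          using ae by eventually_elim (intro tendsto_intros)
      qed auto
      then show ?thesis by (simp add: char_def integral_distr)
    qed
    moreover have "(\<lambda>N. of_real (exp (- t\<^sup>2 * (\<Sum>j<N. (q j)\<^sup>2))) :: complex) \<longlonglongrightarrow> of_real (exp (- t\<^sup>2 * (1/2)))"
      using q(4) unfolding sums_def by (intro tendsto_intros)
    ultimately have "(\<lambda>N. cmod (char (distr M borel (?S N)) t - of_real (exp (- t\<^sup>2 * (\<Sum>j<N. (q j)\<^sup>2))))) \<longlonglongrightarrow>
       cmod (char (distr M borel (quad_form q (\<lambda>_. 0))) t - of_real (exp (- t\<^sup>2 * (1/2))))"
      by (intro tendsto_norm tendsto_diff)
    then have "cmod (char (distr M borel (quad_form q (\<lambda>_. 0))) t - of_real (exp (- t\<^sup>2 * (1/2)))) \<le> ?c / 2"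
      by (rule LIMSEQ_le_const2) (use partial in auto)
    then show ?thesis by simp
  qed
  show thesis using that B(1) main by blast
qed

text \<open>A central limit theorem for infinite triangular arrays in a form free of sequences: if it failed,
  offending weights for \<open>\<delta> = 1/(n+1)\<close> would contradict Levy's continuity theorem.\<close>

lemma uniform_clt:
  assumes "0 < \<epsilon>"
  obtains \<delta> where "0 < \<delta>"
    "\<And>q x. unit_weights q \<delta> \<Longrightarrow> \<bar>cdf (distr M borel (quad_form q (\<lambda>_. 0))) x - Phi x\<bar> \<le> \<epsilon>"
proof -
  have "\<exists>\<delta>>0. \<forall>q x. unit_weights q \<delta> \<longrightarrow> \<bar>cdf (distr M borel (quad_form q (\<lambda>_. 0))) x - Phi x\<bar> \<le> \<epsilon>"
  proof (rule ccontr)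
    assume "\<not> ?thesis"
    then have "\<exists>q. unit_weights q (1 / Suc n) \<and>
        (\<exists>x. \<bar>cdf (distr M borel (quad_form q (\<lambda>_. 0))) x - Phi x\<bar> > \<epsilon>)" for n :: nat
      by (auto simp: not_le)
    then obtain q where q: "\<And>n. unit_weights (q n) (1 / Suc n)"
      and bad: "\<And>n. \<exists>x. \<bar>cdf (distr M borel (quad_form (q n) (\<lambda>_. 0))) x - Phi x\<bar> > \<epsilon>"
      by metis
    let ?\<mu> = "\<lambda>n. distr M borel (quad_form (q n) (\<lambda>_. 0))"
    have rd: "real_distribution (?\<mu> n)" for n by (rule real_distribution_distr) auto
    obtain B where "0 \<le> B" and B: "\<And>q \<delta> t. unit_weights q \<delta> \<Longrightarrow>
      cmod (char (distr M borel (quad_form q (\<lambda>_. 0))) t - of_real (exp (- t\<^sup>2 / 2)))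
        \<le> (B * \<bar>t\<bar> ^ 3 * \<delta> + t ^ 4 * \<delta>\<^sup>2 / 2) / 2"
      by (rule quad_form_char_bound, rule that)
    have "weak_conv_m ?\<mu> std_normal_distribution"
    proof (rule levy_continuity[OF rd real_dist_normal_dist])
      fix t
      have "(\<lambda>n. char (?\<mu> n) t - of_real (exp (- t\<^sup>2 / 2))) \<longlonglongrightarrow> 0"
      proof (rule Lim_null_comparison)
        show "eventually (\<lambda>n. norm (char (?\<mu> n) t - of_real (exp (- t\<^sup>2 / 2))) \<le>
           (B * \<bar>t\<bar> ^ 3 * (1 / Suc n) + t ^ 4 * (1 / Suc n)\<^sup>2 / 2) / 2) sequentially"
          using B[OF q] by auto
        have "(\<lambda>n. 1 / real (Suc n)) \<longlonglongrightarrow> 0"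
          using LIMSEQ_inverse_real_of_nat by (simp add: inverse_eq_divide)
        then have "(\<lambda>n. (B * \<bar>t\<bar> ^ 3 * (1 / real (Suc n)) + t ^ 4 * (1 / real (Suc n))\<^sup>2 / 2) / 2) \<longlonglongrightarrow>
          (B * \<bar>t\<bar> ^ 3 * 0 + t ^ 4 * 0\<^sup>2 / 2) / 2"
          by (intro tendsto_intros) auto
        then show "(\<lambda>n. (B * \<bar>t\<bar> ^ 3 * (1 / real (Suc n)) + t ^ 4 * (1 / real (Suc n))\<^sup>2 / 2) / 2) \<longlonglongrightarrow> 0"
          by simp
      qed
      then have "(\<lambda>n. char (?\<mu> n) t) \<longlonglongrightarrow> of_real (exp (- t\<^sup>2 / 2))"
        by (simp add: LIM_zero_iff)
      then show "(\<lambda>n. char (?\<mu> n) t) \<longlonglongrightarrow> char std_normal_distribution t"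
        by (simp add: char_std_normal_distribution)
    qed
    from cdf_convergence_uniform[OF rd this assms]
    have "eventually (\<lambda>n. False) sequentially"
      by eventually_elim (use bad in \<open>auto simp: not_le[symmetric]\<close>)
    then show False by simp
  qed
  then show thesis using that by auto
qed

lemma signal_energy_nonneg:
  assumes "unit_weights q \<delta>" "summable (\<lambda>j. (b j)\<^sup>2)"
  shows "summable (\<lambda>j. q j * (b j)\<^sup>2)" "0 \<le> (\<Sum>j. q j * (b j)\<^sup>2)"
proof -
  have q: "\<And>j. 0 \<le> q j" "\<And>j. q j \<le> \<delta>"
    using assms(1) by (auto simp: unit_weights_def)
  show "summable (\<lambda>j. q j * (b j)\<^sup>2)"
    by (rule summable_comparison_test'[OF summable_mult[OF assms(2), of \<delta>], of 0])
      (use q in \<open>auto intro!: mult_right_mono\<close>)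
  then show "0 \<le> (\<Sum>j. q j * (b j)\<^sup>2)" by (intro suminf_nonneg) (use q in auto)
qed

text \<open>Expanding the square splits the statistic into the null statistic, the deterministic shift and a linear
  form in the noise, all three convergent almost surely.\<close>

lemma AE_quad_form_limit:
  assumes uw: "unit_weights q \<delta>" and b: "summable (\<lambda>j. (b j)\<^sup>2)"
  shows "AE \<omega> in M. (\<lambda>N. \<Sum>j<N. 2 * q j * b j * \<zeta> j \<omega>) \<longlonglongrightarrow>
    quad_form q b \<omega> - quad_form q (\<lambda>_. 0) \<omega> - (\<Sum>j. q j * (b j)\<^sup>2)"
proof -
  have q: "\<And>j. 0 \<le> q j" "\<And>j. q j \<le> \<delta>" "summable q"
    using uw by (auto simp: unit_weights_def)
  have sb: "summable (\<lambda>j. q j * (b j)\<^sup>2)" by (rule signal_energy_nonneg[OF uw b])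
  show ?thesis
    using AE_summable_weighted_squares[of q, OF q(1) q(3)]
  proof eventually_elim
    case (elim \<omega>)
    have s1: "summable (\<lambda>j. q j * ((\<zeta> j \<omega>)\<^sup>2 - 1))"
      using summable_diff[OF elim q(3)] by (simp add: algebra_simps)
    have s2: "summable (\<lambda>j. 2 * q j * b j * \<zeta> j \<omega>)"
    proof (rule summable_comparison_test'[OF summable_add[OF elim sb], of 0])
      fix j :: nat
      have "\<bar>2 * b j * \<zeta> j \<omega>\<bar> \<le> (\<zeta> j \<omega>)\<^sup>2 + (b j)\<^sup>2"
        using sum_squares_bound[of "b j" "\<zeta> j \<omega>"] sum_squares_bound[of "- b j" "\<zeta> j \<omega>"] by (intro abs_leI) auto
      then have "q j * \<bar>2 * b j * \<zeta> j \<omega>\<bar> \<le> q j * ((\<zeta> j \<omega>)\<^sup>2 + (b j)\<^sup>2)"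
        using q(1) by (intro mult_left_mono) auto
      then show "norm (2 * q j * b j * \<zeta> j \<omega>) \<le> q j * (\<zeta> j \<omega>)\<^sup>2 + q j * (b j)\<^sup>2"
        using q(1)[of j] by (simp add: abs_mult algebra_simps)
    qed
    have "(\<lambda>j. q j * ((\<zeta> j \<omega>)\<^sup>2 - 1) + q j * (b j)\<^sup>2 + 2 * q j * b j * \<zeta> j \<omega>) sums
      (quad_form q (\<lambda>_. 0) \<omega> + (\<Sum>j. q j * (b j)\<^sup>2) + (\<Sum>j. 2 * q j * b j * \<zeta> j \<omega>))"
      unfolding quad_form_def using s1 s2 sb by (intro sums_add) (auto intro: summable_sums)
    then have "(\<lambda>j. q j * ((\<zeta> j \<omega> + b j)\<^sup>2 - 1)) sums
      (quad_form q (\<lambda>_. 0) \<omega> + (\<Sum>j. q j * (b j)\<^sup>2) + (\<Sum>j. 2 * q j * b j * \<zeta> j \<omega>))"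
      by (rule sums_cong[THEN iffD1, rotated]) (simp add: algebra_simps power2_eq_square)
    then have "quad_form q b \<omega> - quad_form q (\<lambda>_. 0) \<omega> - (\<Sum>j. q j * (b j)\<^sup>2) = (\<Sum>j. 2 * q j * b j * \<zeta> j \<omega>)"
      unfolding quad_form_def by (simp add: sums_iff)
    then show ?case using s2 by (simp add: summable_LIMSEQ)
  qed
qed

text \<open>The linear term has second moment \<open>4 \<Sum> q\<^sub>j\<^sup>2 b\<^sub>j\<^sup>2 \<le> 4 \<delta> d\<close>, first for partial sums and then by Fatou's
  lemma in the limit; Chebyshev's inequality does the rest. The point is that the bound is linear in \<open>d\<close>: it
  is negligible for small \<open>d\<close>, and for large \<open>d\<close> the linear term is dominated by the shift \<open>d\<close> itself.\<close>

lemma cross_term_tail: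
  assumes uw: "unit_weights q \<delta>" and b: "summable (\<lambda>j. (b j)\<^sup>2)" and "0 < \<eta>"
  defines "d \<equiv> (\<Sum>j. q j * (b j)\<^sup>2)"
  shows "prob {\<omega>\<in>space M. \<eta> \<le> \<bar>quad_form q b \<omega> - quad_form q (\<lambda>_. 0) \<omega> - d\<bar>} \<le> 4 * \<delta> * d / \<eta>\<^sup>2"
proof -
  let ?R = "\<lambda>\<omega>. quad_form q b \<omega> - quad_form q (\<lambda>_. 0) \<omega> - d"
  let ?P = "\<lambda>N \<omega>. \<Sum>j<N. (2 * q j * b j) * \<zeta> j \<omega>"
  have q: "\<And>j. 0 \<le> q j" "\<And>j. q j \<le> \<delta>"
    using uw by (auto simp: unit_weights_def)
  have \<delta>: "0 \<le> \<delta>" using q(1)[of 0] q(2)[of 0] by linarith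
  have sb: "summable (\<lambda>j. q j * (b j)\<^sup>2)" by (rule signal_energy_nonneg[OF uw b])
  have d0: "0 \<le> d" unfolding d_def by (rule signal_energy_nonneg[OF uw b])
  have "(\<integral>\<^sup>+\<omega>. ennreal ((?R \<omega>)\<^sup>2) \<partial>M) = (\<integral>\<^sup>+\<omega>. liminf (\<lambda>N. ennreal ((?P N \<omega>)\<^sup>2)) \<partial>M)"
  proof (rule nn_integral_cong_AE)
    show "AE \<omega> in M. ennreal ((?R \<omega>)\<^sup>2) = liminf (\<lambda>N. ennreal ((?P N \<omega>)\<^sup>2))"
      using AE_quad_form_limit[OF uw b]
    proof eventually_elim
      case (elim \<omega>)
      then have "(\<lambda>N. ennreal ((?P N \<omega>)\<^sup>2)) \<longlonglongrightarrow> ennreal ((?R \<omega>)\<^sup>2)"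
        unfolding d_def by (intro tendsto_ennrealI tendsto_power)
      then show ?case by (rule lim_imp_Liminf[OF sequentially_bot, symmetric])
    qed
  qed
  also have "\<dots> \<le> liminf (\<lambda>N. \<integral>\<^sup>+\<omega>. ennreal ((?P N \<omega>)\<^sup>2) \<partial>M)"
    by (rule nn_integral_liminf) auto
  also have "\<dots> \<le> ennreal (4 * \<delta> * d)"
  proof -
    have "(\<integral>\<^sup>+\<omega>. ennreal ((?P N \<omega>)\<^sup>2) \<partial>M) \<le> ennreal (4 * \<delta> * d)" for N
    proof -
      have "(\<integral>\<^sup>+\<omega>. ennreal ((?P N \<omega>)\<^sup>2) \<partial>M) = ennreal (\<Sum>j<N. (2 * q j * b j)\<^sup>2)"
        by (subst nn_integral_eq_integral) (simp_all add: expectation_linear_form_sq)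
      also have "(\<Sum>j<N. (2 * q j * b j)\<^sup>2) \<le> (\<Sum>j<N. 4 * \<delta> * (q j * (b j)\<^sup>2))"
      proof (rule sum_mono)
        fix j
        have "q j * (q j * (b j)\<^sup>2) \<le> \<delta> * (q j * (b j)\<^sup>2)"
          using q by (intro mult_right_mono) auto
        then show "(2 * q j * b j)\<^sup>2 \<le> 4 * \<delta> * (q j * (b j)\<^sup>2)"
          by (simp add: power2_eq_square algebra_simps)
      qed
      also have "\<dots> = 4 * \<delta> * (\<Sum>j<N. q j * (b j)\<^sup>2)" by (simp add: sum_distrib_left)
      also have "\<dots> \<le> 4 * \<delta> * d"
        unfolding d_def using \<delta> q sb by (intro mult_left_mono sum_le_suminf) auto
      finally show ?thesis by (simp add: ennreal_leI)
    qed
    then show ?thesis by (intro Liminf_le) auto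
  qed
  finally have nn: "(\<integral>\<^sup>+\<omega>. ennreal ((?R \<omega>)\<^sup>2) \<partial>M) \<le> ennreal (4 * \<delta> * d)" .
  have "ennreal (\<eta>\<^sup>2) * emeasure M {\<omega>\<in>space M. \<eta> \<le> \<bar>?R \<omega>\<bar>}
     = (\<integral>\<^sup>+\<omega>. ennreal (\<eta>\<^sup>2) * indicator {\<omega>\<in>space M. \<eta> \<le> \<bar>?R \<omega>\<bar>} \<omega> \<partial>M)"
    by (subst nn_integral_cmult_indicator) auto
  also have "\<dots> \<le> (\<integral>\<^sup>+\<omega>. ennreal ((?R \<omega>)\<^sup>2) \<partial>M)"
  proof (intro nn_integral_mono)
    fix \<omega>
    have "\<eta>\<^sup>2 \<le> (?R \<omega>)\<^sup>2" if "\<eta> \<le> \<bar>?R \<omega>\<bar>"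
      using that \<open>0 < \<eta>\<close> by (metis abs_le_square_iff abs_of_pos)
    then show "ennreal (\<eta>\<^sup>2) * indicator {\<omega>\<in>space M. \<eta> \<le> \<bar>?R \<omega>\<bar>} \<omega> \<le> ennreal ((?R \<omega>)\<^sup>2)"
      by (auto simp: indicator_def ennreal_leI)
  qed
  also note nn
  finally have "\<eta>\<^sup>2 * prob {\<omega>\<in>space M. \<eta> \<le> \<bar>?R \<omega>\<bar>} \<le> 4 * \<delta> * d"
    using \<delta> d0 by (simp add: emeasure_eq_measure ennreal_mult[symmetric])
  then show ?thesis using \<open>0 < \<eta>\<close> by (simp add: field_simps)
qed

section \<open>Error probabilities of threshold tests\<close>

lemma unit_weights_mono: "unit_weights q \<delta> \<Longrightarrow> \<delta> \<le> \<delta>' \<Longrightarrow> unit_weights q \<delta>'"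
  unfolding unit_weights_def by (meson order_trans)

lemma cdf_null_form:
  "cdf (distr M borel (quad_form q (\<lambda>_. 0))) x = prob {\<omega>\<in>space M. quad_form q (\<lambda>_. 0) \<omega> \<le> x}"
  by (simp add: cdf_def measure_distr vimage_def Int_def conj_commute)

lemma prob_null_form_greater:
  "prob {\<omega>\<in>space M. quad_form q (\<lambda>_. 0) \<omega> > x} = 1 - cdf (distr M borel (quad_form q (\<lambda>_. 0))) x"
  unfolding cdf_null_form
  by (subst prob_neg[symmetric]) (auto simp: not_le)

text \<open>With a small shift \<open>d\<close>, the signal changes the statistic by at most \<open>d + \<eta>\<close> outside an event of small
  probability, and the nearly normal null statistic rarely lies within \<open>d + \<eta>\<close> of the threshold.\<close>

lemma errors_under_small_signal:
  assumes "0 < \<epsilon>"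
  obtains \<delta> where "0 < \<delta>"
    "\<And>q b x. unit_weights q \<delta> \<Longrightarrow> summable (\<lambda>j. (b j)\<^sup>2) \<Longrightarrow> (\<Sum>j. q j * (b j)\<^sup>2) \<le> \<delta> \<Longrightarrow>
      1 - \<epsilon> \<le> prob {\<omega>\<in>space M. quad_form q (\<lambda>_. 0) \<omega> > x} + prob {\<omega>\<in>space M. quad_form q b \<omega> \<le> x}"
proof -
  obtain \<delta>0 where \<delta>0: "0 < \<delta>0"
    "\<And>q x. unit_weights q \<delta>0 \<Longrightarrow> \<bar>cdf (distr M borel (quad_form q (\<lambda>_. 0))) x - Phi x\<bar> \<le> \<epsilon> / 8"
    by (rule uniform_clt[of "\<epsilon> / 8"]) (use assms in auto)
  \<comment> \<open>With \<open>\<eta> = \<epsilon> / 4\<close>, each of the four sources of error costs at most \<open>\<epsilon> / 4\<close>; the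
    cubic term makes Chebyshev's bound \<open>4 \<delta> d / \<eta>\<^sup>2\<close> at most \<open>\<epsilon> / 4\<close>.\<close>
  define \<delta> where "\<delta> = min \<delta>0 (min (\<epsilon> / 4) (min 1 (\<epsilon> ^ 3 / 256)))"
  have \<delta>: "0 < \<delta>" "\<delta> \<le> \<delta>0" "\<delta> \<le> \<epsilon> / 4" "\<delta> \<le> 1" "\<delta> \<le> \<epsilon> ^ 3 / 256"
    unfolding \<delta>_def using assms \<delta>0 by auto
  have "1 - \<epsilon> \<le> prob {\<omega>\<in>space M. quad_form q (\<lambda>_. 0) \<omega> > x} + prob {\<omega>\<in>space M. quad_form q b \<omega> \<le> x}"
    if uw: "unit_weights q \<delta>" and b: "summable (\<lambda>j. (b j)\<^sup>2)" and small: "(\<Sum>j. q j * (b j)\<^sup>2) \<le> \<delta>"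
    for q b x
  proof -
    define d where "d = (\<Sum>j. q j * (b j)\<^sup>2)"
    define \<eta> where "\<eta> = \<epsilon> / 4"
    let ?F = "cdf (distr M borel (quad_form q (\<lambda>_. 0)))"
    let ?R = "\<lambda>\<omega>. quad_form q b \<omega> - quad_form q (\<lambda>_. 0) \<omega> - d"
    have d: "0 \<le> d" "d \<le> \<delta>" using signal_energy_nonneg[OF uw b] small by (auto simp: d_def)
    have \<eta>: "0 < \<eta>" using assms by (simp add: \<eta>_def)
    have "prob {\<omega>\<in>space M. \<eta> \<le> \<bar>?R \<omega>\<bar>} \<le> 4 * \<delta> * d / \<eta>\<^sup>2"
      using cross_term_tail[OF uw b \<eta>] by (simp add: d_def)
    also have "\<dots> \<le> \<epsilon> / 4"
    proof -
      have "4 * \<delta> * d \<le> 4 * (\<epsilon> ^ 3 / 256) * 1" using d \<delta> by (intro mult_mono) auto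
      also have "\<dots> = \<epsilon> / 4 * \<eta>\<^sup>2" by (simp add: \<eta>_def power2_eq_square power3_eq_cube)
      finally show ?thesis using \<eta> by (simp add: divide_le_eq)
    qed
    finally have R: "prob {\<omega>\<in>space M. \<eta> \<le> \<bar>?R \<omega>\<bar>} \<le> \<epsilon> / 4" .
    have "?F (x - (d + \<eta>)) = prob {\<omega>\<in>space M. quad_form q (\<lambda>_. 0) \<omega> \<le> x - (d + \<eta>)}"
      by (rule cdf_null_form)
    also have "\<dots> \<le> prob ({\<omega>\<in>space M. quad_form q b \<omega> \<le> x} \<union> {\<omega>\<in>space M. \<eta> \<le> \<bar>?R \<omega>\<bar>})"
      by (rule finite_measure_mono) auto
    also have "\<dots> \<le> prob {\<omega>\<in>space M. quad_form q b \<omega> \<le> x} + prob {\<omega>\<in>space M. \<eta> \<le> \<bar>?R \<omega>\<bar>}"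
      by (rule measure_Un_le) auto
    finally have 1: "?F (x - (d + \<eta>)) - \<epsilon> / 4 \<le> prob {\<omega>\<in>space M. quad_form q b \<omega> \<le> x}" using R by linarith
    have "Phi x - Phi (x - (d + \<eta>)) \<le> d + \<eta>"
      using Phi_diff(2)[of "x - (d + \<eta>)" x] d \<eta> by simp
    moreover have "?F x \<le> Phi x + \<epsilon> / 8" "Phi (x - (d + \<eta>)) - \<epsilon> / 8 \<le> ?F (x - (d + \<eta>))"
      using \<delta>0(2)[OF unit_weights_mono[OF uw \<delta>(2)], of x]
        \<delta>0(2)[OF unit_weights_mono[OF uw \<delta>(2)], of "x - (d + \<eta>)"] by linarith+
    ultimately show ?thesis
      using 1 d \<delta> unfolding prob_null_form_greater \<eta>_def by linarith
  qed
  then show thesis using that \<delta>(1) by blast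
qed

text \<open>The level condition keeps the threshold below \<open>z + D/4\<close>, where \<open>z\<close> is the normal quantile of level
  \<open>1 - \<alpha>\<close>. A type II error then requires either the null statistic to be below \<open>z - D/4\<close>, which costs a
  fixed amount of probability compared with \<open>z\<close>, or the linear term to cancel half of the shift.\<close>

lemma power_under_large_signal:
  assumes "0 < D" "0 < \<alpha>" "\<alpha> < 1"
  obtains \<epsilon> \<delta> where "0 < \<epsilon>" "0 < \<delta>"
    "\<And>q b x. unit_weights q \<delta> \<Longrightarrow> summable (\<lambda>j. (b j)\<^sup>2) \<Longrightarrow> D \<le> (\<Sum>j. q j * (b j)\<^sup>2) \<Longrightarrow>
      \<alpha> - \<epsilon> \<le> prob {\<omega>\<in>space M. quad_form q (\<lambda>_. 0) \<omega> > x} \<Longrightarrow>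
      prob {\<omega>\<in>space M. quad_form q b \<omega> \<le> x} \<le> 1 - \<alpha> - \<epsilon>"
proof -
  obtain z where z: "Phi z = 1 - \<alpha>" using Phi_surj[of "1 - \<alpha>"] assms by auto
  \<comment> \<open>A quarter of the smaller gap pays for each of the defect in level, a use of the central limit
    theorem, the linear term and the margin claimed.\<close>
  define \<epsilon> where "\<epsilon> = min (Phi z - Phi (z - D / 4)) (Phi (z + D / 4) - Phi z) / 4"
  have \<epsilon>: "0 < \<epsilon>" "4 * \<epsilon> \<le> Phi z - Phi (z - D / 4)" "4 * \<epsilon> \<le> Phi (z + D / 4) - Phi z"
    unfolding \<epsilon>_def using Phi_diff(1)[of "z - D/4" z] Phi_diff(1)[of z "z + D/4"] assms by auto
  obtain \<delta>0 where \<delta>0: "0 < \<delta>0"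
    "\<And>q x. unit_weights q \<delta>0 \<Longrightarrow> \<bar>cdf (distr M borel (quad_form q (\<lambda>_. 0))) x - Phi x\<bar> \<le> \<epsilon>"
    by (rule uniform_clt[of \<epsilon>]) (use \<epsilon> in auto)
  define \<delta> where "\<delta> = min \<delta>0 (\<epsilon> * D / 16)"
  have \<delta>: "0 < \<delta>" "\<delta> \<le> \<delta>0" "\<delta> \<le> \<epsilon> * D / 16"
    unfolding \<delta>_def using assms \<delta>0 \<epsilon> by auto
  have "prob {\<omega>\<in>space M. quad_form q b \<omega> \<le> x} \<le> 1 - \<alpha> - \<epsilon>"
    if uw: "unit_weights q \<delta>" and b: "summable (\<lambda>j. (b j)\<^sup>2)" and large: "D \<le> (\<Sum>j. q j * (b j)\<^sup>2)"
      and level: "\<alpha> - \<epsilon> \<le> prob {\<omega>\<in>space M. quad_form q (\<lambda>_. 0) \<omega> > x}"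
    for q b x
  proof -
    define d where "d = (\<Sum>j. q j * (b j)\<^sup>2)"
    let ?F = "cdf (distr M borel (quad_form q (\<lambda>_. 0)))"
    let ?R = "\<lambda>\<omega>. quad_form q b \<omega> - quad_form q (\<lambda>_. 0) \<omega> - d"
    have clt: "\<bar>?F y - Phi y\<bar> \<le> \<epsilon>" for y using \<delta>0(2)[OF unit_weights_mono[OF uw \<delta>(2)]] .
    have d: "D \<le> d" "0 < d" using large assms by (auto simp: d_def)
    have "prob {\<omega>\<in>space M. d / 2 \<le> \<bar>?R \<omega>\<bar>} \<le> 4 * \<delta> * d / (d / 2)\<^sup>2"
      using cross_term_tail[OF uw b, of "d / 2"] d by (simp add: d_def)
    also have "\<dots> = 16 * \<delta> / d" using d by (simp add: power2_eq_square field_simps)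
    also have "\<dots> \<le> \<epsilon>"
    proof -
      have "16 * \<delta> \<le> \<epsilon> * D" using \<delta> by simp
      also have "\<dots> \<le> \<epsilon> * d" using d \<epsilon> by (intro mult_left_mono) auto
      finally show ?thesis using d by (simp add: divide_le_eq)
    qed
    finally have R: "prob {\<omega>\<in>space M. d / 2 \<le> \<bar>?R \<omega>\<bar>} \<le> \<epsilon>" .
    have "Phi x < Phi (z + D / 4)"
      using level clt[of x] z \<epsilon> unfolding prob_null_form_greater by linarith
    then have "x - D / 2 \<le> z - D / 4" using Phi_less_iff by auto
    then have "Phi (x - D / 2) \<le> Phi (z - D / 4)"
      using Phi_less_iff[of "z - D / 4" "x - D / 2"] by linarith
    then have F: "?F (x - D / 2) \<le> 1 - \<alpha> - 3 * \<epsilon>" using clt[of "x - D / 2"] z \<epsilon> by linarith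
    have "prob {\<omega>\<in>space M. quad_form q b \<omega> \<le> x} \<le>
        prob ({\<omega>\<in>space M. quad_form q (\<lambda>_. 0) \<omega> \<le> x - D / 2} \<union> {\<omega>\<in>space M. d / 2 \<le> \<bar>?R \<omega>\<bar>})"
    proof (intro finite_measure_mono subsetI)
      fix \<omega> assume "\<omega> \<in> {\<omega>\<in>space M. quad_form q b \<omega> \<le> x}"
      moreover from this have "quad_form q (\<lambda>_. 0) \<omega> \<le> x - D / 2" if "\<bar>?R \<omega>\<bar> < d / 2"
        using that d abs_ge_minus_self[of "?R \<omega>"] unfolding mem_Collect_eq by linarith
      ultimately show "\<omega> \<in> {\<omega>\<in>space M. quad_form q (\<lambda>_. 0) \<omega> \<le> x - D / 2} \<union>
          {\<omega>\<in>space M. d / 2 \<le> \<bar>?R \<omega>\<bar>}"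
        by (cases "d / 2 \<le> \<bar>?R \<omega>\<bar>") auto
    qed auto
    also have "\<dots> \<le> ?F (x - D / 2) + prob {\<omega>\<in>space M. d / 2 \<le> \<bar>?R \<omega>\<bar>}"
      unfolding cdf_null_form by (rule measure_Un_le) auto
    finally show ?thesis using R F \<epsilon> by linarith
  qed
  then show thesis using that \<epsilon>(1) \<delta>(1) by blast
qed

text \<open>A single threshold, the normal quantile, has asymptotic level \<open>\<alpha>\<close> for all small weights. It supplies a
  concrete test against which inconsistency can be refuted.\<close>

lemma threshold_of_level:
  assumes "0 < \<alpha>" "\<alpha> < 1"
  obtains z where "\<And>\<epsilon>. 0 < \<epsilon> \<Longrightarrow> \<exists>\<delta>>0. \<forall>q. unit_weights q \<delta> \<longrightarrow>
    \<bar>prob {\<omega>\<in>space M. quad_form q (\<lambda>_. 0) \<omega> > z} - \<alpha>\<bar> \<le> \<epsilon>"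
proof -
  obtain z where z: "Phi z = 1 - \<alpha>" using Phi_surj[of "1 - \<alpha>"] assms by auto
  have "\<exists>\<delta>>0. \<forall>q. unit_weights q \<delta> \<longrightarrow> \<bar>prob {\<omega>\<in>space M. quad_form q (\<lambda>_. 0) \<omega> > z} - \<alpha>\<bar> \<le> \<epsilon>"
    if \<epsilon>: "0 < \<epsilon>" for \<epsilon>
  proof -
    obtain \<delta> where \<delta>: "0 < \<delta>"
      "\<And>q x. unit_weights q \<delta> \<Longrightarrow> \<bar>cdf (distr M borel (quad_form q (\<lambda>_. 0))) x - Phi x\<bar> \<le> \<epsilon>"
      by (rule uniform_clt[OF \<epsilon>], rule that)
    have "\<bar>prob {\<omega>\<in>space M. quad_form q (\<lambda>_. 0) \<omega> > z} - \<alpha>\<bar> \<le> \<epsilon>" if "unit_weights q \<delta>" for q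
      using \<delta>(2)[OF that, of z] z unfolding prob_null_form_greater by linarith
    then show ?thesis using \<delta>(1) by blast
  qed
  then show thesis by (rule that)
qed

end

lemma gaussian_sequence_of_iid:
  assumes "iid_std_normal M \<xi>"
  shows "gaussian_sequence M (\<lambda>j. \<xi> (Suc j))"
proof -
  interpret prob_space M using assms by (simp add: iid_std_normal_def)
  have iv: "indep_vars (\<lambda>_. borel) \<xi> {1..}" using assms by (simp add: iid_std_normal_def)
  let ?G = "\<lambda>i. {\<xi> i -` A \<inter> space M | A. A \<in> sets borel}"
  have G: "indep_sets ?G {1..}" using iv by (auto simp: indep_vars_def2)
  have "indep_sets (\<lambda>i. ?G (Suc i)) UNIV"
  proof (rule indep_setsI)
    show "?G (Suc i) \<subseteq> events" for i
      using G by (auto simp: indep_sets_def)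
    fix A J assume J: "J \<noteq> {}" "J \<subseteq> UNIV" "finite J" "\<forall>j\<in>J. A j \<in> ?G (Suc j)"
    have "prob (\<Inter>j\<in>Suc ` J. A (j - 1)) = (\<Prod>j\<in>Suc ` J. prob (A (j - 1)))"
      using J by (intro indep_setsD[OF G]) auto
    then show "prob (\<Inter>j\<in>J. A j) = (\<Prod>j\<in>J. prob (A j))"
      by (simp add: prod.reindex)
  qed
  then have "indep_vars (\<lambda>_. borel) (\<lambda>j. \<xi> (Suc j)) UNIV"
    using iv by (auto simp: indep_vars_def2)
  then show ?thesis
    using assms by unfold_locales (auto simp: iid_std_normal_def)
qed

section \<open>Coefficients and projections in \<open>L\<^sub>2(0,1)\<close>\<close>

lemma L2_mult_integrable:
  assumes "f \<in> L2" "g \<in> L2"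
  shows "integrable leb01 (\<lambda>t. f t * g t)"
proof (rule Bochner_Integration.integrable_bound)
  have [measurable]: "f \<in> borel_measurable leb01" "g \<in> borel_measurable leb01"
    using assms by (auto simp: L2_def)
  show "(\<lambda>t. f t * g t) \<in> borel_measurable leb01" by measurable
  show "integrable leb01 (\<lambda>t. (f t)\<^sup>2 + (g t)\<^sup>2)" using assms by (auto simp: L2_def)
  have "\<bar>f t * g t\<bar> \<le> (f t)\<^sup>2 + (g t)\<^sup>2" for t
  proof -
    have "2 * \<bar>f t\<bar> * \<bar>g t\<bar> \<le> (f t)\<^sup>2 + (g t)\<^sup>2" using sum_squares_bound[of "\<bar>f t\<bar>" "\<bar>g t\<bar>"] by simp
    moreover have "0 \<le> \<bar>f t\<bar> * \<bar>g t\<bar>" by simp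
    ultimately show ?thesis unfolding abs_mult mult.assoc by linarith
  qed
  then show "AE t in leb01. norm (f t * g t) \<le> norm ((f t)\<^sup>2 + (g t)\<^sup>2)"
    by (intro AE_I2) (simp add: abs_of_nonneg)
qed

lemma L2_zero [simp]: "(\<lambda>_. 0) \<in> L2" by (simp add: L2_def)

lemma L2_add: assumes "f \<in> L2" "g \<in> L2" shows "(\<lambda>t. f t + g t) \<in> L2"
proof -
  have "integrable leb01 (\<lambda>t. (f t)\<^sup>2 + (g t)\<^sup>2 + 2 * (f t * g t))"
    using assms L2_mult_integrable[OF assms] by (auto simp: L2_def)
  then have "integrable leb01 (\<lambda>t. (f t + g t)\<^sup>2)" by (simp add: power2_sum mult.assoc)
  then show ?thesis using assms by (auto simp: L2_def)
qed

lemma L2_scale: assumes "f \<in> L2" shows "(\<lambda>t. c * f t) \<in> L2"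
  using assms by (auto simp: L2_def power_mult_distrib)

lemma L2_diff: assumes "f \<in> L2" "g \<in> L2" shows "(\<lambda>t. f t - g t) \<in> L2"
  using L2_add[OF assms(1) L2_scale[OF assms(2), of "-1"]] by simp

lemma L2_sum: assumes "\<And>j. j \<in> J \<Longrightarrow> g j \<in> L2" shows "(\<lambda>t. \<Sum>j\<in>J. g j t) \<in> L2"
  using assms by (induction J rule: infinite_finite_induct) (auto intro: L2_add)

lemma inner_L2_commute: "inner_L2 f g = inner_L2 g f"
  by (simp add: inner_L2_def mult.commute)

lemma inner_L2_zero [simp]: "inner_L2 (\<lambda>_. 0) g = 0" "inner_L2 g (\<lambda>_. 0) = 0"
  by (simp_all add: inner_L2_def)

lemma inner_L2_add: "f \<in> L2 \<Longrightarrow> g \<in> L2 \<Longrightarrow> h \<in> L2 \<Longrightarrow> inner_L2 (\<lambda>t. f t + g t) h = inner_L2 f h + inner_L2 g h"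
  by (simp add: inner_L2_def distrib_right L2_mult_integrable)

lemma inner_L2_diff: "f \<in> L2 \<Longrightarrow> g \<in> L2 \<Longrightarrow> h \<in> L2 \<Longrightarrow> inner_L2 (\<lambda>t. f t - g t) h = inner_L2 f h - inner_L2 g h"
  by (simp add: inner_L2_def left_diff_distrib L2_mult_integrable)

lemma inner_L2_scale: "inner_L2 (\<lambda>t. c * f t) h = c * inner_L2 f h"
  by (simp add: inner_L2_def mult.assoc)

lemma inner_L2_sum:
  assumes "\<And>j. j \<in> J \<Longrightarrow> g j \<in> L2" "h \<in> L2"
  shows "inner_L2 (\<lambda>t. \<Sum>j\<in>J. g j t) h = (\<Sum>j\<in>J. inner_L2 (g j) h)"
  using assms by (induction J rule: infinite_finite_induct) (auto simp: inner_L2_add L2_sum)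

lemma inner_L2_self_nonneg [simp]: "0 \<le> inner_L2 f f"
  by (simp add: inner_L2_def)

lemma norm_L2_sq: "(norm_L2 f)\<^sup>2 = inner_L2 f f"
  by (simp add: norm_L2_def)

lemma norm_L2_nonneg [simp]: "0 \<le> norm_L2 f"
  by (simp add: norm_L2_def)

lemma inner_L2_cong_AE:
  assumes "f \<in> L2" "f' \<in> L2" "g \<in> L2" "AE t in leb01. f t = f' t"
  shows "inner_L2 f g = inner_L2 f' g"
  unfolding inner_L2_def
proof (rule integral_cong_AE)
  show "(\<lambda>t. f t * g t) \<in> borel_measurable leb01" "(\<lambda>t. f' t * g t) \<in> borel_measurable leb01"
    using assms by (auto simp: L2_def)
  show "AE t in leb01. f t * g t = f' t * g t" using assms(4) by eventually_elim simp
qed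

lemma norm_L2_diff_sq:
  assumes "f \<in> L2" "g \<in> L2"
  shows "inner_L2 (\<lambda>t. f t - c * g t) (\<lambda>t. f t - c * g t) = inner_L2 f f - 2 * c * inner_L2 f g + c\<^sup>2 * inner_L2 g g"
proof -
  have m: "(\<lambda>t. f t - c * g t) \<in> L2" "(\<lambda>t. c * g t) \<in> L2"
    by (intro L2_diff L2_scale assms)+
  have 1: "inner_L2 h (\<lambda>t. f t - c * g t) = inner_L2 f h - c * inner_L2 g h" if "h \<in> L2" for h
    by (subst inner_L2_commute) (simp add: inner_L2_diff inner_L2_scale assms m that)
  show ?thesis
    by (subst inner_L2_diff) (simp_all add: assms m inner_L2_scale 1 inner_L2_commute[of g f] power2_eq_square algebra_simps)
qed

text \<open>The members of \<open>L2\<close> are functions rather than classes modulo null sets, so \<open>inner_L2 g g = 0\<close> may hold for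
  nonzero \<open>g\<close>. In that case the nonnegative quadratic is affine in \<open>x\<close>, which forces its slope to vanish.\<close>

lemma Cauchy_Schwarz_L2:
  assumes "f \<in> L2" "g \<in> L2"
  shows "\<bar>inner_L2 f g\<bar> \<le> norm_L2 f * norm_L2 g"
proof -
  let ?a = "inner_L2 f f" and ?b = "inner_L2 f g" and ?c = "inner_L2 g g"
  have quad: "0 \<le> ?a - 2 * x * ?b + x\<^sup>2 * ?c" for x
    using norm_L2_diff_sq[OF assms, of x] inner_L2_self_nonneg[of "\<lambda>t. f t - x * g t"] by linarith
  have "?b\<^sup>2 \<le> ?a * ?c"
  proof (cases "?c = 0")
    case True
    have "?b = 0"
    proof (rule ccontr)
      assume b: "?b \<noteq> 0"
      have "2 * ((?a + 1) / ?b) * ?b = 2 * (?a + 1)" using b by simp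
      then show False using quad[of "(?a + 1) / ?b"] True inner_L2_self_nonneg[of f] by simp
    qed
    then show ?thesis using True by simp
  next
    case False
    then have c: "?c > 0" using inner_L2_self_nonneg[of g] by linarith
    have "0 \<le> ?a - ?b\<^sup>2 / ?c"
      using quad[of "?b / ?c"] c by (simp add: power2_eq_square field_simps)
    then show ?thesis using c by (simp add: field_simps)
  qed
  then have "sqrt (?b\<^sup>2) \<le> sqrt (?a * ?c)" by (rule real_sqrt_le_mono)
  then show ?thesis by (simp add: norm_L2_def real_sqrt_mult)
qed

lemma norm_L2_triangle:
  assumes "f \<in> L2" "g \<in> L2"
  shows "norm_L2 (\<lambda>t. f t + g t) \<le> norm_L2 f + norm_L2 g"
proof (rule power2_le_imp_le)
  have "(norm_L2 (\<lambda>t. f t + g t))\<^sup>2 = (norm_L2 f)\<^sup>2 + 2 * inner_L2 f g + (norm_L2 g)\<^sup>2"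
    using norm_L2_diff_sq[OF assms, of "-1"] by (simp add: norm_L2_sq)
  also have "\<dots> \<le> (norm_L2 f)\<^sup>2 + 2 * (norm_L2 f * norm_L2 g) + (norm_L2 g)\<^sup>2"
    using Cauchy_Schwarz_L2[OF assms] by (intro add_mono mult_left_mono) auto
  finally show "(norm_L2 (\<lambda>t. f t + g t))\<^sup>2 \<le> (norm_L2 f + norm_L2 g)\<^sup>2"
    by (simp add: power2_sum)
qed simp

definition proj :: "(nat \<Rightarrow> real \<Rightarrow> real) \<Rightarrow> (real \<Rightarrow> real) \<Rightarrow> nat \<Rightarrow> real \<Rightarrow> real" where
  "proj \<phi> f K = (\<lambda>t. \<Sum>j=1..K. inner_L2 f (\<phi> j) * \<phi> j t)"

definition tail_energy :: "(nat \<Rightarrow> real \<Rightarrow> real) \<Rightarrow> (real \<Rightarrow> real) \<Rightarrow> nat \<Rightarrow> real" where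
  "tail_energy \<phi> f K = (norm_L2 (\<lambda>t. f t - proj \<phi> f K t))\<^sup>2"

locale L2_basis =
  fixes \<phi> :: "nat \<Rightarrow> real \<Rightarrow> real"
  assumes basis: "orthonormal_basis_L2 \<phi>"
begin

lemma basis_L2: "j \<ge> 1 \<Longrightarrow> \<phi> j \<in> L2"
  using basis by (auto simp: orthonormal_basis_L2_def)

lemma inner_basis: "i \<ge> 1 \<Longrightarrow> j \<ge> 1 \<Longrightarrow> inner_L2 (\<phi> i) (\<phi> j) = (if i = j then 1 else 0)"
  using basis by (auto simp: orthonormal_basis_L2_def)

lemma proj_L2: "proj \<phi> f K \<in> L2"
  unfolding proj_def by (intro L2_sum L2_scale basis_L2) auto

lemma inner_proj:
  assumes "h \<in> L2"
  shows "inner_L2 (proj \<phi> f K) h = (\<Sum>j=1..K. inner_L2 f (\<phi> j) * inner_L2 h (\<phi> j))"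
  unfolding proj_def using assms
  by (subst inner_L2_sum) (auto intro!: sum.cong L2_scale basis_L2 simp: inner_L2_scale inner_L2_commute)

lemma coeff_proj:
  assumes "j \<ge> 1"
  shows "inner_L2 (proj \<phi> f K) (\<phi> j) = (if j \<le> K then inner_L2 f (\<phi> j) else 0)"
proof -
  have "inner_L2 (proj \<phi> f K) (\<phi> j) = (\<Sum>i=1..K. inner_L2 f (\<phi> i) * (if j = i then 1 else 0))"
    using assms by (simp add: inner_proj basis_L2 inner_basis)
  then show ?thesis using assms by (simp add: if_distrib sum.delta cong: if_cong)
qed

lemma proj_orthogonal_residual:
  assumes "f \<in> L2"
  shows "inner_L2 (proj \<phi> f K) (\<lambda>t. f t - proj \<phi> f K t) = 0"
proof -
  have "inner_L2 (\<lambda>t. f t - proj \<phi> f K t) (\<phi> j) = 0" if "j \<in> {1..K}" for j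
    using that assms by (simp add: inner_L2_diff coeff_proj basis_L2 proj_L2)
  then show ?thesis using assms by (simp add: inner_proj L2_diff proj_L2)
qed

lemma norm_proj_sq: "(norm_L2 (proj \<phi> f K))\<^sup>2 = (\<Sum>j=1..K. (inner_L2 f (\<phi> j))\<^sup>2)"
  unfolding norm_L2_sq by (simp add: inner_proj proj_L2 coeff_proj power2_eq_square)

lemma Pythagoras_proj:
  assumes "f \<in> L2"
  shows "(norm_L2 f)\<^sup>2 = (norm_L2 (proj \<phi> f K))\<^sup>2 + tail_energy \<phi> f K"
proof -
  have "inner_L2 f (proj \<phi> f K) = inner_L2 (proj \<phi> f K) (proj \<phi> f K)"
    using proj_orthogonal_residual[OF assms, of K]
      inner_L2_diff[OF assms proj_L2[of f K] proj_L2[of f K]]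
      inner_L2_commute[of "proj \<phi> f K" "\<lambda>t. f t - proj \<phi> f K t"] by simp
  then show ?thesis
    using norm_L2_diff_sq[OF assms proj_L2[of f K], of 1]
    by (simp add: tail_energy_def norm_L2_sq)
qed

lemma tail_energy_eq:
  assumes "f \<in> L2"
  shows "tail_energy \<phi> f K = (norm_L2 f)\<^sup>2 - (\<Sum>j=1..K. (inner_L2 f (\<phi> j))\<^sup>2)"
  using Pythagoras_proj[OF assms, of K] by (simp add: norm_proj_sq)

lemma tail_energy_bounds:
  assumes "f \<in> L2"
  shows "0 \<le> tail_energy \<phi> f K" "tail_energy \<phi> f K \<le> (norm_L2 f)\<^sup>2"
proof -
  show "0 \<le> tail_energy \<phi> f K" by (simp add: tail_energy_def)
  have "0 \<le> (\<Sum>j=1..K. (inner_L2 f (\<phi> j))\<^sup>2)" by (simp add: sum_nonneg)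
  then show "tail_energy \<phi> f K \<le> (norm_L2 f)\<^sup>2"
    unfolding tail_energy_eq[OF assms, of K] by linarith
qed

lemma tail_energy_antimono:
  assumes "f \<in> L2" "K \<le> K'"
  shows "tail_energy \<phi> f K' \<le> tail_energy \<phi> f K"
  unfolding tail_energy_eq[OF assms(1)] using assms(2)
  by (intro diff_left_mono sum_mono2) auto

lemma tail_energy_tendsto_0:
  assumes "f \<in> L2"
  shows "tail_energy \<phi> f \<longlonglongrightarrow> 0"
proof -
  have "(\<lambda>N. norm_L2 (\<lambda>t. f t - proj \<phi> f N t)) \<longlonglongrightarrow> 0"
    using basis assms by (simp add: orthonormal_basis_L2_def proj_def)
  then have "(\<lambda>N. (norm_L2 (\<lambda>t. f t - proj \<phi> f N t))\<^sup>2) \<longlonglongrightarrow> 0\<^sup>2" by (rule tendsto_power)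
  then show ?thesis by (simp add: tail_energy_def[abs_def])
qed

lemma Parseval:
  assumes "f \<in> L2"
  shows "(\<lambda>j. (inner_L2 f (\<phi> (Suc j)))\<^sup>2) sums (norm_L2 f)\<^sup>2"
proof -
  have "(\<lambda>K. (norm_L2 f)\<^sup>2 - tail_energy \<phi> f K) \<longlonglongrightarrow> (norm_L2 f)\<^sup>2 - 0"
    by (intro tendsto_diff tendsto_const tail_energy_tendsto_0 assms)
  then have "(\<lambda>K. \<Sum>j=1..K. (inner_L2 f (\<phi> j))\<^sup>2) \<longlonglongrightarrow> (norm_L2 f)\<^sup>2"
    by (simp add: tail_energy_eq[OF assms])
  moreover have "(\<Sum>j=1..K. (inner_L2 f (\<phi> j))\<^sup>2) = (\<Sum>j<K. (inner_L2 f (\<phi> (Suc j)))\<^sup>2)" for K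
    by (simp add: sum.atLeast1_atMost_eq)
  ultimately show ?thesis by (simp add: sums_def)
qed

text \<open>The series over \<open>j > K\<close> is Parseval's series with its first \<open>K\<close> terms removed.\<close>

lemma has_sum_tail_energy:
  assumes "f \<in> L2"
  shows "((\<lambda>j. (inner_L2 f (\<phi> j))\<^sup>2) has_sum tail_energy \<phi> f K) {Suc K..}"
proof -
  let ?g = "\<lambda>j. (inner_L2 f (\<phi> (Suc K + j)))\<^sup>2"
  have "(\<lambda>j. (inner_L2 f (\<phi> (Suc (j + K))))\<^sup>2) sums ((norm_L2 f)\<^sup>2 - (\<Sum>j<K. (inner_L2 f (\<phi> (Suc j)))\<^sup>2))"
    using sums_split_initial_segment[OF Parseval[OF assms], of K] by simp
  then have "?g sums tail_energy \<phi> f K"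
    by (simp add: tail_energy_eq[OF assms] sum.atLeast1_atMost_eq add.commute)
  then have "(?g has_sum tail_energy \<phi> f K) UNIV"
    by (intro sums_nonneg_imp_has_sum) auto
  moreover have "bij_betw (\<lambda>j. Suc K + j) UNIV {Suc K..}"
    by (rule bij_betwI[where g = "\<lambda>j. j - Suc K"]) auto
  ultimately show ?thesis
    using has_sum_reindex_bij_betw[of "\<lambda>j. Suc K + j" UNIV "{Suc K..}" "\<lambda>j. (inner_L2 f (\<phi> j))\<^sup>2"] by simp
qed

lemma infsum_coeffs:
  assumes "f \<in> L2" "0 \<le> u"
  shows "(\<Sum>\<^sub>\<infinity>j\<in>{j. u < real j}. (inner_L2 f (\<phi> j))\<^sup>2) = tail_energy \<phi> f (nat \<lfloor>u\<rfloor>)"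
proof -
  have "{j. u < real j} = {Suc (nat \<lfloor>u\<rfloor>)..}"
    using assms(2) by (auto simp: Suc_le_eq nat_less_iff floor_less_iff)
  then show ?thesis using has_sum_tail_energy[OF assms(1)] by (simp add: infsumI)
qed

lemma Besov_body_iff:
  "f \<in> Besov_body \<phi> s \<gamma> \<longleftrightarrow>
    f \<in> L2 \<and> (\<forall>u>0. u powr (2 * s) * tail_energy \<phi> f (nat \<lfloor>u\<rfloor>) \<le> \<gamma>)"
  unfolding Besov_body_def by (auto simp: SUP_le_iff infsum_coeffs)

lemma sqrt_tail_energy_le:
  assumes "f \<in> L2" "g \<in> L2"
  shows "sqrt (tail_energy \<phi> f K) \<le> norm_L2 (\<lambda>t. f t - g t) + sqrt (tail_energy \<phi> g K)"
proof -
  let ?h = "\<lambda>t. f t - g t"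
  have h: "?h \<in> L2" using assms by (rule L2_diff)
  have "proj \<phi> ?h K t = proj \<phi> f K t - proj \<phi> g K t" for t
    unfolding proj_def sum_subtractf[symmetric]
    by (intro sum.cong refl) (simp add: inner_L2_diff assms basis_L2 left_diff_distrib)
  then have "(\<lambda>t. f t - proj \<phi> f K t) = (\<lambda>t. (?h t - proj \<phi> ?h K t) + (g t - proj \<phi> g K t))"
    by (simp add: fun_eq_iff)
  then have "sqrt (tail_energy \<phi> f K) \<le> sqrt (tail_energy \<phi> ?h K) + sqrt (tail_energy \<phi> g K)"
    unfolding tail_energy_def
    using norm_L2_triangle[OF L2_diff[OF h proj_L2] L2_diff[OF assms(2) proj_L2], of ?h K g K] by simp
  also have "sqrt (tail_energy \<phi> ?h K) \<le> norm_L2 ?h"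
    using tail_energy_bounds(2)[OF h, of K] by (simp add: real_le_lsqrt)
  finally show ?thesis by simp
qed

text \<open>Orthogonality of the summands gives \<open>\<parallel>h\<parallel>\<^sup>2 = \<langle>f, h\<rangle>\<close>. Splitting this inner product at frequency \<open>K\<close> and
  applying Cauchy-Schwarz to each part shows that an orthogonal summand \<open>h\<close> is small whenever \<open>h\<close> has few low
  and \<open>f\<close> has few high frequencies.\<close>

lemma norm_sq_summand_le:
  assumes f: "f \<in> L2" and g: "g \<in> L2" and h: "h \<in> L2"
    and sum: "AE t in leb01. f t = g t + h t" and orth: "inner_L2 g h = 0"
  shows "(norm_L2 h)\<^sup>2 \<le> norm_L2 f * sqrt (\<Sum>j=1..K. (inner_L2 h (\<phi> j))\<^sup>2) + norm_L2 f * sqrt (tail_energy \<phi> f K)"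
    and "norm_L2 h \<le> norm_L2 f"
proof -
  have "inner_L2 f h = inner_L2 (\<lambda>t. g t + h t) h"
    by (intro inner_L2_cong_AE f h L2_add g sum)
  also have "\<dots> = inner_L2 h h" using orth g h by (simp add: inner_L2_add)
  finally have fh: "inner_L2 f h = (norm_L2 h)\<^sup>2" by (simp add: norm_L2_sq)
  show le: "norm_L2 h \<le> norm_L2 f"
  proof (cases "norm_L2 h = 0")
    case False
    then have "norm_L2 h > 0" using norm_L2_nonneg[of h] by linarith
    moreover have "norm_L2 h * norm_L2 h \<le> norm_L2 f * norm_L2 h"
      using Cauchy_Schwarz_L2[OF f h] fh by (simp add: power2_eq_square)
    ultimately show ?thesis by simp
  qed simp
  have "inner_L2 (proj \<phi> f K) h = inner_L2 (proj \<phi> h K) f"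
    using f h by (simp add: inner_proj mult.commute)
  also have "\<dots> \<le> norm_L2 (proj \<phi> h K) * norm_L2 f"
    using Cauchy_Schwarz_L2[OF proj_L2[of h K] f] by linarith
  also have "norm_L2 (proj \<phi> h K) = sqrt (\<Sum>j=1..K. (inner_L2 h (\<phi> j))\<^sup>2)"
    unfolding norm_proj_sq[symmetric] by simp
  finally have 1: "inner_L2 (proj \<phi> f K) h \<le> norm_L2 f * sqrt (\<Sum>j=1..K. (inner_L2 h (\<phi> j))\<^sup>2)"
    by (simp add: mult.commute)
  have "inner_L2 (\<lambda>t. f t - proj \<phi> f K t) h \<le> sqrt (tail_energy \<phi> f K) * norm_L2 h"
    using Cauchy_Schwarz_L2[OF L2_diff[OF f proj_L2] h, of f K] by (simp add: tail_energy_def)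
  also have "\<dots> \<le> sqrt (tail_energy \<phi> f K) * norm_L2 f"
    using le tail_energy_bounds[OF f] by (intro mult_left_mono) auto
  finally have "inner_L2 f h - inner_L2 (proj \<phi> f K) h \<le> sqrt (tail_energy \<phi> f K) * norm_L2 f"
    using f h by (simp add: inner_L2_diff proj_L2)
  then show "(norm_L2 h)\<^sup>2 \<le> norm_L2 f * sqrt (\<Sum>j=1..K. (inner_L2 h (\<phi> j))\<^sup>2) + norm_L2 f * sqrt (tail_energy \<phi> f K)"
    using 1 fh by (simp add: mult.commute)
qed

end

section \<open>Orders of magnitude of the weights\<close>

locale test_weights =
  fixes r \<sigma> :: real and \<kappa> :: "nat \<Rightarrow> nat \<Rightarrow> real"
  assumes r: "0 < r" "r < 1 / 2" and \<sigma>: "0 < \<sigma>"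
    and A1: "A1 \<kappa>" and A2: "A2 \<sigma> \<kappa>" and A3: "A3 r \<kappa>" and A4: "A4 \<kappa>" and A5: "A5 \<kappa>"
begin

abbreviation w :: "nat \<Rightarrow> nat \<Rightarrow> real" where "w n j \<equiv> (\<kappa> n (Suc j))\<^sup>2"

lemma kappa_antimono: "1 \<le> n \<Longrightarrow> 1 \<le> i \<Longrightarrow> i \<le> j \<Longrightarrow> (\<kappa> n j)\<^sup>2 \<le> (\<kappa> n i)\<^sup>2"
  using A1 by (auto simp: A1_def monotone_on_def)

lemma summable_w: "1 \<le> n \<Longrightarrow> summable (w n)"
  using A3 by (auto simp: A3_def)

lemma rho_pos: "1 \<le> n \<Longrightarrow> 0 < rho \<kappa> n"
proof -
  assume n: "1 \<le> n"
  obtain c1 where c1: "0 < c1" "c1 * real n powr (- 2 * r) \<le> rho \<kappa> n" using A3 n by (auto simp: A3_def)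
  have "0 < c1 * real n powr (- 2 * r)" using c1 n by simp
  then show ?thesis using c1 by linarith
qed

lemma summable_w_sq:
  assumes "1 \<le> n"
  shows "summable (\<lambda>j. (\<kappa> n (Suc j)) ^ 4)"
    "(\<Sum>j. (\<kappa> n (Suc j)) ^ 4) \<le> (\<kappa> n 1)\<^sup>2 * rho \<kappa> n"
proof -
  have le: "(\<kappa> n (Suc j)) ^ 4 \<le> (\<kappa> n 1)\<^sup>2 * w n j" for j
    using mult_right_mono[OF kappa_antimono[OF assms, of 1 "Suc j"], of "w n j"]
    by (simp add: power4_eq_xxxx power2_eq_square mult.assoc)
  have sm: "summable (\<lambda>j. (\<kappa> n 1)\<^sup>2 * w n j)" by (intro summable_mult summable_w assms)
  show s: "summable (\<lambda>j. (\<kappa> n (Suc j)) ^ 4)"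
    by (rule summable_comparison_test'[OF sm, of 0]) (use le in auto)
  have "(\<Sum>j. (\<kappa> n (Suc j)) ^ 4) \<le> (\<Sum>j. (\<kappa> n 1)\<^sup>2 * w n j)"
    by (rule suminf_le[OF le s sm])
  then show "(\<Sum>j. (\<kappa> n (Suc j)) ^ 4) \<le> (\<kappa> n 1)\<^sup>2 * rho \<kappa> n"
    using suminf_mult[OF summable_w[OF assms]] by (simp add: rho_def)
qed

text \<open>The partial sums converge to \<open>\<rho>\<^sub>n > \<rho>\<^sub>n / 2\<close>, so the set in the definition of \<open>k_index\<close> is finite and its
  supremum is its maximum; that \<open>k + 1\<close> is not in the set gives the strict inequality.\<close>

lemma k_index_props:
  assumes n: "1 \<le> n"
  defines "k \<equiv> k_index \<kappa> n"
  shows "1 \<le> k" "rho \<kappa> n / 2 < (\<Sum>j=1..k. (\<kappa> n j)\<^sup>2)" "(\<Sum>j=1..k. (\<kappa> n j)\<^sup>2) \<le> rho \<kappa> n" "0 < kappa_sq \<kappa> n"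
proof -
  let ?S = "{k. 1 \<le> k \<and> (\<Sum>j=1..<k. (\<kappa> n j)\<^sup>2) \<le> rho \<kappa> n / 2}"
  have shift: "(\<Sum>j=1..<Suc N. (\<kappa> n j)\<^sup>2) = (\<Sum>j<N. w n j)" for N
    by (simp add: sum.atLeast1_atMost_eq atLeastLessThanSuc_atLeastAtMost)
  have "(\<lambda>N. \<Sum>j<N. w n j) \<longlonglongrightarrow> rho \<kappa> n"
    unfolding rho_def by (rule summable_LIMSEQ[OF summable_w[OF n]])
  then have "eventually (\<lambda>N. rho \<kappa> n / 2 < (\<Sum>j<N. w n j)) sequentially"
    using rho_pos[OF n] by (intro order_tendstoD) auto
  then obtain N where N: "rho \<kappa> n / 2 < (\<Sum>j<N. w n j)"
    by (auto simp: eventually_sequentially)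
  have bd: "k' \<le> N" if "k' \<in> ?S" for k'
  proof (rule ccontr)
    assume "\<not> k' \<le> N"
    then have "(\<Sum>j=1..<Suc N. (\<kappa> n j)\<^sup>2) \<le> (\<Sum>j=1..<k'. (\<kappa> n j)\<^sup>2)"
      by (intro sum_mono2) auto
    then show False using that N unfolding shift by simp
  qed
  then have fin: "finite ?S" by (intro finite_subset[of ?S "{..N}"]) auto
  have one: "1 \<in> ?S" using rho_pos[OF n] by simp
  then have ne: "?S \<noteq> {}" by blast
  have kM: "k = Max ?S" unfolding k_def k_index_def using Sup_nat_def ne by auto
  have kin: "k \<in> ?S" unfolding kM by (rule Max_in[OF fin ne])
  then show k1: "1 \<le> k" by simp
  have "Suc k \<notin> ?S" using Max_ge[OF fin, of "Suc k"] kM by auto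
  then show gt: "rho \<kappa> n / 2 < (\<Sum>j=1..k. (\<kappa> n j)\<^sup>2)"
    by (simp add: atLeastLessThanSuc_atLeastAtMost not_le)
  have "(\<Sum>j=1..k. (\<kappa> n j)\<^sup>2) = (\<Sum>j<k. w n j)" by (simp add: sum.atLeast1_atMost_eq)
  also have "\<dots> \<le> rho \<kappa> n" unfolding rho_def by (intro sum_le_suminf summable_w n) auto
  finally show "(\<Sum>j=1..k. (\<kappa> n j)\<^sup>2) \<le> rho \<kappa> n" .
  have "(\<Sum>j=1..k. (\<kappa> n j)\<^sup>2) = (\<Sum>j=1..<k. (\<kappa> n j)\<^sup>2) + (\<kappa> n k)\<^sup>2"
    using k1 by (metis atLeastLessThanSuc_atLeastAtMost sum.atLeastLessThan_Suc)
  moreover have "(\<Sum>j=1..<k. (\<kappa> n j)\<^sup>2) \<le> rho \<kappa> n / 2" using kin by simp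
  ultimately have "0 < (\<kappa> n k)\<^sup>2" using gt by linarith
  then show "0 < kappa_sq \<kappa> n" by (simp add: kappa_sq_def k_def)
qed

lemma kappa_sq_le: "1 \<le> n \<Longrightarrow> 1 \<le> j \<Longrightarrow> j \<le> k_index \<kappa> n \<Longrightarrow> kappa_sq \<kappa> n \<le> (\<kappa> n j)\<^sup>2"
  unfolding kappa_sq_def by (rule kappa_antimono)

lemma kappa_le_kappa_sq:
  obtains L where "0 < L" "\<And>n j. 1 \<le> n \<Longrightarrow> 1 \<le> j \<Longrightarrow> (\<kappa> n j)\<^sup>2 \<le> L * kappa_sq \<kappa> n"
proof -
  obtain L where L: "0 < L" "\<And>n. 1 \<le> n \<Longrightarrow> (\<kappa> n 1)\<^sup>2 / kappa_sq \<kappa> n \<le> L"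
    using A5 by (auto simp: A5_def same_order_def)
  have "(\<kappa> n j)\<^sup>2 \<le> L * kappa_sq \<kappa> n" if "1 \<le> n" "1 \<le> j" for n j
  proof -
    have "(\<kappa> n j)\<^sup>2 \<le> (\<kappa> n 1)\<^sup>2" using kappa_antimono[of n 1 j] that by simp
    also have "\<dots> \<le> L * kappa_sq \<kappa> n"
      using L(2)[OF that(1)] k_index_props(4)[OF that(1)] by (simp add: divide_le_eq)
    finally show ?thesis .
  qed
  then show thesis using that L(1) by blast
qed

lemma sum_kappa4_bounds:
  obtains v1 v2 where "0 < v1" "0 < v2"
    "\<And>n. 1 \<le> n \<Longrightarrow> v1 \<le> (real n)\<^sup>2 * (\<Sum>j. (\<kappa> n (Suc j)) ^ 4)"
    "\<And>n. 1 \<le> n \<Longrightarrow> (real n)\<^sup>2 * (\<Sum>j. (\<kappa> n (Suc j)) ^ 4) \<le> v2"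
proof -
  obtain C1 C2 where C: "0 < C1" "0 < C2"
    "\<And>n. 1 \<le> n \<Longrightarrow> C1 < (real n)\<^sup>2 / \<sigma> ^ 4 * (\<Sum>j. (\<kappa> n (Suc j)) ^ 4)"
    "\<And>n. 1 \<le> n \<Longrightarrow> (real n)\<^sup>2 / \<sigma> ^ 4 * (\<Sum>j. (\<kappa> n (Suc j)) ^ 4) < C2"
    using A2 by (auto simp: A2_def)
  have s: "0 < \<sigma> ^ 4" using \<sigma> by simp
  show thesis
  proof (rule that[of "C1 * \<sigma> ^ 4" "C2 * \<sigma> ^ 4"])
    show "0 < C1 * \<sigma> ^ 4" "0 < C2 * \<sigma> ^ 4" using C s by auto
    fix n :: nat assume n: "1 \<le> n"
    show "C1 * \<sigma> ^ 4 \<le> (real n)\<^sup>2 * (\<Sum>j. (\<kappa> n (Suc j)) ^ 4)"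
      using C(3)[OF n] s by (simp add: field_simps)
    show "(real n)\<^sup>2 * (\<Sum>j. (\<kappa> n (Suc j)) ^ 4) \<le> C2 * \<sigma> ^ 4"
      using C(4)[OF n] s by (simp add: field_simps)
  qed
qed

text \<open>Since at least half of \<open>\<rho>\<^sub>n\<close> comes from the first \<open>k\<^sub>n\<close> weights, all comparable to \<open>\<kappa>\<^sub>n\<^sup>2\<close>, one has
  \<open>k\<^sub>n \<kappa>\<^sub>n\<^sup>2\<close> of order \<open>\<rho>\<^sub>n\<close>, that is, \<open>n\<^bsup>-2r\<^esup>\<close>. Likewise \<open>\<Sum> \<kappa>\<^sub>n\<^sub>j\<^sup>4\<close> lies between multiples of
  \<open>k\<^sub>n \<kappa>\<^sub>n\<^sup>4\<close> and \<open>\<kappa>\<^sub>n\<^sup>2 \<rho>\<^sub>n\<close>, both of order \<open>\<kappa>\<^sub>n\<^sup>2 n\<^bsup>-2r\<^esup>\<close>, and it is of order \<open>n\<^sup>-\<^sup>2\<close>.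
  Solving the two relations gives \<open>\<kappa>\<^sub>n\<^sup>2\<close> and \<open>k\<^sub>n\<close>.\<close>

lemma orders:
  obtains b1 b2 h1 h2 where "0 < b1" "0 < b2" "0 < h1" "0 < h2"
    "\<And>n. 1 \<le> n \<Longrightarrow> b1 * real n powr (2 - 4 * r) \<le> real (k_index \<kappa> n)"
    "\<And>n. 1 \<le> n \<Longrightarrow> real (k_index \<kappa> n) \<le> b2 * real n powr (2 - 4 * r)"
    "\<And>n. 1 \<le> n \<Longrightarrow> h1 * real n powr (2 * r - 2) \<le> kappa_sq \<kappa> n"
    "\<And>n. 1 \<le> n \<Longrightarrow> kappa_sq \<kappa> n \<le> h2 * real n powr (2 * r - 2)"
proof -
  obtain L where L: "0 < L" "\<And>n j. 1 \<le> n \<Longrightarrow> 1 \<le> j \<Longrightarrow> (\<kappa> n j)\<^sup>2 \<le> L * kappa_sq \<kappa> n"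
    using kappa_le_kappa_sq by metis
  obtain v1 v2 where v: "0 < v1" "0 < v2"
    "\<And>n. 1 \<le> n \<Longrightarrow> v1 \<le> (real n)\<^sup>2 * (\<Sum>j. (\<kappa> n (Suc j)) ^ 4)"
    "\<And>n. 1 \<le> n \<Longrightarrow> (real n)\<^sup>2 * (\<Sum>j. (\<kappa> n (Suc j)) ^ 4) \<le> v2"
    using sum_kappa4_bounds by metis
  obtain c1 c2 where c: "0 < c1" "0 < c2"
    "\<And>n. 1 \<le> n \<Longrightarrow> c1 * real n powr (- 2 * r) \<le> rho \<kappa> n"
    "\<And>n. 1 \<le> n \<Longrightarrow> rho \<kappa> n \<le> c2 * real n powr (- 2 * r)"
    using A3 by (auto simp: A3_def)
  define h1 where "h1 = v1 / (L * c2)"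
  define h2 where "h2 = 2 * L * v2 / c1"
  have h: "0 < h1" "0 < h2" unfolding h1_def h2_def using v c L by auto
  have main: "c1 / (2 * L) * real n powr (- 2 * r) \<le> real (k_index \<kappa> n) * kappa_sq \<kappa> n \<and>
     real (k_index \<kappa> n) * kappa_sq \<kappa> n \<le> c2 * real n powr (- 2 * r) \<and>
     h1 * real n powr (2 * r - 2) \<le> kappa_sq \<kappa> n \<and> kappa_sq \<kappa> n \<le> h2 * real n powr (2 * r - 2)"
    if n: "1 \<le> n" for n
  proof -
    let ?k = "k_index \<kappa> n" and ?K = "kappa_sq \<kappa> n" and ?V = "\<Sum>j. (\<kappa> n (Suc j)) ^ 4"
    note kp = k_index_props[OF n]
    have np: "real n > 0" using n by simp
    have p1: "real n powr (- 2 * r) > 0" "real n powr (2 * r - 2) > 0" using np by auto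
    have pw: "real n powr (2 * r - 2) * ((real n)\<^sup>2 * real n powr (- 2 * r)) = 1"
      using np by (simp add: powr_realpow[symmetric] powr_add[symmetric] flip: powr_numeral)
    have lo: "rho \<kappa> n / 2 \<le> real ?k * (L * ?K)"
      using kp(2) sum_bounded_above[of "{1..?k}" "\<lambda>j. (\<kappa> n j)\<^sup>2" "L * ?K"] L(2)[OF n] by fastforce
    have up: "real ?k * ?K \<le> rho \<kappa> n"
      using kp(3) sum_bounded_below[of "{1..?k}" "?K" "\<lambda>j. (\<kappa> n j)\<^sup>2"] kappa_sq_le[OF n] by fastforce
    have 1: "c1 / (2 * L) * real n powr (- 2 * r) \<le> real ?k * ?K"
      using lo c(3)[OF n] L(1) by (simp add: field_simps)
    have 2: "real ?k * ?K \<le> c2 * real n powr (- 2 * r)" using up c(4)[OF n] by linarith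
    have V_up: "?V \<le> L * ?K * (c2 * real n powr (- 2 * r))"
    proof -
      have "?V \<le> (\<kappa> n 1)\<^sup>2 * rho \<kappa> n" by (rule summable_w_sq[OF n])
      also have "\<dots> \<le> (L * ?K) * (c2 * real n powr (- 2 * r))"
        using L(2)[OF n, of 1] c(4)[OF n] rho_pos[OF n] L(1) kp(4) by (intro mult_mono) auto
      finally show ?thesis .
    qed
    have V_lo: "real ?k * ?K\<^sup>2 \<le> ?V"
    proof -
      have "real ?k * ?K\<^sup>2 = (\<Sum>j<?k. ?K\<^sup>2)" by simp
      also have "\<dots> \<le> (\<Sum>j<?k. (\<kappa> n (Suc j)) ^ 4)"
      proof (rule sum_mono)
        fix j assume "j \<in> {..<?k}"
        then have "?K \<le> w n j" by (intro kappa_sq_le n) auto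
        then have "?K\<^sup>2 \<le> (w n j)\<^sup>2" using kp(4) by (intro power_mono) auto
        then show "?K\<^sup>2 \<le> (\<kappa> n (Suc j)) ^ 4" by (simp add: power_mult[symmetric])
      qed
      also have "\<dots> \<le> ?V" by (intro sum_le_suminf summable_w_sq n) auto
      finally show ?thesis .
    qed
    have n2: "(real n)\<^sup>2 > 0" using np by simp
    have 3: "h1 * real n powr (2 * r - 2) \<le> ?K"
    proof -
      have "v1 \<le> (real n)\<^sup>2 * (L * ?K * (c2 * real n powr (- 2 * r)))"
        using v(3)[OF n] mult_left_mono[OF V_up, of "(real n)\<^sup>2"] n2 by linarith
      then have "v1 * real n powr (2 * r - 2) \<le>
          (real n)\<^sup>2 * (L * ?K * (c2 * real n powr (- 2 * r))) * real n powr (2 * r - 2)"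
        using p1 by (intro mult_right_mono) auto
      also have "\<dots> = L * c2 * ?K * (real n powr (2 * r - 2) * ((real n)\<^sup>2 * real n powr (- 2 * r)))"
        by (simp only: ac_simps)
      also have "\<dots> = L * c2 * ?K" unfolding pw by simp
      finally show ?thesis unfolding h1_def using L c by (simp add: field_simps)
    qed
    have 4: "?K \<le> h2 * real n powr (2 * r - 2)"
    proof -
      have "c1 / (2 * L) * real n powr (- 2 * r) * ?K \<le> real ?k * ?K * ?K"
        using 1 kp(4) by (intro mult_right_mono) auto
      also have "\<dots> \<le> ?V" using V_lo by (simp add: power2_eq_square)
      finally have "(real n)\<^sup>2 * (c1 / (2 * L) * real n powr (- 2 * r) * ?K) \<le> v2"
        using v(4)[OF n] mult_left_mono[of _ ?V "(real n)\<^sup>2"] n2 by fastforce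
      then have "(real n)\<^sup>2 * (c1 / (2 * L) * real n powr (- 2 * r) * ?K) * real n powr (2 * r - 2) \<le> v2 * real n powr (2 * r - 2)"
        using p1 by (intro mult_right_mono) auto
      also have "(real n)\<^sup>2 * (c1 / (2 * L) * real n powr (- 2 * r) * ?K) * real n powr (2 * r - 2)
         = c1 / (2 * L) * ?K * (real n powr (2 * r - 2) * ((real n)\<^sup>2 * real n powr (- 2 * r)))"
        by (simp only: ac_simps)
      also have "\<dots> = c1 / (2 * L) * ?K" unfolding pw by simp
      finally show ?thesis unfolding h2_def using L c by (simp add: field_simps)
    qed
    show ?thesis using 1 2 3 4 by blast
  qed
  show thesis
  proof (rule that[of "c1 / (2 * L) / h2" "c2 / h1" h1 h2])
    show "0 < c1 / (2 * L) / h2" "0 < c2 / h1" using c L h by auto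
    show "0 < h1" "0 < h2" by fact+
    fix n :: nat assume n: "1 \<le> n"
    note m = main[OF n]
    show "h1 * real n powr (2 * r - 2) \<le> kappa_sq \<kappa> n" "kappa_sq \<kappa> n \<le> h2 * real n powr (2 * r - 2)"
      using m by auto
    have np: "real n > 0" using n by simp
    have p1: "real n powr (2 * r - 2) > 0" using np by simp
    have pw: "real n powr (2 - 4 * r) * real n powr (2 * r - 2) = real n powr (- 2 * r)"
      by (simp add: powr_add[symmetric])
    have "c1 / (2 * L) * real n powr (- 2 * r) \<le> real (k_index \<kappa> n) * (h2 * real n powr (2 * r - 2))"
      using m mult_left_mono[of "kappa_sq \<kappa> n" "h2 * real n powr (2 * r - 2)" "real (k_index \<kappa> n)"] by linarith
    then have "(c1 / (2 * L) * real n powr (2 - 4 * r)) * real n powr (2 * r - 2) \<le> (real (k_index \<kappa> n) * h2) * real n powr (2 * r - 2)"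
      unfolding pw[symmetric] by (simp only: mult.assoc)
    then have "c1 / (2 * L) * real n powr (2 - 4 * r) \<le> real (k_index \<kappa> n) * h2"
      using p1 by (rule mult_right_le_imp_le)
    then have "c1 / (2 * L) * real n powr (2 - 4 * r) / h2 \<le> real (k_index \<kappa> n)"
      using h(2) by (subst pos_divide_le_eq)
    then show "c1 / (2 * L) / h2 * real n powr (2 - 4 * r) \<le> real (k_index \<kappa> n)"
      by simp
    have "real (k_index \<kappa> n) * (h1 * real n powr (2 * r - 2)) \<le> c2 * real n powr (- 2 * r)"
      using m mult_left_mono[of "h1 * real n powr (2 * r - 2)" "kappa_sq \<kappa> n" "real (k_index \<kappa> n)"] by linarith
    then have "(real (k_index \<kappa> n) * h1) * real n powr (2 * r - 2) \<le> (c2 * real n powr (2 - 4 * r)) * real n powr (2 * r - 2)"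
      unfolding pw[symmetric] by (simp only: mult.assoc)
    then have "real (k_index \<kappa> n) * h1 \<le> c2 * real n powr (2 - 4 * r)"
      using p1 by (rule mult_right_le_imp_le)
    then show "real (k_index \<kappa> n) \<le> c2 / h1 * real n powr (2 - 4 * r)"
      using h by (simp add: field_simps)
  qed
qed

end

section \<open>Consistency in terms of the weighted energy\<close>

locale white_noise_tests = test_weights r \<sigma> \<kappa> + L2_basis \<phi>
  for r \<sigma> :: real and \<kappa> :: "nat \<Rightarrow> nat \<Rightarrow> real" and \<phi> :: "nat \<Rightarrow> real \<Rightarrow> real" +
  fixes M :: "'w measure" and \<xi> :: "nat \<Rightarrow> 'w \<Rightarrow> real"
  assumes iid: "iid_std_normal M \<xi>"
begin

sublocale gaussian_sequence M "\<lambda>j. \<xi> (Suc j)"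
  by (rule gaussian_sequence_of_iid[OF iid])

text \<open>Standard deviation under the hypothesis, in units of \<open>\<sigma>\<^sup>2 / n\<close>.\<close>

definition null_sd :: "nat \<Rightarrow> real" where
  "null_sd n = sqrt (2 * (\<Sum>j. (\<kappa> n (Suc j)) ^ 4))"

definition unit_w :: "nat \<Rightarrow> nat \<Rightarrow> real" where
  "unit_w n j = w n j / null_sd n"

definition noise_units :: "nat \<Rightarrow> (real \<Rightarrow> real) \<Rightarrow> nat \<Rightarrow> real" where
  "noise_units n g j = inner_L2 g (\<phi> (Suc j)) * sqrt (real n) / \<sigma>"

text \<open>The mean of the test statistic under the alternative \<open>g\<close>.\<close>

definition energy :: "nat \<Rightarrow> (real \<Rightarrow> real) \<Rightarrow> real" where
  "energy n g = (\<Sum>j. w n j * (inner_L2 g (\<phi> (Suc j)))\<^sup>2)"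

lemma null_sd_bounds:
  obtains V1 V2 where "0 < V1" "0 < V2" "\<And>n. 1 \<le> n \<Longrightarrow> V1 \<le> real n * null_sd n"
    "\<And>n. 1 \<le> n \<Longrightarrow> real n * null_sd n \<le> V2"
proof -
  obtain v1 v2 where v: "0 < v1" "0 < v2"
    "\<And>n. 1 \<le> n \<Longrightarrow> v1 \<le> (real n)\<^sup>2 * (\<Sum>j. (\<kappa> n (Suc j)) ^ 4)"
    "\<And>n. 1 \<le> n \<Longrightarrow> (real n)\<^sup>2 * (\<Sum>j. (\<kappa> n (Suc j)) ^ 4) \<le> v2"
    using sum_kappa4_bounds by metis
  have eq: "real n * null_sd n = sqrt (2 * ((real n)\<^sup>2 * (\<Sum>j. (\<kappa> n (Suc j)) ^ 4)))" for n
    by (simp add: null_sd_def real_sqrt_mult)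
  show thesis
    by (rule that[of "sqrt (2 * v1)" "sqrt (2 * v2)"]) (use v in \<open>auto simp: eq\<close>)
qed

lemma null_sd_pos: "1 \<le> n \<Longrightarrow> 0 < null_sd n"
proof -
  assume n: "1 \<le> n"
  obtain V1 where "0 < V1" "\<And>n. 1 \<le> n \<Longrightarrow> V1 \<le> real n * null_sd n"
    using null_sd_bounds by metis
  then have "0 < real n * null_sd n" using n by fastforce
  then show ?thesis using n by (simp add: zero_less_mult_iff)
qed

lemma summable_noise_units_sq: "g \<in> L2 \<Longrightarrow> summable (\<lambda>j. (noise_units n g j)\<^sup>2)"
  unfolding noise_units_def power_mult_distrib power_divide
  by (intro summable_divide summable_mult2 sums_summable[OF Parseval])

lemma summable_energy:
  assumes n: "1 \<le> n" and "g \<in> L2"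
  shows "summable (\<lambda>j. w n j * (inner_L2 g (\<phi> (Suc j)))\<^sup>2)"
proof -
  have "summable (\<lambda>j. (\<kappa> n 1)\<^sup>2 * (inner_L2 g (\<phi> (Suc j)))\<^sup>2)"
    by (intro summable_mult sums_summable[OF Parseval] assms)
  then show ?thesis
    by (rule summable_comparison_test'[of _ 0])
      (use kappa_antimono[OF n, of 1] in \<open>auto intro!: mult_right_mono\<close>)
qed

lemma energy_nonneg: "1 \<le> n \<Longrightarrow> g \<in> L2 \<Longrightarrow> 0 \<le> energy n g"
  unfolding energy_def by (intro suminf_nonneg summable_energy) auto

lemma noise_units_zero: "noise_units n (\<lambda>_. 0) = (\<lambda>_. 0)"
  by (simp add: noise_units_def fun_eq_iff)

text \<open>The largest normalised weight is of order \<open>n \<kappa>\<^sub>n\<^sup>2\<close>, hence of order \<open>n\<^bsup>2r-1\<^esup>\<close>, and \<open>r < 1/2\<close>.\<close>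

lemma unit_weights_unit_w:
  assumes "0 < \<delta>"
  shows "eventually (\<lambda>n. unit_weights (unit_w n) \<delta>) sequentially"
proof -
  obtain L where L: "0 < L" "\<And>n j. 1 \<le> n \<Longrightarrow> 1 \<le> j \<Longrightarrow> (\<kappa> n j)\<^sup>2 \<le> L * kappa_sq \<kappa> n"
    using kappa_le_kappa_sq by metis
  obtain h2 where h2: "0 < h2" "\<And>n. 1 \<le> n \<Longrightarrow> kappa_sq \<kappa> n \<le> h2 * real n powr (2 * r - 2)"
    using orders by metis
  obtain V1 where V1: "0 < V1" "\<And>n. 1 \<le> n \<Longrightarrow> V1 \<le> real n * null_sd n"
    using null_sd_bounds by metis
  have "(\<lambda>n. L * h2 / V1 * real n powr (2 * r - 1)) \<longlonglongrightarrow> L * h2 / V1 * 0"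
    using r by (intro tendsto_mult tendsto_const tendsto_neg_powr filterlim_real_sequentially) auto
  then have "eventually (\<lambda>n. L * h2 / V1 * real n powr (2 * r - 1) < \<delta>) sequentially"
    using assms by (intro order_tendstoD) auto
  then show ?thesis using eventually_ge_at_top[of 1]
  proof eventually_elim
    case (elim n)
    then have n: "1 \<le> n" and np: "0 < real n" by auto
    note V = null_sd_pos[OF n]
    have le: "unit_w n j \<le> \<delta>" for j
    proof -
      have "w n j \<le> L * kappa_sq \<kappa> n" using L(2)[OF n, of "Suc j"] by simp
      also have "\<dots> \<le> L * (h2 * real n powr (2 * r - 2))"
        using h2(2)[OF n] L(1) by (intro mult_left_mono) auto
      also have "\<dots> = (L * h2 / V1 * real n powr (2 * r - 1)) * (V1 / real n)"
        using V1(1) np by (simp add: powr_diff powr_numeral power2_eq_square)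
      also have "\<dots> \<le> \<delta> * null_sd n"
      proof (rule mult_mono)
        show "L * h2 / V1 * real n powr (2 * r - 1) \<le> \<delta>" using elim(1) by simp
        show "V1 / real n \<le> null_sd n" using V1(2)[OF n] np by (simp add: divide_le_eq mult.commute)
      qed (use assms V1 in auto)
      finally show ?thesis using V by (simp add: unit_w_def divide_le_eq)
    qed
    have "(\<lambda>j. (unit_w n j)\<^sup>2) sums ((\<Sum>j. (\<kappa> n (Suc j)) ^ 4) / (null_sd n)\<^sup>2)"
      unfolding unit_w_def power_divide
      using sums_divide[OF summable_sums[OF summable_w_sq(1)[OF n]]]
      by (simp add: power_mult[symmetric])
    moreover have "(null_sd n)\<^sup>2 = 2 * (\<Sum>j. (\<kappa> n (Suc j)) ^ 4)"
      unfolding null_sd_def by (simp add: suminf_nonneg summable_w_sq(1)[OF n])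
    ultimately have "(\<lambda>j. (unit_w n j)\<^sup>2) sums (1/2)"
      using V by (auto simp: null_sd_def)
    moreover have "summable (unit_w n)"
      unfolding unit_w_def by (intro summable_divide summable_w n)
    ultimately show ?case using le V
      unfolding unit_weights_def by (auto simp: unit_w_def)
  qed
qed

lemma signal_in_units_of_sd:
  assumes n: "1 \<le> n" and g: "g \<in> L2"
  shows "(\<Sum>j. unit_w n j * (noise_units n g j)\<^sup>2) = (real n)\<^sup>2 * energy n g / (\<sigma>\<^sup>2 * (real n * null_sd n))"
proof -
  have "(\<Sum>j. unit_w n j * (noise_units n g j)\<^sup>2) = (\<Sum>j. real n / (\<sigma>\<^sup>2 * null_sd n) * (w n j * (inner_L2 g (\<phi> (Suc j)))\<^sup>2))"
    by (intro suminf_cong) (simp add: unit_w_def noise_units_def power_mult_distrib power_divide mult_ac)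
  also have "\<dots> = real n / (\<sigma>\<^sup>2 * null_sd n) * energy n g"
    unfolding energy_def by (rule suminf_mult[OF summable_energy[OF n g]])
  finally show ?thesis using n by (simp add: power2_eq_square)
qed

lemma signal_bounds:
  obtains u1 u2 where "0 < u1" "0 < u2"
    "\<And>n g. 1 \<le> n \<Longrightarrow> g \<in> L2 \<Longrightarrow> u1 * ((real n)\<^sup>2 * energy n g) \<le> (\<Sum>j. unit_w n j * (noise_units n g j)\<^sup>2)"
    "\<And>n g. 1 \<le> n \<Longrightarrow> g \<in> L2 \<Longrightarrow> (\<Sum>j. unit_w n j * (noise_units n g j)\<^sup>2) \<le> u2 * ((real n)\<^sup>2 * energy n g)"
proof -
  obtain V1 V2 where V: "0 < V1" "0 < V2" "\<And>n. 1 \<le> n \<Longrightarrow> V1 \<le> real n * null_sd n"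
    "\<And>n. 1 \<le> n \<Longrightarrow> real n * null_sd n \<le> V2"
    using null_sd_bounds by metis
  show thesis
  proof (rule that[of "1 / (\<sigma>\<^sup>2 * V2)" "1 / (\<sigma>\<^sup>2 * V1)"])
    show "0 < 1 / (\<sigma>\<^sup>2 * V2)" "0 < 1 / (\<sigma>\<^sup>2 * V1)" using V \<sigma> by auto
    fix n :: nat and g assume n: "1 \<le> n" and g: "g \<in> L2"
    have e: "0 \<le> (real n)\<^sup>2 * energy n g" using energy_nonneg[OF n g] by simp
    note V' = V(3,4)[OF n]
    have N: "0 < real n" "0 < null_sd n" using n null_sd_pos[OF n] by auto
    have "(real n)\<^sup>2 * energy n g / (\<sigma>\<^sup>2 * V2) \<le> (\<Sum>j. unit_w n j * (noise_units n g j)\<^sup>2)"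
      unfolding signal_in_units_of_sd[OF n g] using V(1,2) V' N \<sigma> e
      by (intro divide_left_mono mult_left_mono mult_pos_pos) auto
    then show "1 / (\<sigma>\<^sup>2 * V2) * ((real n)\<^sup>2 * energy n g) \<le> (\<Sum>j. unit_w n j * (noise_units n g j)\<^sup>2)" by simp
    have "(\<Sum>j. unit_w n j * (noise_units n g j)\<^sup>2) \<le> (real n)\<^sup>2 * energy n g / (\<sigma>\<^sup>2 * V1)"
      unfolding signal_in_units_of_sd[OF n g] using V(1,2) V' N \<sigma> e
      by (intro divide_left_mono mult_left_mono mult_pos_pos) auto
    then show "(\<Sum>j. unit_w n j * (noise_units n g j)\<^sup>2) \<le> 1 / (\<sigma>\<^sup>2 * V1) * ((real n)\<^sup>2 * energy n g)" by simp
  qed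
qed

lemma measurable_test_stat [measurable]: "test_stat \<xi> \<sigma> \<phi> \<kappa> n g \<in> borel_measurable M"
  unfolding test_stat_def[abs_def] obs_def by measurable

text \<open>Almost surely only: off the event where the series of weighted squared noise converges, the series in
  \<open>test_stat\<close> and \<open>quad_form\<close> have unrelated default values.\<close>

lemma AE_test_stat:
  assumes n: "1 \<le> n" and g: "g \<in> L2"
  shows "AE \<omega> in M. test_stat \<xi> \<sigma> \<phi> \<kappa> n g \<omega> = \<sigma>\<^sup>2 * null_sd n / real n * quad_form (unit_w n) (noise_units n g) \<omega>"
  using AE_summable_weighted_squares[of "w n", OF zero_le_power2 summable_w[OF n]]
proof eventually_elim
  case (elim \<omega>)
  let ?b = "noise_units n g" and ?z = "\<lambda>j. \<xi> (Suc j) \<omega>"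
  have np: "0 < real n" using n by simp
  note V = null_sd_pos[OF n]
  have wb: "summable (\<lambda>j. w n j * (?b j)\<^sup>2)"
  proof -
    have "summable (\<lambda>j. w n j * (inner_L2 g (\<phi> (Suc j)))\<^sup>2 * (real n / \<sigma>\<^sup>2))"
      by (intro summable_mult2 summable_energy n g)
    then show ?thesis by (simp add: noise_units_def power_mult_distrib power_divide mult_ac)
  qed
  have s: "summable (\<lambda>j. w n j * (?z j + ?b j)\<^sup>2)"
  proof (rule summable_comparison_test'[OF summable_mult[OF summable_add[OF elim wb], of 2], of 0])
    fix j :: nat
    have "(?z j + ?b j)\<^sup>2 \<le> 2 * ((?z j)\<^sup>2 + (?b j)\<^sup>2)"
      using sum_squares_bound[of "?z j" "?b j"] by (simp add: power2_sum)
    then have "w n j * (?z j + ?b j)\<^sup>2 \<le> w n j * (2 * ((?z j)\<^sup>2 + (?b j)\<^sup>2))"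
      by (intro mult_left_mono) auto
    then show "norm (w n j * (?z j + ?b j)\<^sup>2) \<le> 2 * (w n j * (?z j)\<^sup>2 + w n j * (?b j)\<^sup>2)"
      by (simp add: algebra_simps)
  qed
  have obs: "(obs \<xi> \<sigma> \<phi> n g (Suc j) \<omega>)\<^sup>2 = \<sigma>\<^sup>2 / real n * (?z j + ?b j)\<^sup>2" for j
  proof -
    have "obs \<xi> \<sigma> \<phi> n g (Suc j) \<omega> = \<sigma> / sqrt (real n) * (?z j + ?b j)"
      unfolding obs_def noise_units_def using \<sigma> np by (simp add: field_simps)
    then show ?thesis by (simp add: power_mult_distrib power_divide)
  qed
  have "(\<Sum>j. w n j * (obs \<xi> \<sigma> \<phi> n g (Suc j) \<omega>)\<^sup>2) = (\<Sum>j. \<sigma>\<^sup>2 / real n * (w n j * (?z j + ?b j)\<^sup>2))"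
    unfolding obs by (simp add: mult.left_commute)
  also have "\<dots> = \<sigma>\<^sup>2 / real n * (\<Sum>j. w n j * (?z j + ?b j)\<^sup>2)"
    by (rule suminf_mult[OF s])
  finally have 1: "test_stat \<xi> \<sigma> \<phi> \<kappa> n g \<omega> = \<sigma>\<^sup>2 / real n * ((\<Sum>j. w n j * (?z j + ?b j)\<^sup>2) - rho \<kappa> n)"
    by (simp add: test_stat_def right_diff_distrib)
  have "quad_form (unit_w n) ?b \<omega> = (\<Sum>j. (w n j * (?z j + ?b j)\<^sup>2 - w n j) / null_sd n)"
    unfolding quad_form_def unit_w_def by (intro suminf_cong) (simp add: field_simps)
  also have "\<dots> = (\<Sum>j. w n j * (?z j + ?b j)\<^sup>2 - w n j) / null_sd n"
    by (rule suminf_divide[OF summable_diff[OF s summable_w[OF n]]])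
  also have "(\<Sum>j. w n j * (?z j + ?b j)\<^sup>2 - w n j) = (\<Sum>j. w n j * (?z j + ?b j)\<^sup>2) - rho \<kappa> n"
    unfolding rho_def by (rule suminf_diff[OF s summable_w[OF n], symmetric])
  finally show "test_stat \<xi> \<sigma> \<phi> \<kappa> n g \<omega> = \<sigma>\<^sup>2 * null_sd n / real n * quad_form (unit_w n) ?b \<omega>"
    using 1 V by simp
qed

lemma errors_as_quad_form:
  assumes n: "1 \<le> n"
  defines "y \<equiv> \<lambda>x. x * real n / (\<sigma>\<^sup>2 * null_sd n)"
  shows "type_I_error M \<xi> \<sigma> \<phi> \<kappa> n x = prob {\<omega>\<in>space M. quad_form (unit_w n) (\<lambda>_. 0) \<omega> > y x}"
    and "g \<in> L2 \<Longrightarrow> type_II_error M \<xi> \<sigma> \<phi> \<kappa> n x g = prob {\<omega>\<in>space M. quad_form (unit_w n) (noise_units n g) \<omega> \<le> y x}"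
proof -
  define A where "A = \<sigma>\<^sup>2 * null_sd n / real n"
  have A: "0 < A" using null_sd_pos[OF n] \<sigma> n by (simp add: A_def)
  have y: "y x = x / A" by (simp add: y_def A_def)
  show "type_I_error M \<xi> \<sigma> \<phi> \<kappa> n x = prob {\<omega>\<in>space M. quad_form (unit_w n) (\<lambda>_. 0) \<omega> > y x}"
    unfolding type_I_error_def
  proof (rule finite_measure_eq_AE)
    show "AE \<omega> in M. (\<omega> \<in> {\<omega> \<in> space M. x < test_stat \<xi> \<sigma> \<phi> \<kappa> n (\<lambda>_. 0) \<omega>}) =
       (\<omega> \<in> {\<omega>\<in>space M. quad_form (unit_w n) (\<lambda>_. 0) \<omega> > y x})"
      using AE_test_stat[OF n L2_zero, folded A_def]
      by eventually_elim (simp add: y noise_units_zero pos_divide_less_eq[OF A] mult.commute)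
  qed auto
  assume g: "g \<in> L2"
  show "type_II_error M \<xi> \<sigma> \<phi> \<kappa> n x g = prob {\<omega>\<in>space M. quad_form (unit_w n) (noise_units n g) \<omega> \<le> y x}"
    unfolding type_II_error_def
  proof (rule finite_measure_eq_AE)
    show "AE \<omega> in M. (\<omega> \<in> {\<omega> \<in> space M. test_stat \<xi> \<sigma> \<phi> \<kappa> n g \<omega> \<le> x}) =
       (\<omega> \<in> {\<omega>\<in>space M. quad_form (unit_w n) (noise_units n g) \<omega> \<le> y x})"
      using AE_test_stat[OF n g, folded A_def]
      by eventually_elim (simp add: y pos_le_divide_eq[OF A] mult.commute)
  qed auto
qed

lemma inconsistent_if_energy_vanishes:
  assumes m: "strict_mono m" "\<And>i. 1 \<le> m i" and g: "\<And>i. g i \<in> L2"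
    and lim: "(\<lambda>i. (real (m i))\<^sup>2 * energy (m i) (g i)) \<longlonglongrightarrow> 0"
  shows "inconsistent_along M \<xi> \<sigma> \<phi> \<kappa> m g"
  unfolding inconsistent_along_def
proof
  fix x :: "nat \<Rightarrow> real"
  let ?e = "\<lambda>i. type_I_error M \<xi> \<sigma> \<phi> \<kappa> (m i) (x i) + type_II_error M \<xi> \<sigma> \<phi> \<kappa> (m i) (x i) (g i)"
  obtain u2 where u2: "0 < u2"
    "\<And>n g. 1 \<le> n \<Longrightarrow> g \<in> L2 \<Longrightarrow> (\<Sum>j. unit_w n j * (noise_units n g j)\<^sup>2) \<le> u2 * ((real n)\<^sup>2 * energy n g)"
    using signal_bounds by metis
  have ev: "eventually (\<lambda>i. 1 - \<epsilon> \<le> ?e i) sequentially" if "0 < \<epsilon>" for \<epsilon>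
  proof -
    obtain \<delta> where \<delta>: "0 < \<delta>"
      "\<And>q b x. unit_weights q \<delta> \<Longrightarrow> summable (\<lambda>j. (b j)\<^sup>2) \<Longrightarrow> (\<Sum>j. q j * (b j)\<^sup>2) \<le> \<delta> \<Longrightarrow>
      1 - \<epsilon> \<le> prob {\<omega>\<in>space M. quad_form q (\<lambda>_. 0) \<omega> > x} + prob {\<omega>\<in>space M. quad_form q b \<omega> \<le> x}"
      by (rule errors_under_small_signal[OF \<open>0 < \<epsilon>\<close>], rule that)
    have "eventually (\<lambda>i. unit_weights (unit_w (m i)) \<delta>) sequentially"
      by (rule eventually_compose_filterlim[OF unit_weights_unit_w[OF \<delta>(1)] filterlim_subseq[OF m(1)]])
    moreover have "eventually (\<lambda>i. (real (m i))\<^sup>2 * energy (m i) (g i) < \<delta> / u2) sequentially"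
      using lim \<delta>(1) u2(1) by (intro order_tendstoD) auto
    ultimately show ?thesis
    proof eventually_elim
      case (elim i)
      have "u2 * ((real (m i))\<^sup>2 * energy (m i) (g i)) \<le> \<delta>"
        using elim(2) u2(1) by (simp add: pos_less_divide_eq mult.commute)
      then have "(\<Sum>j. unit_w (m i) j * (noise_units (m i) (g i) j)\<^sup>2) \<le> \<delta>"
        using u2(2)[OF m(2) g, of i i] by linarith
      then show ?case
        unfolding errors_as_quad_form(1)[OF m(2)] errors_as_quad_form(2)[OF m(2) g]
        by (rule \<delta>(2)[OF elim(1) summable_noise_units_sq[OF g]])
    qed
  qed
  have "ereal 1 \<le> liminf (\<lambda>i. ereal (?e i))"
    unfolding le_Liminf_iff
  proof (intro allI impI)
    fix y assume y: "y < ereal 1"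
    show "eventually (\<lambda>i. y < ereal (?e i)) sequentially"
    proof (cases y)
      case (real t)
      then have "eventually (\<lambda>i. 1 - (1 - t) / 2 \<le> ?e i) sequentially" using y by (intro ev) auto
      then show ?thesis
      proof eventually_elim
        case (elim i)
        have "t < 1 - (1 - t) / 2" using y real by (simp add: field_simps)
        then show ?case using elim real by simp
      qed
    qed (use y in auto)
  qed
  then show "1 \<le> liminf (\<lambda>i. ereal (?e i))" by (simp add: one_ereal_def)
qed

text \<open>Along the indices at which the energy is at least \<open>D\<close>, the test of asymptotic level \<open>1/2\<close> would have total
  error bounded away from \<open>1\<close>, so there can be only finitely many such indices.\<close>

lemma energy_vanishes_if_inconsistent:
  assumes m: "strict_mono m" "\<And>i. 1 \<le> m i" and g: "\<And>i. g i \<in> L2"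
    and inc: "inconsistent_along M \<xi> \<sigma> \<phi> \<kappa> m g"
  shows "(\<lambda>i. (real (m i))\<^sup>2 * energy (m i) (g i)) \<longlonglongrightarrow> 0"
proof (rule order_tendstoI)
  fix a :: real assume "a < 0"
  then show "eventually (\<lambda>i. a < (real (m i))\<^sup>2 * energy (m i) (g i)) sequentially"
    by (intro always_eventually allI order.strict_trans2[OF _ mult_nonneg_nonneg] energy_nonneg m g) auto
next
  fix D :: real assume D: "0 < D"
  obtain u1 where u1: "0 < u1"
    "\<And>n g. 1 \<le> n \<Longrightarrow> g \<in> L2 \<Longrightarrow> u1 * ((real n)\<^sup>2 * energy n g) \<le> (\<Sum>j. unit_w n j * (noise_units n g j)\<^sup>2)"
    using signal_bounds by metis
  have "0 < u1 * D" using u1 D by simp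
  then obtain \<epsilon> \<delta> where \<epsilon>: "0 < \<epsilon>" and \<delta>: "0 < \<delta>" and pow:
    "\<And>q b x. unit_weights q \<delta> \<Longrightarrow> summable (\<lambda>j. (b j)\<^sup>2) \<Longrightarrow> u1 * D \<le> (\<Sum>j. q j * (b j)\<^sup>2) \<Longrightarrow>
      1/2 - \<epsilon> \<le> prob {\<omega>\<in>space M. quad_form q (\<lambda>_. 0) \<omega> > x} \<Longrightarrow>
      prob {\<omega>\<in>space M. quad_form q b \<omega> \<le> x} \<le> 1 - 1/2 - \<epsilon>"
    by (rule power_under_large_signal[of "u1 * D" "1/2"]) (use that in auto)
  obtain z where "\<And>\<epsilon>. 0 < \<epsilon> \<Longrightarrow> \<exists>\<delta>>0. \<forall>q. unit_weights q \<delta> \<longrightarrow>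
    \<bar>prob {\<omega>\<in>space M. quad_form q (\<lambda>_. 0) \<omega> > z} - 1/2\<bar> \<le> \<epsilon>"
    by (rule threshold_of_level[of "1/2"]) (use that in auto)
  from this[of "\<epsilon> / 2"] \<epsilon> obtain \<delta>' where \<delta>': "0 < \<delta>'" and lev: "\<And>q. unit_weights q \<delta>' \<Longrightarrow>
    \<bar>prob {\<omega>\<in>space M. quad_form q (\<lambda>_. 0) \<omega> > z} - 1/2\<bar> \<le> \<epsilon> / 2" by auto
  \<comment> \<open>The threshold \<open>z\<close> of the normalised statistic, expressed on the scale of \<open>test_stat\<close>.\<close>
  define x where "x i = z * (\<sigma>\<^sup>2 * null_sd (m i)) / real (m i)" for i
  have x: "x i * real (m i) / (\<sigma>\<^sup>2 * null_sd (m i)) = z" for i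
    using null_sd_pos[OF m(2), of i] m(2)[of i] \<sigma> by (simp add: x_def)
  let ?e = "\<lambda>i. type_I_error M \<xi> \<sigma> \<phi> \<kappa> (m i) (x i) + type_II_error M \<xi> \<sigma> \<phi> \<kappa> (m i) (x i) (g i)"
  have "1 \<le> liminf (\<lambda>i. ereal (?e i))" using inc by (simp add: inconsistent_along_def)
  moreover have "ereal (1 - \<epsilon> / 2) < 1" using \<epsilon> by (simp add: one_ereal_def)
  ultimately have "eventually (\<lambda>i. ereal (1 - \<epsilon> / 2) < ereal (?e i)) sequentially"
    unfolding le_Liminf_iff by blast
  moreover have "eventually (\<lambda>i. unit_weights (unit_w (m i)) \<delta>) sequentially"
    "eventually (\<lambda>i. unit_weights (unit_w (m i)) \<delta>') sequentially"
    by (rule eventually_compose_filterlim[OF unit_weights_unit_w[OF \<delta>] filterlim_subseq[OF m(1)]],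
        rule eventually_compose_filterlim[OF unit_weights_unit_w[OF \<delta>'] filterlim_subseq[OF m(1)]])
  ultimately show "eventually (\<lambda>i. (real (m i))\<^sup>2 * energy (m i) (g i) < D) sequentially"
  proof eventually_elim
    case (elim i)
    show ?case
    proof (rule ccontr)
      assume "\<not> ?case"
      then have "u1 * D \<le> u1 * ((real (m i))\<^sup>2 * energy (m i) (g i))"
        using u1(1) by (intro mult_left_mono) auto
      then have big: "u1 * D \<le> (\<Sum>j. unit_w (m i) j * (noise_units (m i) (g i) j)\<^sup>2)"
        using u1(2)[OF m(2) g, of i i] by linarith
      have I: "\<bar>type_I_error M \<xi> \<sigma> \<phi> \<kappa> (m i) (x i) - 1/2\<bar> \<le> \<epsilon> / 2"
        using lev[OF elim(3)] unfolding errors_as_quad_form(1)[OF m(2)] x .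
      have "type_II_error M \<xi> \<sigma> \<phi> \<kappa> (m i) (x i) (g i) \<le> 1 - 1/2 - \<epsilon>"
        using I \<epsilon> unfolding errors_as_quad_form(1)[OF m(2)] errors_as_quad_form(2)[OF m(2) g] x
        by (intro pow elim summable_noise_units_sq g big) linarith
      then show False using I elim(1) unfolding less_ereal.simps by linarith
    qed
  qed
qed

lemma consistent_if_energy_bounded_below:
  assumes g: "\<And>n. 1 \<le> n \<Longrightarrow> g n \<in> L2" and D: "0 < D"
    and low: "\<And>n. 1 \<le> n \<Longrightarrow> D \<le> (real n)\<^sup>2 * energy n (g n)"
  shows "consistent M \<xi> \<sigma> \<phi> \<kappa> g"
  unfolding consistent_def
proof (intro ballI allI impI)
  fix \<alpha> :: real and x :: "nat \<Rightarrow> real"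
  assume \<alpha>: "\<alpha> \<in> {0<..<1}" and eq: "(\<lambda>n. type_I_error M \<xi> \<sigma> \<phi> \<kappa> n (x n)) \<sim>[sequentially] (\<lambda>_. \<alpha>)"
  have lim: "(\<lambda>n. type_I_error M \<xi> \<sigma> \<phi> \<kappa> n (x n)) \<longlonglongrightarrow> \<alpha>"
    using tendsto_asymp_equiv_cong[OF eq] by simp
  obtain u1 where u1: "0 < u1"
    "\<And>n g. 1 \<le> n \<Longrightarrow> g \<in> L2 \<Longrightarrow> u1 * ((real n)\<^sup>2 * energy n g) \<le> (\<Sum>j. unit_w n j * (noise_units n g j)\<^sup>2)"
    using signal_bounds by metis
  have "0 < u1 * D" using u1 D by simp
  then obtain \<epsilon> \<delta> where \<epsilon>: "0 < \<epsilon>" and \<delta>: "0 < \<delta>" and pow: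
    "\<And>q b x. unit_weights q \<delta> \<Longrightarrow> summable (\<lambda>j. (b j)\<^sup>2) \<Longrightarrow> u1 * D \<le> (\<Sum>j. q j * (b j)\<^sup>2) \<Longrightarrow>
      \<alpha> - \<epsilon> \<le> prob {\<omega>\<in>space M. quad_form q (\<lambda>_. 0) \<omega> > x} \<Longrightarrow>
      prob {\<omega>\<in>space M. quad_form q b \<omega> \<le> x} \<le> 1 - \<alpha> - \<epsilon>"
    by (rule power_under_large_signal[of "u1 * D" \<alpha>]) (use that \<alpha> in auto)
  have "eventually (\<lambda>n. \<alpha> - \<epsilon> < type_I_error M \<xi> \<sigma> \<phi> \<kappa> n (x n)) sequentially"
    using lim \<epsilon> by (intro order_tendstoD) auto
  then have "eventually (\<lambda>n. ereal (type_II_error M \<xi> \<sigma> \<phi> \<kappa> n (x n) (g n)) \<le> ereal (1 - \<alpha> - \<epsilon>)) sequentially"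
    using unit_weights_unit_w[OF \<delta>] eventually_ge_at_top[of 1]
  proof eventually_elim
    case (elim n)
    have "u1 * D \<le> u1 * ((real n)\<^sup>2 * energy n (g n))"
      using u1(1) low[OF elim(3)] by (intro mult_left_mono) auto
    then have big: "u1 * D \<le> (\<Sum>j. unit_w n j * (noise_units n (g n) j)\<^sup>2)"
      using u1(2)[OF elim(3) g[OF elim(3)]] by linarith
    show ?case
      using elim(1)
      unfolding errors_as_quad_form(1)[OF elim(3)] errors_as_quad_form(2)[OF elim(3) g[OF elim(3)]] ereal_less_eq
      by (intro pow elim summable_noise_units_sq g big) linarith
  qed
  then have "limsup (\<lambda>n. ereal (type_II_error M \<xi> \<sigma> \<phi> \<kappa> n (x n) (g n))) \<le> ereal (1 - \<alpha> - \<epsilon>)"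
    by (rule Limsup_bounded)
  also have "\<dots> < ereal (1 - \<alpha>)" using \<epsilon> by simp
  finally show "limsup (\<lambda>n. ereal (type_II_error M \<xi> \<sigma> \<phi> \<kappa> n (x n) (g n))) < ereal (1 - \<alpha>)" .
qed

section \<open>Concentration on low frequencies\<close>

text \<open>By A5 and monotonicity, all weights up to \<open>a k\<^sub>n\<close> are at least a multiple of \<open>\<kappa>\<^sub>n\<^sup>2\<close>, and
  \<open>n\<^sup>2 \<kappa>\<^sub>n\<^sup>2\<close> is of order \<open>n\<^bsup>2r\<^esup>\<close>: low frequencies are visible to the test.\<close>

lemma energy_lower_bound:
  assumes a: "2 \<le> a"
  obtains D where "0 < D"
    "\<And>n g. 1 \<le> n \<Longrightarrow> g \<in> L2 \<Longrightarrow>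
      D * real n powr (2 * r) * (\<Sum>j=1..a * k_index \<kappa> n. (inner_L2 g (\<phi> j))\<^sup>2) \<le> (real n)\<^sup>2 * energy n g"
proof -
  obtain h1 where h1: "0 < h1" "\<And>n. 1 \<le> n \<Longrightarrow> h1 * real n powr (2 * r - 2) \<le> kappa_sq \<kappa> n"
    using orders by metis
  have "1 < real a" using a by simp
  then obtain C where C: "0 < C" "\<And>n. 1 \<le> n \<Longrightarrow> C * kappa_sq \<kappa> n \<le> (\<kappa> n (nat \<lfloor>real a * real (k_index \<kappa> n)\<rfloor>))\<^sup>2"
    using A5 unfolding A5_def by blast
  have fl: "nat \<lfloor>real a * real k\<rfloor> = a * k" for k :: nat
    by (metis floor_of_nat nat_int of_nat_mult)
  have "C * h1 * real n powr (2 * r) * (\<Sum>j=1..a * k_index \<kappa> n. (inner_L2 g (\<phi> j))\<^sup>2) \<le> (real n)\<^sup>2 * energy n g"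
    if n: "1 \<le> n" and g: "g \<in> L2" for n g
  proof -
    let ?K = "a * k_index \<kappa> n" and ?S = "\<Sum>j=1..a * k_index \<kappa> n. (inner_L2 g (\<phi> j))\<^sup>2"
    have np: "0 < real n" using n by simp
    have S: "0 \<le> ?S" by (simp add: sum_nonneg)
    have "C * kappa_sq \<kappa> n * ?S = (\<Sum>j<?K. C * kappa_sq \<kappa> n * (inner_L2 g (\<phi> (Suc j)))\<^sup>2)"
      by (simp add: sum.atLeast1_atMost_eq sum_distrib_left)
    also have "\<dots> \<le> (\<Sum>j<?K. w n j * (inner_L2 g (\<phi> (Suc j)))\<^sup>2)"
    proof (intro sum_mono mult_right_mono)
      fix j assume "j \<in> {..<?K}"
      then have "(\<kappa> n ?K)\<^sup>2 \<le> w n j" by (intro kappa_antimono n) auto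
      then show "C * kappa_sq \<kappa> n \<le> w n j" using C(2)[OF n] unfolding fl by linarith
    qed auto
    also have "\<dots> \<le> energy n g"
      unfolding energy_def by (intro sum_le_suminf summable_energy n g) auto
    finally have 1: "C * kappa_sq \<kappa> n * ?S \<le> energy n g" .
    have "(real n)\<^sup>2 * (C * (h1 * real n powr (2 * r - 2)) * ?S) \<le> (real n)\<^sup>2 * (C * kappa_sq \<kappa> n * ?S)"
      using C(1) h1(2)[OF n] S by (intro mult_left_mono mult_right_mono) auto
    also have "\<dots> \<le> (real n)\<^sup>2 * energy n g" using 1 by (intro mult_left_mono) auto
    finally show ?thesis using np by (simp add: powr_diff powr_numeral)
  qed
  then show thesis using that[of "C * h1"] C(1) h1(1) by auto
qed

text \<open>By A4 with \<open>1 + \<delta> = a\<close>, the weights beyond \<open>a k\<^sub>n\<close> are at most a multiple of \<open>\<kappa>\<^sub>n\<^sup>2 / a\<close>: high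
  frequencies are nearly invisible to the test.\<close>

lemma residual_energy_upper_bound:
  obtains D where "0 < D"
    "\<And>a n g. 2 \<le> a \<Longrightarrow> 1 \<le> n \<Longrightarrow> g \<in> L2 \<Longrightarrow>
      (real n)\<^sup>2 * energy n (\<lambda>t. g t - proj \<phi> g (a * k_index \<kappa> n) t) \<le> D / real a * real n powr (2 * r) * (norm_L2 g)\<^sup>2"
proof -
  obtain h2 where h2: "0 < h2" "\<And>n. 1 \<le> n \<Longrightarrow> kappa_sq \<kappa> n \<le> h2 * real n powr (2 * r - 2)"
    using orders by metis
  obtain C l where l: "1 < l" and C: "\<And>\<delta> n. 0 < \<delta> \<Longrightarrow> 1 \<le> n \<Longrightarrow>
     (\<kappa> n (nat \<lfloor>(1 + \<delta>) * real (k_index \<kappa> n)\<rfloor>))\<^sup>2 < C * (1 + \<delta>) powr (- l) * kappa_sq \<kappa> n"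
    using A4 by (auto simp: A4_def)
  \<comment> \<open>The constant in A4 is positive, because it bounds a square strictly.\<close>
  have "0 < C * (1 + 1) powr (- l) * kappa_sq \<kappa> 1"
    using C[of 1 1] zero_le_power2 by (meson less_le_trans not_less order_refl zero_less_one)
  then have C0: "0 < C" using k_index_props(4)[of 1] by (simp add: zero_less_mult_iff)
  have fl: "nat \<lfloor>real a * real k\<rfloor> = a * k" for a k :: nat
    by (metis floor_of_nat nat_int of_nat_mult)
  have "(real n)\<^sup>2 * energy n (\<lambda>t. g t - proj \<phi> g (a * k_index \<kappa> n) t) \<le> C * h2 / real a * real n powr (2 * r) * (norm_L2 g)\<^sup>2"
    if a: "2 \<le> a" and n: "1 \<le> n" and g: "g \<in> L2" for a n :: nat and g
  proof -
    let ?K = "a * k_index \<kappa> n" and ?R = "\<lambda>t. g t - proj \<phi> g (a * k_index \<kappa> n) t"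
    have np: "0 < real n" and ap: "0 < real a" using n a by auto
    have K: "1 \<le> ?K" using a k_index_props(1)[OF n] by simp
    have R: "?R \<in> L2" by (intro L2_diff g proj_L2)
    have "(\<kappa> n ?K)\<^sup>2 \<le> C * real a powr (- l) * kappa_sq \<kappa> n"
      using C[of "real a - 1" n] a n by (simp add: fl less_imp_le)
    also have "\<dots> \<le> C * real a powr (- 1) * kappa_sq \<kappa> n"
      using C0 l a k_index_props(4)[OF n] by (intro mult_right_mono mult_left_mono powr_mono) auto
    also have "\<dots> = C / real a * kappa_sq \<kappa> n" using ap by (simp add: powr_minus_divide)
    finally have \<kappa>K: "(\<kappa> n ?K)\<^sup>2 \<le> C / real a * kappa_sq \<kappa> n" .
    have coeff: "inner_L2 ?R (\<phi> (Suc j)) = (if Suc j \<le> ?K then 0 else inner_L2 g (\<phi> (Suc j)))" for j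
      by (simp add: inner_L2_diff g proj_L2 basis_L2 coeff_proj)
    have term_le: "w n j * (inner_L2 ?R (\<phi> (Suc j)))\<^sup>2 \<le> (\<kappa> n ?K)\<^sup>2 * (inner_L2 g (\<phi> (Suc j)))\<^sup>2" for j
      unfolding coeff using kappa_antimono[OF n K, of "Suc j"] by (auto intro!: mult_right_mono)
    have "energy n ?R \<le> (\<Sum>j. (\<kappa> n ?K)\<^sup>2 * (inner_L2 g (\<phi> (Suc j)))\<^sup>2)"
      unfolding energy_def
      by (intro suminf_le term_le summable_energy n R summable_mult sums_summable[OF Parseval] g)
    also have "\<dots> = (\<kappa> n ?K)\<^sup>2 * (norm_L2 g)\<^sup>2"
      using Parseval[OF g] by (simp add: suminf_mult sums_iff)
    also have "\<dots> \<le> (C / real a * kappa_sq \<kappa> n) * (norm_L2 g)\<^sup>2"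
      using \<kappa>K by (intro mult_right_mono) auto
    also have "\<dots> \<le> (C / real a * (h2 * real n powr (2 * r - 2))) * (norm_L2 g)\<^sup>2"
      using h2(2)[OF n] C0 ap by (intro mult_right_mono mult_left_mono) auto
    finally have "(real n)\<^sup>2 * energy n ?R \<le> (real n)\<^sup>2 * ((C / real a * (h2 * real n powr (2 * r - 2))) * (norm_L2 g)\<^sup>2)"
      by (intro mult_left_mono) auto
    then show ?thesis using np by (simp add: powr_diff powr_numeral)
  qed
  then show thesis using that[of "C * h2"] C0 h2(1) by auto
qed

text \<open>The condition to which both sides of the equivalence reduce. Cutting at integer multiples of \<open>k\<^sub>n\<close> avoids
  rounding in A4 and A5.\<close>

definition low_frequency :: "(nat \<Rightarrow> real \<Rightarrow> real) \<Rightarrow> bool" where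
  "low_frequency f \<longleftrightarrow> (\<forall>\<epsilon>>0. \<exists>a\<ge>2. \<forall>n\<ge>1.
     tail_energy \<phi> (f n) (a * k_index \<kappa> n) \<le> \<epsilon> * real n powr (- 2 * r))"

lemma powr_sq: "(real n powr x)\<^sup>2 = real n powr (2 * x)"
  by (simp add: power2_eq_square powr_add[symmetric])

end

locale rate_signals = white_noise_tests r \<sigma> \<kappa> \<phi> M \<xi>
  for r \<sigma> :: real and \<kappa> :: "nat \<Rightarrow> nat \<Rightarrow> real" and \<phi> :: "nat \<Rightarrow> real \<Rightarrow> real"
    and M :: "'w measure" and \<xi> :: "nat \<Rightarrow> 'w \<Rightarrow> real" +
  fixes f :: "nat \<Rightarrow> real \<Rightarrow> real" and c C :: real
  assumes f_L2: "\<And>n. 1 \<le> n \<Longrightarrow> f n \<in> L2"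
    and c: "0 < c" and f_lower: "\<And>n. 1 \<le> n \<Longrightarrow> c * real n powr (- r) \<le> norm_L2 (f n)"
    and C: "0 < C" and f_upper: "\<And>n. 1 \<le> n \<Longrightarrow> norm_L2 (f n) \<le> C * real n powr (- r)"
begin

lemma f_norm_sq: "1 \<le> n \<Longrightarrow> (norm_L2 (f n))\<^sup>2 \<le> C\<^sup>2 * real n powr (- 2 * r)"
  using power_mono[OF f_upper[of n], of 2] by (simp add: power_mult_distrib powr_sq)

lemma Besov_exponent:
  assumes "s = r / (2 - 4 * r)"
  shows "0 < s" "(2 - 4 * r) * (2 * s) = 2 * r"
proof -
  have "0 < 2 - 4 * r" using r by simp
  then show "0 < s" "(2 - 4 * r) * (2 * s) = 2 * r" using r(1) by (simp_all add: assms)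
qed

text \<open>Truncation at \<open>a k\<^sub>n\<close> has no frequencies above \<open>a k\<^sub>n\<close>, and below that point \<open>u\<^bsup>2s\<^esup>\<close> is at most of order
  \<open>k\<^sub>n\<^bsup>2s\<^esup>\<close>, hence of order \<open>n\<^bsup>2r\<^esup>\<close>, which compensates \<open>\<parallel>f\<^sub>n\<parallel>\<^sup>2\<close>.\<close>

lemma low_frequency_imp_Besov:
  assumes s: "s = r / (2 - 4 * r)" and lf: "low_frequency f" and "0 < \<epsilon>"
  shows "\<exists>\<gamma>>0. \<exists>f1. \<forall>n\<ge>1. f1 n \<in> Besov_body \<phi> s \<gamma> \<and>
       norm_L2 (\<lambda>t. f n t - f1 n t) \<le> \<epsilon> * real n powr (- r) \<and>
       (norm_L2 (f n))\<^sup>2 = (norm_L2 (f1 n))\<^sup>2 + (norm_L2 (\<lambda>t. f n t - f1 n t))\<^sup>2"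
proof -
  note s0 = Besov_exponent(1)[OF s] and s2 = Besov_exponent(2)[OF s]
  have "0 < \<epsilon>\<^sup>2" using \<open>0 < \<epsilon>\<close> by simp
  then obtain a where a: "2 \<le> a" "\<And>n. 1 \<le> n \<Longrightarrow> tail_energy \<phi> (f n) (a * k_index \<kappa> n) \<le> \<epsilon>\<^sup>2 * real n powr (- 2 * r)"
    using lf unfolding low_frequency_def by blast
  obtain b2 where b2: "0 < b2" "\<And>n. 1 \<le> n \<Longrightarrow> real (k_index \<kappa> n) \<le> b2 * real n powr (2 - 4 * r)"
    using orders by metis
  define \<gamma> where "\<gamma> = (a * b2) powr (2 * s) * C\<^sup>2"
  have "0 < \<gamma>" using a b2 C by (simp add: \<gamma>_def)
  have "proj \<phi> (f n) (a * k_index \<kappa> n) \<in> Besov_body \<phi> s \<gamma> \<and>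
       norm_L2 (\<lambda>t. f n t - proj \<phi> (f n) (a * k_index \<kappa> n) t) \<le> \<epsilon> * real n powr (- r) \<and>
       (norm_L2 (f n))\<^sup>2 = (norm_L2 (proj \<phi> (f n) (a * k_index \<kappa> n)))\<^sup>2 +
         (norm_L2 (\<lambda>t. f n t - proj \<phi> (f n) (a * k_index \<kappa> n) t))\<^sup>2" if n: "1 \<le> n" for n
  proof (intro conjI)
    let ?K = "a * k_index \<kappa> n"
    let ?P = "proj \<phi> (f n) ?K"
    have np: "0 < real n" using n by simp
    show "(norm_L2 (f n))\<^sup>2 = (norm_L2 ?P)\<^sup>2 + (norm_L2 (\<lambda>t. f n t - ?P t))\<^sup>2"
      using Pythagoras_proj[OF f_L2[OF n]] by (simp add: tail_energy_def)
    have "(norm_L2 (\<lambda>t. f n t - ?P t))\<^sup>2 \<le> (\<epsilon> * real n powr (- r))\<^sup>2"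
      using a(2)[OF n] by (simp add: tail_energy_def power_mult_distrib powr_sq)
    then show "norm_L2 (\<lambda>t. f n t - ?P t) \<le> \<epsilon> * real n powr (- r)"
      by (rule power2_le_imp_le) (use \<open>0 < \<epsilon>\<close> in auto)
    have "u powr (2 * s) * tail_energy \<phi> ?P (nat \<lfloor>u\<rfloor>) \<le> \<gamma>" if u: "0 < u" for u
    proof (cases "?K \<le> nat \<lfloor>u\<rfloor>")
      case True
      have "tail_energy \<phi> ?P ?K = 0"
        by (simp add: tail_energy_eq proj_L2 norm_proj_sq coeff_proj)
      then have "tail_energy \<phi> ?P (nat \<lfloor>u\<rfloor>) = 0"
        using tail_energy_antimono[OF proj_L2 True, of "f n" ?K] tail_energy_bounds(1)[OF proj_L2, of "f n" ?K "nat \<lfloor>u\<rfloor>"]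
        by simp
      then show ?thesis using \<open>0 < \<gamma>\<close> by simp
    next
      case False
      then have "u \<le> real ?K" using u by (simp add: not_le nat_less_iff floor_less_iff)
      also have "\<dots> \<le> (a * b2) * real n powr (2 - 4 * r)"
        using mult_left_mono[OF b2(2)[OF n], of "real a"] by (simp add: mult.assoc)
      finally have "u powr (2 * s) \<le> ((a * b2) * real n powr (2 - 4 * r)) powr (2 * s)"
        using u s0 by (intro powr_mono2) auto
      also have "\<dots> = (a * b2) powr (2 * s) * real n powr (2 * r)"
        using b2(1) by (simp add: powr_mult powr_powr s2)
      finally have 1: "u powr (2 * s) \<le> (a * b2) powr (2 * s) * real n powr (2 * r)" .
      have "tail_energy \<phi> ?P (nat \<lfloor>u\<rfloor>) \<le> (norm_L2 ?P)\<^sup>2" by (rule tail_energy_bounds(2)[OF proj_L2])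
      also have "\<dots> \<le> (norm_L2 (f n))\<^sup>2"
        using Pythagoras_proj[OF f_L2[OF n], of ?K] tail_energy_bounds(1)[OF f_L2[OF n], of ?K] by simp
      also have "\<dots> \<le> C\<^sup>2 * real n powr (- 2 * r)" by (rule f_norm_sq[OF n])
      finally have "u powr (2 * s) * tail_energy \<phi> ?P (nat \<lfloor>u\<rfloor>) \<le>
          ((a * b2) powr (2 * s) * real n powr (2 * r)) * (C\<^sup>2 * real n powr (- 2 * r))"
        using 1 tail_energy_bounds(1)[OF proj_L2] by (intro mult_mono) auto
      also have "\<dots> = \<gamma> * (real n powr (2 * r) * real n powr (- 2 * r))" by (simp add: \<gamma>_def)
      also have "\<dots> = \<gamma>" using np by (simp add: powr_add[symmetric])
      finally show ?thesis .
    qed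
    then show "?P \<in> Besov_body \<phi> s \<gamma>" by (simp add: Besov_body_iff proj_L2)
  qed
  then show ?thesis using \<open>0 < \<gamma>\<close>
    by (intro exI[of _ \<gamma>] conjI exI[of _ "\<lambda>n. proj \<phi> (f n) (a * k_index \<kappa> n)"]) auto
qed

text \<open>A signal in the Besov ball has tail at most \<open>\<gamma> (a k\<^sub>n)\<^bsup>-2s\<^esup>\<close> beyond \<open>a k\<^sub>n\<close>, of order \<open>a\<^bsup>-2s\<^esup> n\<^bsup>-2r\<^esup>\<close>. By
  the triangle inequality the approximation error only adds to the root of the tail.\<close>

lemma Besov_imp_low_frequency:
  assumes s: "s = r / (2 - 4 * r)"
    and approx: "\<And>\<epsilon>. 0 < \<epsilon> \<Longrightarrow> \<exists>\<gamma>>0. \<exists>f1. \<forall>n\<ge>1. f1 n \<in> Besov_body \<phi> s \<gamma> \<and>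
       norm_L2 (\<lambda>t. f n t - f1 n t) \<le> \<epsilon> * real n powr (- r)"
  shows "low_frequency f"
  unfolding low_frequency_def
proof (intro allI impI)
  fix \<epsilon> :: real assume \<epsilon>: "0 < \<epsilon>"
  note s0 = Besov_exponent(1)[OF s] and s2 = Besov_exponent(2)[OF s]
  have "0 < sqrt \<epsilon> / 2" using \<epsilon> by simp
  then obtain \<gamma> f1 where \<gamma>: "0 < \<gamma>" and f1: "\<And>n. 1 \<le> n \<Longrightarrow> f1 n \<in> Besov_body \<phi> s \<gamma>"
    "\<And>n. 1 \<le> n \<Longrightarrow> norm_L2 (\<lambda>t. f n t - f1 n t) \<le> sqrt \<epsilon> / 2 * real n powr (- r)"
    using approx by blast
  obtain b1 where b1: "0 < b1" "\<And>n. 1 \<le> n \<Longrightarrow> b1 * real n powr (2 - 4 * r) \<le> real (k_index \<kappa> n)"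
    using orders by metis
  \<comment> \<open>Chosen so that \<open>X\<^bsup>2s\<^esup> = 4 \<gamma> / \<epsilon>\<close>; then \<open>a b\<^sub>1 \<ge> X\<close> makes the tail of \<open>f\<^sub>1\<^sub>n\<close> at most
    \<open>\<epsilon> n\<^bsup>-2r\<^esup> / 4\<close>.\<close>
  define X where "X = (4 * \<gamma> / \<epsilon>) powr (1 / (2 * s))"
  obtain a0 :: nat where a0: "X / b1 < real a0" using reals_Archimedean2 by blast
  define a where "a = max a0 2"
  have a: "2 \<le> a" "X \<le> a * b1"
    using a0 b1(1) by (auto simp: a_def pos_divide_less_eq intro: order_trans[OF less_imp_le mult_right_mono])
  have ab: "4 * \<gamma> / \<epsilon> \<le> (a * b1) powr (2 * s)"
  proof -
    have "4 * \<gamma> / \<epsilon> = X powr (2 * s)" using \<gamma> \<epsilon> s0 by (simp add: X_def powr_powr)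
    also have "\<dots> \<le> (a * b1) powr (2 * s)" using a s0 by (intro powr_mono2) (auto simp: X_def)
    finally show ?thesis .
  qed
  show "\<exists>a\<ge>2. \<forall>n\<ge>1. tail_energy \<phi> (f n) (a * k_index \<kappa> n) \<le> \<epsilon> * real n powr (- 2 * r)"
  proof (intro exI conjI allI impI)
    show "2 \<le> a" by fact
    fix n :: nat assume n: "1 \<le> n"
    let ?K = "a * k_index \<kappa> n"
    have np: "0 < real n" using n by simp
    have f1L: "f1 n \<in> L2" using f1(1)[OF n] by (simp add: Besov_body_iff)
    have K0: "0 < real ?K" using a k_index_props(1)[OF n] by simp
    have "(a * b1) * real n powr (2 - 4 * r) \<le> real ?K"
      using mult_left_mono[OF b1(2)[OF n], of "real a"] by (simp add: mult.assoc)
    then have "((a * b1) * real n powr (2 - 4 * r)) powr (2 * s) \<le> real ?K powr (2 * s)"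
      using b1(1) s0 by (intro powr_mono2) auto
    moreover have "((a * b1) * real n powr (2 - 4 * r)) powr (2 * s) = (a * b1) powr (2 * s) * real n powr (2 * r)"
      using b1(1) by (simp add: powr_mult powr_powr s2)
    ultimately have "4 * \<gamma> / \<epsilon> * real n powr (2 * r) \<le> real ?K powr (2 * s)"
      using mult_right_mono[OF ab, of "real n powr (2 * r)"] by simp
    then have "4 * \<gamma> / \<epsilon> * real n powr (2 * r) * tail_energy \<phi> (f1 n) ?K \<le> real ?K powr (2 * s) * tail_energy \<phi> (f1 n) ?K"
      using tail_energy_bounds(1)[OF f1L] by (intro mult_right_mono) auto
    also have "\<dots> \<le> \<gamma>"
      using f1(1)[OF n] K0 unfolding Besov_body_iff by (metis floor_of_nat nat_int)
    finally have "real n powr (2 * r) * tail_energy \<phi> (f1 n) ?K \<le> \<epsilon> / 4"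
      using \<gamma> \<epsilon> by (simp add: field_simps)
    then have "real n powr (- 2 * r) * (real n powr (2 * r) * tail_energy \<phi> (f1 n) ?K) \<le> real n powr (- 2 * r) * (\<epsilon> / 4)"
      by (intro mult_left_mono) auto
    moreover have "real n powr (- 2 * r) * (real n powr (2 * r) * tail_energy \<phi> (f1 n) ?K) = tail_energy \<phi> (f1 n) ?K"
      using np by (simp add: mult.assoc[symmetric] powr_add[symmetric])
    ultimately have "tail_energy \<phi> (f1 n) ?K \<le> real n powr (- 2 * r) * (\<epsilon> / 4)" by (simp only:)
    also have "\<dots> = (sqrt \<epsilon> / 2 * real n powr (- r))\<^sup>2"
      using \<epsilon> by (simp add: power_mult_distrib powr_sq power_divide)
    finally have "tail_energy \<phi> (f1 n) ?K \<le> (sqrt \<epsilon> / 2 * real n powr (- r))\<^sup>2" .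
    then have "sqrt (tail_energy \<phi> (f1 n) ?K) \<le> sqrt \<epsilon> / 2 * real n powr (- r)"
      using \<epsilon> by (intro real_le_lsqrt) (auto simp: tail_energy_bounds f1L)
    then have "sqrt (tail_energy \<phi> (f n) ?K) \<le> sqrt \<epsilon> * real n powr (- r)"
      using sqrt_tail_energy_le[OF f_L2[OF n] f1L, of ?K] f1(2)[OF n] by simp
    then have "(sqrt (tail_energy \<phi> (f n) ?K))\<^sup>2 \<le> (sqrt \<epsilon> * real n powr (- r))\<^sup>2"
      by (intro power_mono) (auto simp: tail_energy_bounds f_L2[OF n])
    then show "tail_energy \<phi> (f n) ?K \<le> \<epsilon> * real n powr (- 2 * r)"
      using \<epsilon> by (simp add: power_mult_distrib powr_sq tail_energy_bounds f_L2[OF n])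
  qed
qed

text \<open>At least half of \<open>c\<^sup>2 n\<^bsup>-2r\<^esup>\<close> lies below some \<open>a k\<^sub>n\<close>, where the test sees it; this gives consistency. An
  inconsistent component has vanishing weighted energy, hence vanishing energy below \<open>a k\<^sub>n\<close>, while \<open>f\<^sub>n\<close> has
  little above; then \<open>norm_sq_summand_le\<close> contradicts its lower bound.\<close>

lemma low_frequency_imp_purely_consistent:
  assumes lf: "low_frequency f"
  shows "purely_consistent M \<xi> \<sigma> \<phi> \<kappa> r f"
  unfolding purely_consistent_def rate_consistent_def
proof (intro conjI notI)
  show "same_order (\<lambda>n. norm_L2 (f n)) (\<lambda>n. real n powr - r)"
    unfolding same_order_def using c C f_lower f_upper
    by (intro exI[of _ c] exI[of _ C] conjI allI impI) (auto simp: pos_le_divide_eq pos_divide_le_eq)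
  show "consistent M \<xi> \<sigma> \<phi> \<kappa> f"
  proof -
    have "0 < c\<^sup>2 / 2" using c by simp
    then obtain a where a: "2 \<le> a" "\<And>n. 1 \<le> n \<Longrightarrow> tail_energy \<phi> (f n) (a * k_index \<kappa> n) \<le> c\<^sup>2 / 2 * real n powr (- 2 * r)"
      using lf unfolding low_frequency_def by blast
    obtain D where D: "0 < D" "\<And>n g. 1 \<le> n \<Longrightarrow> g \<in> L2 \<Longrightarrow>
      D * real n powr (2 * r) * (\<Sum>j=1..a * k_index \<kappa> n. (inner_L2 g (\<phi> j))\<^sup>2) \<le> (real n)\<^sup>2 * energy n g"
      using energy_lower_bound[OF a(1)] by metis
    show ?thesis
    proof (rule consistent_if_energy_bounded_below)
      show "f n \<in> L2" if "1 \<le> n" for n using f_L2 that .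
      show "0 < D * (c\<^sup>2 / 2)" using D c by simp
      fix n :: nat assume n: "1 \<le> n"
      let ?S = "\<Sum>j=1..a * k_index \<kappa> n. (inner_L2 (f n) (\<phi> j))\<^sup>2"
      have np: "0 < real n" using n by simp
      have "c\<^sup>2 * real n powr (- 2 * r) \<le> (norm_L2 (f n))\<^sup>2"
        using power_mono[OF f_lower[OF n], of 2] c by (simp add: power_mult_distrib powr_sq)
      then have "c\<^sup>2 / 2 * real n powr (- 2 * r) \<le> ?S"
        using a(2)[OF n] unfolding tail_energy_eq[OF f_L2[OF n]] by (simp add: field_simps)
      then have "D * real n powr (2 * r) * (c\<^sup>2 / 2 * real n powr (- 2 * r)) \<le> D * real n powr (2 * r) * ?S"
        using D by (intro mult_left_mono) auto
      also have "\<dots> \<le> (real n)\<^sup>2 * energy n (f n)" by (rule D(2)[OF n f_L2[OF n]])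
      also have "D * real n powr (2 * r) * (c\<^sup>2 / 2 * real n powr (- 2 * r)) =
          D * (c\<^sup>2 / 2) * (real n powr (2 * r) * real n powr (- 2 * r))" by (simp only: ac_simps)
      also have "\<dots> = D * (c\<^sup>2 / 2)" using np by (simp add: powr_add[symmetric])
      finally show "D * (c\<^sup>2 / 2) \<le> (real n)\<^sup>2 * energy n (f n)" .
    qed
  qed
  assume "\<exists>(m :: nat \<Rightarrow> nat) f1 f2.
          strict_mono m \<and> (\<forall>i. m i \<ge> 1) \<and>
          (\<forall>i. f1 i \<in> L2 \<and> f2 i \<in> L2 \<and>
               (AE t in leb01. f (m i) t = f1 i t + f2 i t) \<and>
               inner_L2 (f1 i) (f2 i) = 0) \<and>
          (\<exists>c1>0. \<forall>i. norm_L2 (f2 i) > c1 * real (m i) powr (- r)) \<and>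
          inconsistent_along M \<xi> \<sigma> \<phi> \<kappa> m f2"
  then obtain m :: "nat \<Rightarrow> nat" and f1 f2 c1 where m: "strict_mono m" "\<And>i. 1 \<le> m i"
    and f12: "\<And>i. f1 i \<in> L2" "\<And>i. f2 i \<in> L2" "\<And>i. AE t in leb01. f (m i) t = f1 i t + f2 i t"
      "\<And>i. inner_L2 (f1 i) (f2 i) = 0"
    and c1: "0 < c1" "\<And>i. c1 * real (m i) powr (- r) < norm_L2 (f2 i)"
    and inc: "inconsistent_along M \<xi> \<sigma> \<phi> \<kappa> m f2"
    by blast
  \<comment> \<open>Chosen so that the two contributions \<open>C \<surd>\<eta> n\<^bsup>-2r\<^esup>\<close> add up to \<open>c\<^sub>1\<^sup>2 n\<^bsup>-2r\<^esup>\<close>.\<close>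
  define \<eta> where "\<eta> = (c1\<^sup>2 / (2 * C))\<^sup>2"
  have \<eta>: "0 < \<eta>" "C * sqrt \<eta> = c1\<^sup>2 / 2" using c1 C by (auto simp: \<eta>_def)
  obtain a where a: "2 \<le> a" "\<And>n. 1 \<le> n \<Longrightarrow> tail_energy \<phi> (f n) (a * k_index \<kappa> n) \<le> \<eta> * real n powr (- 2 * r)"
    using lf \<eta>(1) unfolding low_frequency_def by blast
  obtain D where D: "0 < D" "\<And>n g. 1 \<le> n \<Longrightarrow> g \<in> L2 \<Longrightarrow>
      D * real n powr (2 * r) * (\<Sum>j=1..a * k_index \<kappa> n. (inner_L2 g (\<phi> j))\<^sup>2) \<le> (real n)\<^sup>2 * energy n g"
    using energy_lower_bound[OF a(1)] by metis
  have "(\<lambda>i. (real (m i))\<^sup>2 * energy (m i) (f2 i)) \<longlonglongrightarrow> 0"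
    by (rule energy_vanishes_if_inconsistent[OF m f12(2) inc])
  then have "eventually (\<lambda>i. (real (m i))\<^sup>2 * energy (m i) (f2 i) < D * \<eta>) sequentially"
    using D \<eta> by (intro order_tendstoD) auto
  then obtain i where i: "(real (m i))\<^sup>2 * energy (m i) (f2 i) < D * \<eta>"
    by (auto simp: eventually_sequentially)
  let ?n = "m i"
  let ?K = "a * k_index \<kappa> ?n"
  let ?S = "\<Sum>j=1..?K. (inner_L2 (f2 i) (\<phi> j))\<^sup>2"
  have np: "0 < real ?n" using m(2)[of i] by simp
  have pw: "sqrt (\<eta> * real ?n powr (- 2 * r)) = sqrt \<eta> * real ?n powr (- r)"
    by (simp add: real_sqrt_mult powr_sq[symmetric, of ?n "- r", simplified])
  have "D * (real ?n powr (2 * r) * ?S) < D * \<eta>" using D(2)[OF m(2) f12(2), of i i] i by (simp add: mult.assoc)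
  then have "real ?n powr (2 * r) * ?S < \<eta>" using D(1) by simp
  then have "?S \<le> \<eta> * real ?n powr (- 2 * r)"
    using np by (simp add: powr_minus field_simps)
  then have S: "sqrt ?S \<le> sqrt \<eta> * real ?n powr (- r)" unfolding pw[symmetric] by (rule real_sqrt_le_mono)
  have T: "sqrt (tail_energy \<phi> (f ?n) ?K) \<le> sqrt \<eta> * real ?n powr (- r)"
    unfolding pw[symmetric] by (rule real_sqrt_le_mono[OF a(2)[OF m(2)]])
  have "(norm_L2 (f2 i))\<^sup>2 \<le> norm_L2 (f ?n) * sqrt ?S + norm_L2 (f ?n) * sqrt (tail_energy \<phi> (f ?n) ?K)"
    by (rule norm_sq_summand_le[OF f_L2[OF m(2)] f12])
  also have "\<dots> \<le> (C * real ?n powr (- r)) * (sqrt \<eta> * real ?n powr (- r)) + (C * real ?n powr (- r)) * (sqrt \<eta> * real ?n powr (- r))"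
    using S T f_upper[OF m(2), of i] tail_energy_bounds(1)[OF f_L2[OF m(2)], of i ?K] C
    by (intro add_mono mult_mono) (auto simp: sum_nonneg)
  also have "\<dots> = 2 * (C * sqrt \<eta>) * (real ?n powr (- r))\<^sup>2" by (simp add: power2_eq_square)
  also have "\<dots> = (c1 * real ?n powr (- r))\<^sup>2" unfolding \<eta>(2) by (simp add: power_mult_distrib)
  also have "\<dots> < (norm_L2 (f2 i))\<^sup>2" using c1 by (intro power_strict_mono) auto
  finally show False by simp
qed

text \<open>If the condition fails at \<open>\<epsilon>\<close>, then for each \<open>i\<close> some sample size \<open>m\<^sub>i\<close> has energy above
  \<open>\<epsilon> m\<^sub>i\<^bsup>-2r\<^esup>\<close> beyond \<open>(i + 2) k\<close>, where \<open>k\<close> belongs to \<open>m\<^sub>i\<close>. The corresponding residuals are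
  orthogonal components of norm of order \<open>m\<^sub>i\<^bsup>-r\<^esup>\<close> whose weighted energy,
  multiplied by \<open>m\<^sub>i\<^sup>2\<close>, is \<open>O(1/i)\<close>; hence they are inconsistent.\<close>

lemma purely_consistent_imp_low_frequency:
  assumes pc: "purely_consistent M \<xi> \<sigma> \<phi> \<kappa> r f"
  shows "low_frequency f"
proof (rule ccontr)
  assume "\<not> low_frequency f"
  then obtain \<epsilon> where \<epsilon>: "0 < \<epsilon>" and bad: "\<And>a. 2 \<le> a \<Longrightarrow>
      \<exists>n\<ge>1. tail_energy \<phi> (f n) (a * k_index \<kappa> n) > \<epsilon> * real n powr (- 2 * r)"
    unfolding low_frequency_def by (metis not_le)
  \<comment> \<open>Finitely many sample sizes can be absorbed by enlarging \<open>a\<close>, since the tails of each single signal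
    vanish; hence failure for every \<open>a\<close> means failure at arbitrarily large \<open>n\<close>.\<close>
  have later: "\<exists>n>N. tail_energy \<phi> (f n) (a * k_index \<kappa> n) > \<epsilon> * real n powr (- 2 * r)" if a: "2 \<le> a" for a N :: nat
  proof -
    have "\<exists>b. tail_energy \<phi> (f n) b \<le> \<epsilon> * real n powr (- 2 * r)" if n: "n \<in> {1..N}" for n
    proof -
      have "eventually (\<lambda>b. tail_energy \<phi> (f n) b < \<epsilon> * real n powr (- 2 * r)) sequentially"
        using tail_energy_tendsto_0[OF f_L2, of n] n \<epsilon> by (intro order_tendstoD) auto
      then show ?thesis by (auto simp: eventually_sequentially intro: less_imp_le)
    qed
    then obtain b where b: "\<And>n. n \<in> {1..N} \<Longrightarrow> tail_energy \<phi> (f n) (b n) \<le> \<epsilon> * real n powr (- 2 * r)"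
      by metis
    define a' where "a' = a + (\<Sum>n\<in>{1..N}. b n)"
    obtain n where n: "1 \<le> n" "tail_energy \<phi> (f n) (a' * k_index \<kappa> n) > \<epsilon> * real n powr (- 2 * r)"
      using bad[of a'] a by (auto simp: a'_def)
    have k: "1 \<le> k_index \<kappa> n" by (rule k_index_props(1)[OF n(1)])
    have "N < n"
    proof (rule ccontr)
      assume "\<not> N < n"
      then have nN: "n \<in> {1..N}" using n(1) by simp
      have "b n \<le> (\<Sum>n\<in>{1..N}. b n)" using nN by (intro member_le_sum) auto
      also have "\<dots> \<le> a' * k_index \<kappa> n" using k by (simp add: a'_def trans_le_add2 le_trans[OF _ mult_le_mono2[OF k]])
      finally have "tail_energy \<phi> (f n) (a' * k_index \<kappa> n) \<le> tail_energy \<phi> (f n) (b n)"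
        by (rule tail_energy_antimono[OF f_L2[OF n(1)]])
      then show False using b[OF nN] n(2) by linarith
    qed
    moreover have "tail_energy \<phi> (f n) (a' * k_index \<kappa> n) \<le> tail_energy \<phi> (f n) (a * k_index \<kappa> n)"
      by (intro tail_energy_antimono f_L2 n mult_le_mono1) (simp add: a'_def)
    ultimately show ?thesis using n(2) by (intro exI[of _ n]) auto
  qed
  let ?P = "\<lambda>i n. 1 \<le> n \<and> tail_energy \<phi> (f n) ((i + 2) * k_index \<kappa> n) > \<epsilon> * real n powr (- 2 * r)"
  have "\<exists>m. \<forall>i. ?P i (m i) \<and> m i < m (Suc i)"
  proof (rule dependent_nat_choice)
    show "\<exists>n. ?P 0 n" using later[of "0 + 2" 0, OF le_add2] unfolding One_nat_def Suc_le_eq by blast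
    show "\<exists>y. ?P (Suc i) y \<and> x < y" for x i 
      using later[of "Suc i + 2" "max x 0", OF le_add2]
      unfolding One_nat_def Suc_le_eq max_less_iff_conj by blast
  qed
  then obtain m where P: "\<And>i. ?P i (m i)" and "\<And>i. m i < m (Suc i)" by blast
  then have m: "strict_mono m" "\<And>i. 1 \<le> m i" by (auto simp: strict_mono_Suc_iff)
  let ?K = "\<lambda>i. (i + 2) * k_index \<kappa> (m i)"
  define f1 where "f1 i = proj \<phi> (f (m i)) (?K i)" for i
  define f2 where "f2 i = (\<lambda>t. f (m i) t - f1 i t)" for i
  have L: "f1 i \<in> L2" "f2 i \<in> L2" for i
    unfolding f2_def f1_def by (intro L2_diff proj_L2 f_L2 m)+
  obtain D where D: "0 < D"
    "\<And>a n g. 2 \<le> a \<Longrightarrow> 1 \<le> n \<Longrightarrow> g \<in> L2 \<Longrightarrow>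
      (real n)\<^sup>2 * energy n (\<lambda>t. g t - proj \<phi> g (a * k_index \<kappa> n) t) \<le> D / real a * real n powr (2 * r) * (norm_L2 g)\<^sup>2"
    using residual_energy_upper_bound by metis
  have up: "(real (m i))\<^sup>2 * energy (m i) (f2 i) \<le> D * C\<^sup>2 / real (i + 2)" for i
  proof -
    have np: "0 < real (m i)" using m(2)[of i] by simp
    have "(real (m i))\<^sup>2 * energy (m i) (f2 i) \<le> D / real (i + 2) * real (m i) powr (2 * r) * (norm_L2 (f (m i)))\<^sup>2"
      unfolding f2_def f1_def by (intro D m f_L2) auto
    also have "\<dots> \<le> D / real (i + 2) * real (m i) powr (2 * r) * (C\<^sup>2 * real (m i) powr (- 2 * r))"
      using D(1) f_norm_sq[OF m(2)] by (intro mult_left_mono) auto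
    also have "\<dots> = D * C\<^sup>2 / real (i + 2) * (real (m i) powr (2 * r) * real (m i) powr (- 2 * r))"
      by (simp add: field_simps)
    also have "\<dots> = D * C\<^sup>2 / real (i + 2)" using np by (simp add: powr_add[symmetric])
    finally show ?thesis .
  qed
  have "(\<lambda>i. (real (m i))\<^sup>2 * energy (m i) (f2 i)) \<longlonglongrightarrow> 0"
  proof (rule tendsto_sandwich)
    show "eventually (\<lambda>i. 0 \<le> (real (m i))\<^sup>2 * energy (m i) (f2 i)) sequentially"
      by (intro always_eventually allI mult_nonneg_nonneg energy_nonneg m L) auto
    show "eventually (\<lambda>i. (real (m i))\<^sup>2 * energy (m i) (f2 i) \<le> D * C\<^sup>2 / real (i + 2)) sequentially"
      using up by auto
    show "(\<lambda>i. D * C\<^sup>2 / real (i + 2)) \<longlonglongrightarrow> 0"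
      using lim_const_over_n[of "D * C\<^sup>2", THEN LIMSEQ_ignore_initial_segment, of 2] by simp
  qed auto
  then have "inconsistent_along M \<xi> \<sigma> \<phi> \<kappa> m f2"
    by (rule inconsistent_if_energy_vanishes[OF m L(2)])
  moreover have "sqrt \<epsilon> * real (m i) powr (- r) < norm_L2 (f2 i)" for i
  proof -
    have "(sqrt \<epsilon> * real (m i) powr (- r))\<^sup>2 < (norm_L2 (f2 i))\<^sup>2"
      using P[of i] \<epsilon> by (simp add: power_mult_distrib powr_sq tail_energy_def f2_def f1_def)
    then show ?thesis by (rule power2_less_imp_less) simp
  qed
  moreover have "inner_L2 (f1 i) (f2 i) = 0" for i
    unfolding f2_def f1_def by (rule proj_orthogonal_residual[OF f_L2[OF m(2)]])
  moreover have "AE t in leb01. f (m i) t = f1 i t + f2 i t" for i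
    by (simp add: f2_def)
  moreover have "0 < sqrt \<epsilon>" using \<epsilon> by simp
  ultimately show False
    using pc m L unfolding purely_consistent_def by blast
qed

end

theorem theorem4p9:
  fixes r \<sigma> s c C :: real
    and M :: "'w measure" and \<xi> :: "nat \<Rightarrow> 'w \<Rightarrow> real"
    and \<phi> :: "nat \<Rightarrow> real \<Rightarrow> real" and \<kappa> :: "nat \<Rightarrow> nat \<Rightarrow> real"
    and f :: "nat \<Rightarrow> real \<Rightarrow> real"
  assumes "0 < r" "r < 1 / 2" "0 < \<sigma>"
    and "iid_std_normal M \<xi>"
    and "orthonormal_basis_L2 \<phi>"
    and "A1 \<kappa>" "A2 \<sigma> \<kappa>" "A3 r \<kappa>" "A4 \<kappa>" "A5 \<kappa>"
    and "s = r / (2 - 4 * r)"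
    and "0 < c" "c < C"
    and "\<And>n. n \<ge> 1 \<Longrightarrow> f n \<in> L2"
    and "\<And>n. n \<ge> 1 \<Longrightarrow>
           c * real n powr (- r) \<le> norm_L2 (f n) \<and> norm_L2 (f n) \<le> C * real n powr (- r)"
  shows "purely_consistent M \<xi> \<sigma> \<phi> \<kappa> r f \<longleftrightarrow>
    (\<forall>\<epsilon>>0. \<exists>\<gamma>>0. \<exists>f1 :: nat \<Rightarrow> real \<Rightarrow> real. \<forall>n\<ge>1.
       f1 n \<in> Besov_body \<phi> s \<gamma> \<and>
       norm_L2 (\<lambda>t. f n t - f1 n t) \<le> \<epsilon> * real n powr (- r) \<and>
       (norm_L2 (f n))\<^sup>2 = (norm_L2 (f1 n))\<^sup>2 + (norm_L2 (\<lambda>t. f n t - f1 n t))\<^sup>2)"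
proof -
  interpret rate_signals r \<sigma> \<kappa> \<phi> M \<xi> f c C
    using assms by unfold_locales auto
  show ?thesis
  proof
    assume "purely_consistent M \<xi> \<sigma> \<phi> \<kappa> r f"
    then have "low_frequency f" by (rule purely_consistent_imp_low_frequency)
    then show "\<forall>\<epsilon>>0. \<exists>\<gamma>>0. \<exists>f1 :: nat \<Rightarrow> real \<Rightarrow> real. \<forall>n\<ge>1.
       f1 n \<in> Besov_body \<phi> s \<gamma> \<and>
       norm_L2 (\<lambda>t. f n t - f1 n t) \<le> \<epsilon> * real n powr (- r) \<and>
       (norm_L2 (f n))\<^sup>2 = (norm_L2 (f1 n))\<^sup>2 + (norm_L2 (\<lambda>t. f n t - f1 n t))\<^sup>2"
      using low_frequency_imp_Besov[OF \<open>s = r / (2 - 4 * r)\<close>] by blast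
  next
    assume approx: "\<forall>\<epsilon>>0. \<exists>\<gamma>>0. \<exists>f1 :: nat \<Rightarrow> real \<Rightarrow> real. \<forall>n\<ge>1.
       f1 n \<in> Besov_body \<phi> s \<gamma> \<and>
       norm_L2 (\<lambda>t. f n t - f1 n t) \<le> \<epsilon> * real n powr (- r) \<and>
       (norm_L2 (f n))\<^sup>2 = (norm_L2 (f1 n))\<^sup>2 + (norm_L2 (\<lambda>t. f n t - f1 n t))\<^sup>2"
    have "low_frequency f"
      by (rule Besov_imp_low_frequency[OF \<open>s = r / (2 - 4 * r)\<close>]) (use approx in meson)
    then show "purely_consistent M \<xi> \<sigma> \<phi> \<kappa> r f"
      by (rule low_frequency_imp_purely_consistent)
  qed
qed

end
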